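(* Let $x_0+\sum_{k=1}^{\infty} g_k(t)$ be the Taylor expansion associated with the differential equation $$dX_t=\sum_{i=0}^{d}V_i(X_t)\,dy^i_t,\qquad X_0=x_0 .$$ There exists $T>0$ such that for $0\le t<T$ the series $\sum_{k=1}^{\infty}\|g_k(t)\|$ is convergent and $$X_t=x_0+\sum_{k=1}^{\infty}g_k(t).$$
   Context: Standing assumptions: $x_0\in\mathbb{R}^n$; $V_0,\dots,V_d$ are Lipschitz $C^\infty$ vector fields on $\mathbb{R}^n$ with Lipschitz derivatives, and they are analytic on the set $\{x:\|x-x_0\|\le C\}$ for some $C>0$; the driving path $y=(y^0,\dots,y^d):\mathbb{R}_{\ge0}\to\mathbb{R}^{d+1}$ is $\beta$-Hölder continuous with $\beta>1/2$. Integrals against $dy^i$ are Young integrals. Under these assumptions the equation has a unique solution $(X_t)_{t\ge0}$. Taylor expansion: for a word $I=(i_1,\dots,i_k)\in\{0,1,\dots,d\}^k$ of length $|I|=k$, put $$\int_{\triangle^k[0,t]}dy^I=\int_{0\le t_1\le\cdots\le t_k\le t}dy^{i_1}_{t_1}\cdots dy^{i_k}_{t_k},\qquad P_I^j=(V_{i_1}\cdots V_{i_k}\pi^j)(x_0),$$ where $\pi^j(x)=x_j$ is the $j$-th coordinate projection on $\mathbb{R}^n$ and the vector fields act as first-order differential operators. The Taylor expansion associated with the equation is the formal series $x_0+\sum_{k\ge1}g_k(t)$, where $g_k(t)\in\mathbb{R}^n$ has coordinates $g_k^j(t)=\sum_{|I|=k}P_I^j\int_{\triangle^k[0,t]}dy^I$.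 *)

theory Defs
  imports "HOL-Analysis.Analysis"
begin

section \<open>Hoelder continuity and the Young integral\<close>

definition holder_on :: "real \<Rightarrow> real set \<Rightarrow> (real \<Rightarrow> 'a::metric_space) \<Rightarrow> bool" where
  "holder_on \<alpha> S f \<longleftrightarrow>
     \<alpha> > 0 \<and> (\<exists>K. \<forall>s\<in>S. \<forall>t\<in>S. dist (f s) (f t) \<le> K * \<bar>s - t\<bar> powr \<alpha>)"

text \<open>
  The Young integral of \<open>f\<close> against \<open>g\<close> over \<open>[a, b]\<close> is the limit of the Riemann--Stieltjes sums
  of arbitrarily tagged partitions as the mesh tends to zero, for Hoelder integrand and integrator
  whose exponents sum to more than one.  The gauge below has constant radius, so the limit is of
  Riemann type and not of Henstock--Kurzweil type.
\<close>

definition has_young_integral ::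
  "(real \<Rightarrow> 'a::real_normed_vector) \<Rightarrow> (real \<Rightarrow> real) \<Rightarrow> real \<Rightarrow> real \<Rightarrow> 'a \<Rightarrow> bool" where
  "has_young_integral f g a b I \<longleftrightarrow>
     (\<exists>\<alpha> \<beta>. \<alpha> + \<beta> > 1 \<and> holder_on \<alpha> {a..b} f \<and> holder_on \<beta> {a..b} g) \<and>
     (\<forall>e>0. \<exists>\<delta>>0. \<forall>p. p tagged_division_of {a..b} \<and> (\<lambda>x. ball x \<delta>) fine p \<longrightarrow>
        norm ((\<Sum>(x, K)\<in>p. (g (Sup K) - g (Inf K)) *\<^sub>R f x) - I) < e)"

definition young_integrable ::
  "(real \<Rightarrow> 'a::real_normed_vector) \<Rightarrow> (real \<Rightarrow> real) \<Rightarrow> real \<Rightarrow> real \<Rightarrow> bool" where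
  "young_integrable f g a b \<longleftrightarrow> (\<exists>I. has_young_integral f g a b I)"

definition young_integral ::
  "(real \<Rightarrow> 'a::real_normed_vector) \<Rightarrow> (real \<Rightarrow> real) \<Rightarrow> real \<Rightarrow> real \<Rightarrow> 'a" where
  "young_integral f g a b = (THE I. has_young_integral f g a b I)"

section \<open>Smooth and real-analytic maps\<close>

primrec C_k :: "nat \<Rightarrow> ('a::euclidean_space \<Rightarrow> 'b::real_normed_vector) \<Rightarrow> bool" where
  "C_k 0 f \<longleftrightarrow> continuous_on UNIV f"
| "C_k (Suc k) f \<longleftrightarrow>
     (\<forall>x. f differentiable (at x)) \<and> (\<forall>v. C_k k (\<lambda>x. frechet_derivative f (at x) v))"

definition C_infinity :: "('a::euclidean_space \<Rightarrow> 'b::real_normed_vector) \<Rightarrow> bool" where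
  "C_infinity f \<longleftrightarrow> (\<forall>k. C_k k f)"

text \<open>
  Around every point of \<open>S\<close> the map is the sum of a power series in the \<open>n\<close> coordinates;
  \<open>\<nu>\<close> ranges over multi-indices.
\<close>

definition real_analytic_on ::
  "(real ^ 'n \<Rightarrow> 'b::real_normed_vector) \<Rightarrow> (real ^ 'n) set \<Rightarrow> bool" where
  "real_analytic_on f S \<longleftrightarrow>
     (\<forall>a\<in>S. \<exists>r>0. \<exists>c :: ('n \<Rightarrow> nat) \<Rightarrow> 'b. \<forall>x\<in>ball a r.
        ((\<lambda>\<nu>. (\<Prod>i\<in>UNIV. (x $ i - a $ i) ^ \<nu> i) *\<^sub>R c \<nu>) has_sum f x) UNIV)"

section \<open>Differential equations driven by a path and their Taylor expansion\<close>

text \<open>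
  The finite type \<open>'m\<close> plays the role of the index set \<open>{0, \<dots>, d}\<close>.  The initial condition
  \<open>X 0 = x0\<close> is the case \<open>t = 0\<close>.
\<close>

definition young_ode_solution ::
  "('m::finite \<Rightarrow> real ^ 'n \<Rightarrow> real ^ 'n) \<Rightarrow> (real \<Rightarrow> real ^ 'm) \<Rightarrow> real ^ 'n
    \<Rightarrow> (real \<Rightarrow> real ^ 'n) \<Rightarrow> bool" where
  "young_ode_solution V y x0 X \<longleftrightarrow>
     (\<forall>t\<ge>0. (\<forall>i. young_integrable (\<lambda>s. V i (X s)) (\<lambda>s. y s $ i) 0 t) \<and>
        X t = x0 + (\<Sum>i\<in>UNIV. young_integral (\<lambda>s. V i (X s)) (\<lambda>s. y s $ i) 0 t))"

definition vf_apply ::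
  "(real ^ 'n \<Rightarrow> real ^ 'n) \<Rightarrow> (real ^ 'n \<Rightarrow> real) \<Rightarrow> real ^ 'n \<Rightarrow> real" where
  "vf_apply W f = (\<lambda>x. \<Sum>j\<in>UNIV. W x $ j * frechet_derivative f (at x) (axis j 1))"

text \<open>
  The integral over \<open>0 \<le> t\<^sub>1 \<le> \<dots> \<le> t\<^sub>k \<le> t\<close> as an iterated Young integral: the first letter of the
  word is integrated innermost, the last letter outermost.
\<close>

definition iterated_integral :: "(real \<Rightarrow> real ^ 'm) \<Rightarrow> 'm list \<Rightarrow> real \<Rightarrow> real" where
  "iterated_integral y I = foldl (\<lambda>F i t. young_integral F (\<lambda>s. y s $ i) 0 t) (\<lambda>_. 1) I"

text \<open>The word \<open>[i\<^sub>1, \<dots>, i\<^sub>k]\<close> gives \<open>(V\<^sub>i\<^sub>1 (\<dots> (V\<^sub>i\<^sub>k \<pi>\<^sup>j)))(x0)\<close>.\<close>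

definition taylor_coeff ::
  "('m \<Rightarrow> real ^ 'n \<Rightarrow> real ^ 'n) \<Rightarrow> real ^ 'n \<Rightarrow> 'm list \<Rightarrow> 'n \<Rightarrow> real" where
  "taylor_coeff V x0 I j = foldr (\<lambda>i. vf_apply (V i)) I (\<lambda>x. x $ j) x0"

definition taylor_term ::
  "('m::finite \<Rightarrow> real ^ 'n \<Rightarrow> real ^ 'n) \<Rightarrow> (real \<Rightarrow> real ^ 'm) \<Rightarrow> real ^ 'n
    \<Rightarrow> nat \<Rightarrow> real \<Rightarrow> real ^ 'n" where
  "taylor_term V y x0 k t =
     (\<chi> j. \<Sum>I | length I = k. taylor_coeff V x0 I j * iterated_integral y I t)"

end

theory Submission
  imports Defs
begin

text \<open>
  The coefficients of the words of length \<open>k\<close> may grow like \<open>k!\<close> while the iterated integrals decay only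
  like \<open>(k!)\<^sup>-\<^sup>\<beta>\<close>, so the words cannot be bounded one by one.  For smooth \<open>f\<close> let \<open>E\<^sub>k f\<close> be the sum over \<open>|I| = k\<close> of
  \<open>(V\<^sub>I f)(x0)\<close> times the iterated integral of \<open>I\<close>.  Since vector fields are derivations and Young integrals
  satisfy integration by parts, \<open>E\<^sub>k (f g)\<close> is the Cauchy product of the \<open>E\<^sub>a f\<close> and \<open>E\<^sub>b g\<close>.  Moreover
  \<open>E\<^sub>k f\<close> depends only on the \<open>k\<close>-jet of \<open>f\<close> at \<open>x0\<close>, and \<open>g\<^sub>k\<^sub>+\<^sub>1 = \<Sum>\<^sub>i \<integral> E\<^sub>k (V\<^sub>i) dy\<^sup>i\<close>.  Expanding \<open>V\<^sub>i\<close> as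
  a power series thus bounds the Hoelder norms of \<open>g\<^sub>k\<^sub>+\<^sub>1\<close> by those of \<open>g\<^sub>1, \<dots>, g\<^sub>k\<close> through a majorant
  series, and on a short interval, where the Young integral has small norm and the Hoelder norm is
  submultiplicative, the partial sums of the norms stay below the radius \<open>\<rho>\<close>.  The sum of the series
  solves the equation, and the solution is unique on a short interval.

  All identities between Young integrals are reduced to local expansions: an increment of a function that
  is \<open>O(\<bar>t - s\<bar>\<^sup>\<theta>)\<close> with \<open>\<theta> > 1\<close> vanishes.
\<close>

section \<open>Sewing and the Young integral\<close>

text \<open>The smallness of integrals comes from an exponent \<alpha> strictly below the exponent
  \<beta> of the driver: integration against \<open>y\<close> produces \<beta>-Hoelder functions,
  and measuring them with exponent \<alpha> on \<open>[0, T]\<close> gains a factor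
  \<open>T powr (\<beta> - \<alpha>)\<close>. Sewing asks for \<alpha> + \<beta> > 1; because
  \<beta> > 1/2, the value \<alpha> = 1/2 meets both demands. For small T the bound \<rho> then
  reproduces itself: if the coordinate terms up to degree N have total norm at most \<rho>, the
  majorant series bounds those of the fields by a constant independent of N, and one integration,
  which raises the degree by one, leads back to \<rho> for N + 1. No single coefficient is ever
  estimated, so no factorial appears. The coordinates are centred at \<open>x0\<close>, so that
  their degree 0 terms vanish and the bound can be as small as the radius of analyticity demands.
  Uniqueness is a contraction in the Hoelder norm rather than in the supremum norm; increments of
  \<open>V i (X t) - V i (Z t)\<close> are then second differences of \<open>V i\<close>, which is
  where the Lipschitz derivatives enter.\<close>

definition sewing_const :: "real \<Rightarrow> real" where
  "sewing_const \<theta> = 1 / (1 - 2 powr (1 - \<theta>))"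

lemma sewing_const_pos: "\<theta> > 1 \<Longrightarrow> sewing_const \<theta> > 0"
  unfolding sewing_const_def by (simp add: powr_less_one)

text \<open>Bisect \<open>[s, t]\<close> repeatedly. The a priori bounds on the pieces sum to a
  multiple of \<open>2 powr (n * (1 - \<theta>'))\<close>, which tends to 0, while the defects at
  level k contribute at most \<open>A * (t - s) powr \<theta>\<close> times
  \<open>2 powr (k * (1 - \<theta>))\<close>; \<open>sewing_const\<close> is the sum of this
  geometric series. Neither \<open>B\<close> nor \<theta>' survives in the conclusion, which is how
  a qualitative remainder becomes a quantitative one.\<close>

lemma sewing_bound:
  fixes R :: "real \<Rightarrow> real \<Rightarrow> 'a::real_normed_vector"
  assumes th: "\<theta> > 1" and th': "\<theta>' > 1" and A: "A \<ge> 0"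
    and apriori: "\<And>s t. \<lbrakk>a \<le> s; s \<le> t; t \<le> b\<rbrakk> \<Longrightarrow> norm (R s t) \<le> B * (t - s) powr \<theta>'"
    and delta: "\<And>s m t. \<lbrakk>a \<le> s; s \<le> m; m \<le> t; t \<le> b\<rbrakk> \<Longrightarrow>
        norm (R s t - R s m - R m t) \<le> A * (t - s) powr \<theta>"
    and st: "a \<le> s" "s \<le> t" "t \<le> b"
  shows "norm (R s t) \<le> sewing_const \<theta> * A * (t - s) powr \<theta>"
proof -
  define r where "r = (2::real) powr (1 - \<theta>)"
  define r' where "r' = (2::real) powr (1 - \<theta>')"
  have r: "0 < r" "r < 1" and r': "0 < r'" "r' < 1"
    using th th' by (auto simp: r_def r'_def powr_less_one)
  have bisect: "norm (R s t) \<le> r' ^ n * (B * (t - s) powr \<theta>') + (\<Sum>k<n. r ^ k) * A * (t - s) powr \<theta>"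
    if "a \<le> s" "s \<le> t" "t \<le> b" for n s t
    using that
  proof (induction n arbitrary: s t)
    case 0
    then show ?case using apriori by simp
  next
    case (Suc n)
    define m where "m = (s + t) / 2"
    have m: "s \<le> m" "m \<le> t" "m - s = (t - s) / 2" "t - m = (t - s) / 2"
      using Suc.prems by (auto simp: m_def field_simps)
    have half: "2 * ((t - s) / 2) powr p = 2 powr (1 - p) * (t - s) powr p" for p
      using Suc.prems by (simp add: powr_divide powr_diff)
    have "norm (R s t) \<le> norm (R s m) + norm (R m t) + norm (R s t - R s m - R m t)"
      by norm
    also have "\<dots> \<le> 2 * (r' ^ n * (B * ((t - s) / 2) powr \<theta>') + (\<Sum>k<n. r ^ k) * A * ((t - s) / 2) powr \<theta>)
        + A * (t - s) powr \<theta>"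
      using Suc.IH[of s m] Suc.IH[of m t] delta[of s m t] m Suc.prems by auto
    also have "\<dots> = r' ^ n * B * (2 * ((t - s) / 2) powr \<theta>') + (\<Sum>k<n. r ^ k) * A * (2 * ((t - s) / 2) powr \<theta>)
        + A * (t - s) powr \<theta>"
      by (simp add: algebra_simps)
    also have "\<dots> = r' ^ Suc n * (B * (t - s) powr \<theta>') + (r * (\<Sum>k<n. r ^ k) + 1) * A * (t - s) powr \<theta>"
      unfolding half r_def[symmetric] r'_def[symmetric] by (simp add: algebra_simps)
    also have "r * (\<Sum>k<n. r ^ k) + 1 = (\<Sum>k<Suc n. r ^ k)"
      by (simp add: sum.lessThan_Suc_shift sum_distrib_left del: sum.lessThan_Suc)
    finally show ?case .
  qed
  have "(\<lambda>n. r' ^ n * (B * (t - s) powr \<theta>') + (\<Sum>k<n. r ^ k) * A * (t - s) powr \<theta>)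
      \<longlonglongrightarrow> 0 * (B * (t - s) powr \<theta>') + (1 / (1 - r)) * A * (t - s) powr \<theta>"
    using r r' geometric_sums[of r]
    by (intro tendsto_intros LIMSEQ_power_zero) (auto simp: sums_def)
  then have "norm (R s t) \<le> 0 * (B * (t - s) powr \<theta>') + (1 / (1 - r)) * A * (t - s) powr \<theta>"
    by (rule LIMSEQ_le_const) (use bisect[OF st] in blast)
  then show ?thesis by (simp add: sewing_const_def r_def)
qed

section \<open>Two-parameter remainders of order above one\<close>

text \<open>Exponent and constant are existential, so that remainders can be added without
  bookkeeping; \<open>sewing_bound\<close> recovers explicit ones where an estimate is
  wanted.\<close>

definition negligible_on :: "real \<Rightarrow> (real \<Rightarrow> real \<Rightarrow> 'a::real_normed_vector) \<Rightarrow> bool" where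
  "negligible_on T R \<longleftrightarrow>
     (\<exists>\<theta>>1. \<exists>B\<ge>0. \<forall>s t. 0 \<le> s \<longrightarrow> s \<le> t \<longrightarrow> t \<le> T \<longrightarrow> norm (R s t) \<le> B * (t - s) powr \<theta>)"

lemma negligible_onI:
  assumes "\<theta> > 1" "\<And>s t. \<lbrakk>0 \<le> s; s \<le> t; t \<le> T\<rbrakk> \<Longrightarrow> norm (R s t) \<le> B * (t - s) powr \<theta>"
  shows "negligible_on T R"
  unfolding negligible_on_def
proof (intro exI conjI allI impI)
  fix s t assume "0 \<le> s" "s \<le> t" "t \<le> T"
  then have "norm (R s t) \<le> B * (t - s) powr \<theta>" by (rule assms)
  also have "\<dots> \<le> max B 0 * (t - s) powr \<theta>" by (intro mult_right_mono) auto
  finally show "norm (R s t) \<le> max B 0 * (t - s) powr \<theta>" .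
qed (use assms in auto)

lemma negligible_on_cong:
  assumes "\<And>s t. \<lbrakk>0 \<le> s; s \<le> t; t \<le> T\<rbrakk> \<Longrightarrow> R s t = R' s t"
  shows "negligible_on T R \<longleftrightarrow> negligible_on T R'"
  unfolding negligible_on_def using assms by (metis (mono_tags, lifting))

lemma negligible_on_mono: "negligible_on T R \<Longrightarrow> T' \<le> T \<Longrightarrow> negligible_on T' R"
  unfolding negligible_on_def by (meson order_trans)

lemma negligible_on_bounded_mult:
  assumes "negligible_on T R" "\<And>s t. \<lbrakk>0 \<le> s; s \<le> t; t \<le> T\<rbrakk> \<Longrightarrow> norm (R' s t) \<le> c * norm (R s t)" "c \<ge> 0"
  shows "negligible_on T R'"
proof -
  obtain \<theta> B where *: "\<theta> > 1" "\<And>s t. \<lbrakk>0 \<le> s; s \<le> t; t \<le> T\<rbrakk> \<Longrightarrow> norm (R s t) \<le> B * (t - s) powr \<theta>"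
    using assms(1) unfolding negligible_on_def by blast
  show ?thesis
  proof (rule negligible_onI[OF *(1), where B = "c * B"])
    fix s t assume st: "0 \<le> s" "s \<le> t" "t \<le> T"
    have "norm (R' s t) \<le> c * norm (R s t)" by (rule assms(2)[OF st])
    also have "\<dots> \<le> c * (B * (t - s) powr \<theta>)" using *(2)[OF st] assms(3) by (rule mult_left_mono)
    finally show "norm (R' s t) \<le> c * B * (t - s) powr \<theta>" by simp
  qed
qed

text \<open>Trades a higher exponent for a lower one. The factor \<open>T powr (q - p)\<close> is
  the smallness in \<open>integral_gain\<close> (q = \<beta>, p = \<alpha>) and in the convergence
  of Riemann sums (q = \<theta>, p = 1).\<close>

lemma powr_le_rescale:
  fixes h T p q :: real
  assumes "0 \<le> h" "h \<le> T" "p \<le> q"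
  shows "h powr q \<le> T powr (q - p) * h powr p"
proof (cases "h = 0")
  case False
  then have "h powr q = h powr (q - p) * h powr p" using assms by (simp flip: powr_add)
  also have "\<dots> \<le> T powr (q - p) * h powr p"
    using assms by (intro mult_right_mono powr_mono2) auto
  finally show ?thesis .
qed simp

lemma negligible_on_exponent:
  assumes "\<theta>1 \<ge> \<theta>" "B \<ge> 0" "\<And>s t. \<lbrakk>0 \<le> s; s \<le> t; t \<le> T\<rbrakk> \<Longrightarrow> norm (R s t) \<le> B * (t - s) powr \<theta>1"
    and st: "0 \<le> s" "s \<le> t" "t \<le> T"
  shows "norm (R s t) \<le> (B * T powr (\<theta>1 - \<theta>)) * (t - s) powr \<theta>"
proof -
  have "norm (R s t) \<le> B * (t - s) powr \<theta>1" using assms by blast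
  also have "\<dots> \<le> B * (T powr (\<theta>1 - \<theta>) * (t - s) powr \<theta>)"
    using st assms by (intro mult_left_mono powr_le_rescale) auto
  finally show ?thesis by (simp add: mult.assoc)
qed

lemma negligible_on_add:
  fixes R R' :: "real \<Rightarrow> real \<Rightarrow> 'a::real_normed_vector"
  assumes "negligible_on T R" "negligible_on T R'"
  shows "negligible_on T (\<lambda>s t. R s t + R' s t)"
proof -
  obtain \<theta>1 B1 where 1: "\<theta>1 > 1" "B1 \<ge> 0"
      "\<And>s t. \<lbrakk>0 \<le> s; s \<le> t; t \<le> T\<rbrakk> \<Longrightarrow> norm (R s t) \<le> B1 * (t - s) powr \<theta>1"
    using assms(1) unfolding negligible_on_def by blast
  obtain \<theta>2 B2 where 2: "\<theta>2 > 1" "B2 \<ge> 0"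
      "\<And>s t. \<lbrakk>0 \<le> s; s \<le> t; t \<le> T\<rbrakk> \<Longrightarrow> norm (R' s t) \<le> B2 * (t - s) powr \<theta>2"
    using assms(2) unfolding negligible_on_def by blast
  define \<theta> where "\<theta> = min \<theta>1 \<theta>2"
  show ?thesis
  proof (rule negligible_onI[where \<theta> = \<theta> and B = "B1 * T powr (\<theta>1 - \<theta>) + B2 * T powr (\<theta>2 - \<theta>)"])
    fix s t assume st: "0 \<le> s" "s \<le> t" "t \<le> T"
    have "norm (R s t) \<le> (B1 * T powr (\<theta>1 - \<theta>)) * (t - s) powr \<theta>"
      by (rule negligible_on_exponent[OF _ 1(2,3) st]) (auto simp: \<theta>_def)
    moreover have "norm (R' s t) \<le> (B2 * T powr (\<theta>2 - \<theta>)) * (t - s) powr \<theta>"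
      by (rule negligible_on_exponent[OF _ 2(2,3) st]) (auto simp: \<theta>_def)
    ultimately show "norm (R s t + R' s t) \<le> (B1 * T powr (\<theta>1 - \<theta>) + B2 * T powr (\<theta>2 - \<theta>)) * (t - s) powr \<theta>"
      unfolding distrib_right by (rule norm_triangle_mono)
  qed (use 1 2 in \<open>auto simp: \<theta>_def\<close>)
qed

lemma negligible_on_0: "negligible_on T (\<lambda>s t. 0)"
  by (rule negligible_onI[where \<theta> = 2 and B = 0]) auto

lemma negligible_on_scaleR: "negligible_on T R \<Longrightarrow> negligible_on T (\<lambda>s t. c *\<^sub>R R s t)"
  by (erule negligible_on_bounded_mult[where c = "\<bar>c\<bar>"]) auto

lemma negligible_on_diff:
  "negligible_on T R \<Longrightarrow> negligible_on T R' \<Longrightarrow> negligible_on T (\<lambda>s t. R s t - R' s t)"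
  using negligible_on_add[of T R "\<lambda>s t. (-1) *\<^sub>R R' s t"] negligible_on_scaleR[of T R' "-1"] by simp

lemma negligible_on_sum:
  assumes "\<And>i. i \<in> I \<Longrightarrow> negligible_on T (R i)"
  shows "negligible_on T (\<lambda>s t. \<Sum>i\<in>I. R i s t)"
  using assms by (induction I rule: infinite_finite_induct) (auto intro: negligible_on_add negligible_on_0)

text \<open>Increments are additive over adjacent intervals, so \<open>sewing_bound\<close> applies
  with A = 0.\<close>

lemma negligible_increment_imp_const:
  assumes "negligible_on T (\<lambda>s t. F t - F s)" "0 \<le> t" "t \<le> T"
  shows "F t = F 0"
proof -
  obtain \<theta> B where *: "\<theta> > 1" "\<And>s t. \<lbrakk>0 \<le> s; s \<le> t; t \<le> T\<rbrakk> \<Longrightarrow> norm (F t - F s) \<le> B * (t - s) powr \<theta>"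
    using assms(1) unfolding negligible_on_def by blast
  have "norm (F t - F 0) \<le> sewing_const \<theta> * 0 * (t - 0) powr \<theta>"
    by (rule sewing_bound[where a = 0 and b = T and \<theta>' = \<theta> and B = B and R = "\<lambda>s t. F t - F s"])
       (use * assms in auto)
  then show ?thesis by simp
qed


section \<open>Existence of Young primitives\<close>

text \<open>The defect of the remainder at m is exactly \<open>(f m - f s) * (g t - g m)\<close>, of
  order \<alpha> + \<gamma>. The resulting constant depends only on the Hoelder constants of
  \<open>f\<close> and \<open>g\<close> and not on the one hidden in \<open>neg\<close>, which makes
  it uniform along approximating sequences.\<close>

lemma young_remainder_bound:
  fixes f g F :: "real \<Rightarrow> real"
  assumes "\<alpha> > 0" "\<gamma> > 0" "\<alpha> + \<gamma> > 1" "q \<ge> 0" "\<eta> \<ge> 0"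
    and f: "\<And>s t. \<lbrakk>0 \<le> s; s \<le> t; t \<le> T\<rbrakk> \<Longrightarrow> \<bar>f t - f s\<bar> \<le> q * (t - s) powr \<alpha>"
    and g: "\<And>s t. \<lbrakk>0 \<le> s; s \<le> t; t \<le> T\<rbrakk> \<Longrightarrow> \<bar>g t - g s\<bar> \<le> \<eta> * (t - s) powr \<gamma>"
    and neg: "negligible_on T (\<lambda>s t. F t - F s - f s * (g t - g s))"
    and st: "0 \<le> s" "s \<le> t" "t \<le> T"
  shows "\<bar>F t - F s - f s * (g t - g s)\<bar> \<le> sewing_const (\<alpha> + \<gamma>) * (q * \<eta>) * (t - s) powr (\<alpha> + \<gamma>)"
proof -
  obtain \<theta>' B where *: "\<theta>' > 1" "\<And>s t. \<lbrakk>0 \<le> s; s \<le> t; t \<le> T\<rbrakk> \<Longrightarrow>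
      norm (F t - F s - f s * (g t - g s)) \<le> B * (t - s) powr \<theta>'"
    using neg unfolding negligible_on_def by blast
  have "norm (F t - F s - f s * (g t - g s)) \<le> sewing_const (\<alpha> + \<gamma>) * (q * \<eta>) * (t - s) powr (\<alpha> + \<gamma>)"
  proof (rule sewing_bound[where a = 0 and b = T and B = B and \<theta>' = \<theta>'
        and R = "\<lambda>s t. F t - F s - f s * (g t - g s)"])
    fix s m t assume smt: "0 \<le> s" "s \<le> m" "m \<le> t" "t \<le> T"
    have "\<bar>f m - f s\<bar> * \<bar>g t - g m\<bar> \<le> (q * (t - s) powr \<alpha>) * (\<eta> * (t - s) powr \<gamma>)"
    proof (intro mult_mono)
      have "\<bar>f m - f s\<bar> \<le> q * (m - s) powr \<alpha>" using f smt by auto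
      also have "\<dots> \<le> q * (t - s) powr \<alpha>"
        using smt assms by (intro mult_left_mono powr_mono2) auto
      finally show "\<bar>f m - f s\<bar> \<le> q * (t - s) powr \<alpha>" .
      have "\<bar>g t - g m\<bar> \<le> \<eta> * (t - m) powr \<gamma>" using g smt by auto
      also have "\<dots> \<le> \<eta> * (t - s) powr \<gamma>"
        using smt assms by (intro mult_left_mono powr_mono2) auto
      finally show "\<bar>g t - g m\<bar> \<le> \<eta> * (t - s) powr \<gamma>" .
    qed (use assms in auto)
    moreover have "(F t - F s - f s * (g t - g s)) - (F m - F s - f s * (g m - g s))
        - (F t - F m - f m * (g t - g m)) = (f m - f s) * (g t - g m)"
      by (simp add: algebra_simps)
    ultimately show "norm ((F t - F s - f s * (g t - g s)) - (F m - F s - f s * (g m - g s))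
        - (F t - F m - f m * (g t - g m))) \<le> q * \<eta> * (t - s) powr (\<alpha> + \<gamma>)"
      by (simp add: abs_mult powr_add mult_ac)
  qed (fact st | use assms(3-5) * in simp)+
  then show ?thesis by simp
qed

lemma continuous_imp_antiderivative:
  fixes f :: "real \<Rightarrow> real"
  assumes "continuous_on UNIV f"
  obtains F where "\<And>x. x \<in> {a..b} \<Longrightarrow> (F has_real_derivative f x) (at x)"
proof -
  \<comment> \<open>On the enlarged interval the derivatives at a and b are two-sided.\<close>
  obtain F where F: "\<And>x. x \<in> {a - 1..b + 1} \<Longrightarrow> (F has_vector_derivative f x) (at x within {a - 1..b + 1})"
    using antiderivative_continuous[of "a - 1" "b + 1" f] continuous_on_subset[OF assms] by auto
  have "(F has_real_derivative f x) (at x)" if "x \<in> {a..b}" for x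
  proof -
    have "at x within {a - 1..b + 1} = at x"
      using that by (intro at_within_interior) (auto simp: interior_atLeastAtMost_real)
    then show ?thesis using F[of x] that by (simp add: has_real_derivative_iff_has_vector_derivative)
  qed
  then show ?thesis using that by blast
qed

lemma increment_le_deriv_bound:
  fixes F :: "real \<Rightarrow> real"
  assumes "a \<le> b" "\<And>x. x \<in> {a..b} \<Longrightarrow> (F has_real_derivative F' x) (at x)"
    and "\<And>x. x \<in> {a..b} \<Longrightarrow> \<bar>F' x\<bar> \<le> B"
  shows "\<bar>F b - F a\<bar> \<le> B * (b - a)"
  using field_differentiable_bound[of "{a..b}" F F' B b a] assms has_field_derivative_at_within
  by fastforce

lemma holder_imp_continuous:
  fixes f :: "real \<Rightarrow> real"
  assumes "\<alpha> > 0" and f: "\<And>s t. \<bar>f s - f t\<bar> \<le> q * \<bar>s - t\<bar> powr \<alpha>"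
  shows "continuous_on UNIV f"
proof -
  have "isCont f x" for x
  proof -
    have "((\<lambda>y. q * \<bar>y - x\<bar> powr \<alpha>) \<longlongrightarrow> q * \<bar>x - x\<bar> powr \<alpha>) (at x)"
      using assms(1) by (intro tendsto_intros tendsto_powr') auto
    then have "((\<lambda>y. q * \<bar>y - x\<bar> powr \<alpha>) \<longlongrightarrow> 0) (at x)" by simp
    moreover have "\<forall>\<^sub>F y in at x. norm (f y - f x) \<le> q * \<bar>y - x\<bar> powr \<alpha>"
      using f by (simp add: always_eventually)
    ultimately have "((\<lambda>y. f y - f x) \<longlongrightarrow> 0) (at x)"
      by (rule Lim_null_comparison[rotated])
    then show ?thesis unfolding isCont_def by (rule Lim_null[THEN iffD2])
  qed
  then show ?thesis by (simp add: continuous_at_imp_continuous_on)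
qed

text \<open>
  The integrator is replaced by its moving averages \<open>G n\<close>, which are differentiable and inherit its
  Hoelder constant.  Interpolating between that constant and the uniform distance, they form a Cauchy
  sequence in every smaller Hoelder exponent \<open>\<gamma>\<close>, and hence so do the classical integrals against them.
\<close>

lemma young_primitive_exists_global:
  fixes f g :: "real \<Rightarrow> real"
  assumes \<alpha>: "\<alpha> > 0" and \<beta>: "\<beta> > 0" and \<alpha>\<beta>: "\<alpha> + \<beta> > 1" and q: "q \<ge> 0" and K: "K \<ge> 0" and T: "T \<ge> 0"
    and f: "\<And>s t. \<bar>f s - f t\<bar> \<le> q * \<bar>s - t\<bar> powr \<alpha>"
    and g: "\<And>s t. \<bar>g s - g t\<bar> \<le> K * \<bar>s - t\<bar> powr \<beta>"
  shows "\<exists>F. negligible_on T (\<lambda>s t. F t - F s - f s * (g t - g s))"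
proof -
  note cont = holder_imp_continuous[OF \<alpha> f] holder_imp_continuous[OF \<beta> g]
  \<comment> \<open>The extra unit of length makes room for the averaging windows
    \<open>[t, t + e n]\<close> with \<open>e n \<le> 1\<close>.\<close>
  obtain P where P: "\<And>x. x \<in> {0..T + 1} \<Longrightarrow> (P has_real_derivative g x) (at x)"
    using continuous_imp_antiderivative[OF cont(2), of 0 "T + 1"] by blast
  have P': "((\<lambda>v. P (c + v)) has_real_derivative g (c + v)) (at v)" if "c + v \<in> {0..T+1}" for c v
    using DERIV_shift[of P "g (c + v)" v c] P[OF that] by (simp add: add.commute)
  define e :: "nat \<Rightarrow> real" where "e n = 1 / (real n + 1)" for n
  have e: "0 < e n" "e n \<le> 1" for n by (auto simp: e_def)
  define G where "G n t = (P (t + e n) - P t) / e n" for n t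
  define dG where "dG n u = (g (u + e n) - g u) / e n" for n u
  have G_holder: "\<bar>G n t - G n s\<bar> \<le> K * \<bar>t - s\<bar> powr \<beta>" if "s \<in> {0..T}" "t \<in> {0..T}" for n s t
  proof -
    have "\<bar>(P (t + e n) - P (s + e n)) - (P (t + 0) - P (s + 0))\<bar> \<le> (K * \<bar>t - s\<bar> powr \<beta>) * (e n - 0)"
      using e[of n] that
      by (intro increment_le_deriv_bound[where F = "\<lambda>v. P (t + v) - P (s + v)"
            and F' = "\<lambda>v. g (t + v) - g (s + v)"] DERIV_diff P')
         (auto intro: order_trans[OF g])
    then show ?thesis using e[of n] by (simp add: G_def field_simps flip: diff_divide_distrib add_divide_distrib)
  qed
  have G_approx: "\<bar>G n t - g t\<bar> \<le> K * e n powr \<beta>" if "t \<in> {0..T}" for n t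
  proof -
    have "\<bar>(P (t + e n) - e n * g t) - (P (t + 0) - 0 * g t)\<bar> \<le> (K * e n powr \<beta>) * (e n - 0)"
    proof (rule increment_le_deriv_bound[where F = "\<lambda>v. P (t + v) - v * g t"
            and F' = "\<lambda>v. g (t + v) - g t"])
      fix v assume v: "v \<in> {0..e n}"
      show "((\<lambda>v. P (t + v) - v * g t) has_real_derivative g (t + v) - g t) (at v)"
        using v that e[of n] by (auto intro!: derivative_eq_intros P')
      have "\<bar>g (t + v) - g t\<bar> \<le> K * \<bar>v\<bar> powr \<beta>" using g[of "t + v" t] by simp
      also have "\<dots> \<le> K * e n powr \<beta>" using v K \<beta> by (intro mult_left_mono powr_mono2) auto
      finally show "\<bar>g (t + v) - g t\<bar> \<le> K * e n powr \<beta>" .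
    qed (use e[of n] in auto)
    moreover have "(P (t + e n) - e n * g t) - (P (t + 0) - 0 * g t) = e n * (G n t - g t)"
      using e[of n] by (simp add: G_def field_simps)
    ultimately show ?thesis using e[of n] by (simp add: abs_mult mult.commute)
  qed
  have G_deriv: "(G n has_real_derivative dG n u) (at u)" if "u \<in> {0..T}" for n u
  proof -
    have "((\<lambda>v. P (v + e n)) has_real_derivative g (u + e n)) (at u)"
      using P'[of "e n" u] e[of n] that by (simp add: add.commute)
    then show ?thesis
      unfolding G_def dG_def using that by (intro DERIV_cdivide DERIV_diff P) auto
  qed
  have dG_bound: "\<bar>dG n u\<bar> \<le> K * e n powr \<beta> / e n" for n u
    using g[of "u + e n" u] e[of n] by (simp add: dG_def field_simps)
  have "\<exists>F. F 0 = 0 \<and> (\<forall>u\<in>{0..T}. (F has_real_derivative f u * dG n u) (at u))" for n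
  proof -
    have "continuous_on UNIV (\<lambda>u. f u * dG n u)"
      unfolding dG_def using e[of n]
      by (intro continuous_intros cont continuous_on_compose2[OF cont(2)]) auto
    then obtain F where F: "\<And>u. u \<in> {0..T} \<Longrightarrow> (F has_real_derivative f u * dG n u) (at u)"
      using continuous_imp_antiderivative by blast
    show ?thesis
      by (rule exI[where x = "\<lambda>u. F u - F 0"]) (auto intro!: derivative_eq_intros F)
  qed
  then obtain F where F0: "\<And>n. F n 0 = 0"
    and F: "\<And>n u. u \<in> {0..T} \<Longrightarrow> (F n has_real_derivative f u * dG n u) (at u)" by metis
  \<comment> \<open>The constant here may blow up with n. Only negligibility matters, since
    \<open>young_remainder_bound\<close> then supplies the constant of \<open>F_bound\<close>, which
    is uniform in n.\<close>
  have negl: "negligible_on T (\<lambda>s t. F n t - F n s - f s * (G n t - G n s))" for n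
  proof (rule negligible_onI[where \<theta> = "1 + \<alpha>" and B = "q * (K * e n powr \<beta> / e n)"])
    fix s t assume st: "0 \<le> s" "s \<le> t" "t \<le> T"
    have bound: "\<bar>(F n t - f s * G n t) - (F n s - f s * G n s)\<bar>
        \<le> (q * (t - s) powr \<alpha>) * (K * e n powr \<beta> / e n) * (t - s)"
    proof (rule increment_le_deriv_bound[where F = "\<lambda>u. F n u - f s * G n u"
            and F' = "\<lambda>u. (f u - f s) * dG n u"])
      fix u assume u: "u \<in> {s..t}"
      show "((\<lambda>u. F n u - f s * G n u) has_real_derivative (f u - f s) * dG n u) (at u)"
        using DERIV_diff[OF F[of u n] DERIV_cmult[OF G_deriv[of u n], of "f s"]] u st
        by (simp add: left_diff_distrib)
      have "\<bar>f u - f s\<bar> \<le> q * \<bar>u - s\<bar> powr \<alpha>" by (rule f)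
      also have "\<dots> \<le> q * (t - s) powr \<alpha>" using u q \<alpha> by (intro mult_left_mono powr_mono2) auto
      finally show "\<bar>(f u - f s) * dG n u\<bar> \<le> q * (t - s) powr \<alpha> * (K * e n powr \<beta> / e n)"
        unfolding abs_mult using dG_bound[of n u] q by (intro mult_mono) auto
    qed (use st in auto)
    then show "norm (F n t - F n s - f s * (G n t - G n s)) \<le> q * (K * e n powr \<beta> / e n) * (t - s) powr (1 + \<alpha>)"
    proof -
      have "(F n t - f s * G n t) - (F n s - f s * G n s) = F n t - F n s - f s * (G n t - G n s)"
        by (simp add: algebra_simps)
      moreover have "(q * (t - s) powr \<alpha>) * (K * e n powr \<beta> / e n) * (t - s)
          = q * (K * e n powr \<beta> / e n) * (t - s) powr (1 + \<alpha>)"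
        using st by (simp add: powr_add mult_ac)
      ultimately show ?thesis using bound by (metis real_norm_def)
    qed
  qed (use \<alpha> in auto)
  have f': "\<bar>f t - f s\<bar> \<le> q * (t - s) powr \<alpha>" if "0 \<le> s" "s \<le> t" "t \<le> T" for s t
    using f[of t s] that by simp
  have G_holder': "\<bar>G n t - G n s\<bar> \<le> K * (t - s) powr \<beta>" if "0 \<le> s" "s \<le> t" "t \<le> T" for n s t
    using G_holder[of s t n] that by simp
  have F_bound: "\<bar>F n t - F n s - f s * (G n t - G n s)\<bar> \<le> sewing_const (\<alpha> + \<beta>) * (q * K) * (t - s) powr (\<alpha> + \<beta>)"
    if "0 \<le> s" "s \<le> t" "t \<le> T" for n s t
    using that by (intro young_remainder_bound[OF \<alpha> \<beta> \<alpha>\<beta> q K f' G_holder' negl])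
  \<comment> \<open>Any value strictly between \<open>max 0 (1 - \<alpha>)\<close> and \<beta> would
    do: the gap below \<beta> leaves the factor \<open>e n powr (\<beta> - \<gamma>)\<close>, which
    tends to 0, and the lower bound keeps \<alpha> + \<gamma> > 1.\<close>
  define \<gamma> where "\<gamma> = (max 0 (1 - \<alpha>) + \<beta>) / 2"
  have \<gamma>: "\<gamma> > 0" "\<gamma> < \<beta>" "\<alpha> + \<gamma> > 1" using \<alpha> \<beta> \<alpha>\<beta> by (auto simp: \<gamma>_def max_def field_simps)
  have e_mono: "e m \<le> e n" if "n \<le> m" for n m using that by (simp add: e_def frac_le)
  have G_diff: "\<bar>(G n t - G m t) - (G n s - G m s)\<bar> \<le> (4 * K * e n powr (\<beta> - \<gamma>)) * (t - s) powr \<gamma>"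
    if st: "0 \<le> s" "s \<le> t" "t \<le> T" and nm: "n \<le> m" for n m s t
  proof (cases "s = t")
    case False
    have pw: "h powr \<beta> = h powr (\<beta> - \<gamma>) * h powr \<gamma>" for h :: real
      using powr_add[of h "\<beta> - \<gamma>" \<gamma>] by simp
    \<comment> \<open>The two available bounds balance at \<open>t - s = e n\<close>: the Hoelder
      constant serves below this scale, the uniform distance to \<open>g\<close> above it.\<close>
    show ?thesis
    proof (cases "t - s \<le> e n")
      case True
      have "\<bar>(G n t - G m t) - (G n s - G m s)\<bar> \<le> \<bar>G n t - G n s\<bar> + \<bar>G m t - G m s\<bar>" by linarith
      also have "\<dots> \<le> 2 * K * (t - s) powr \<beta>" using G_holder'[OF st, of n] G_holder'[OF st, of m] by linarith
      also have "\<dots> \<le> 4 * K * ((t - s) powr (\<beta> - \<gamma>) * (t - s) powr \<gamma>)"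
        unfolding pw[symmetric] using K by (intro mult_right_mono) auto
      also have "\<dots> \<le> 4 * K * (e n powr (\<beta> - \<gamma>) * (t - s) powr \<gamma>)"
        using K True st \<gamma> by (intro mult_left_mono mult_right_mono powr_mono2) auto
      finally show ?thesis by (simp add: mult_ac)
    next
      case False
      have "\<bar>(G n t - G m t) - (G n s - G m s)\<bar> \<le> \<bar>G n t - g t\<bar> + \<bar>G n s - g s\<bar> + (\<bar>G m t - g t\<bar> + \<bar>G m s - g s\<bar>)"
        by linarith
      also have "\<dots> \<le> 2 * (K * e n powr \<beta>) + 2 * (K * e m powr \<beta>)"
        using G_approx[of s n] G_approx[of t n] G_approx[of s m] G_approx[of t m] st by force
      also have "\<dots> \<le> 2 * (K * e n powr \<beta>) + 2 * (K * e n powr \<beta>)"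
        using e_mono[OF nm] e[of m] K \<beta> by (intro add_left_mono mult_left_mono powr_mono2) auto
      also have "\<dots> = 4 * K * (e n powr (\<beta> - \<gamma>) * e n powr \<gamma>)" unfolding pw[symmetric] by simp
      also have "\<dots> \<le> 4 * K * (e n powr (\<beta> - \<gamma>) * (t - s) powr \<gamma>)"
        using K False e[of n] \<gamma> by (intro mult_left_mono powr_mono2) auto
      finally show ?thesis by (simp add: mult_ac)
    qed
  qed simp
  have F_diff: "\<bar>F n t - F m t\<bar> \<le> (\<bar>f 0\<bar> + sewing_const (\<alpha> + \<gamma>) * q * T powr \<alpha>) * T powr \<gamma> * (4 * K * e n powr (\<beta> - \<gamma>))"
    if t: "t \<in> {0..T}" and nm: "n \<le> m" for n m t
  proof -
    let ?\<eta> = "4 * K * e n powr (\<beta> - \<gamma>)"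
    have neg: "negligible_on T (\<lambda>s t. (F n t - F m t) - (F n s - F m s) - f s * ((G n t - G m t) - (G n s - G m s)))"
      using negligible_on_diff[OF negl[of n] negl[of m]] by (simp add: algebra_simps)
    have "\<bar>(F n t - F m t) - (F n 0 - F m 0) - f 0 * ((G n t - G m t) - (G n 0 - G m 0))\<bar>
        \<le> sewing_const (\<alpha> + \<gamma>) * (q * ?\<eta>) * (t - 0) powr (\<alpha> + \<gamma>)"
      using t K by (intro young_remainder_bound[OF \<alpha> \<gamma>(1,3) q _ f' _ neg] G_diff[OF _ _ _ nm]) auto
    also have "\<dots> \<le> sewing_const (\<alpha> + \<gamma>) * (q * ?\<eta>) * T powr (\<alpha> + \<gamma>)"
      using t K q \<gamma> \<alpha> sewing_const_pos[OF \<gamma>(3)] by (intro mult_left_mono powr_mono2) auto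
    finally have 1: "\<bar>(F n t - F m t) - f 0 * ((G n t - G m t) - (G n 0 - G m 0))\<bar>
        \<le> sewing_const (\<alpha> + \<gamma>) * (q * ?\<eta>) * T powr (\<alpha> + \<gamma>)" by (simp add: F0)
    have "\<bar>f 0 * ((G n t - G m t) - (G n 0 - G m 0))\<bar> \<le> \<bar>f 0\<bar> * (?\<eta> * (t - 0) powr \<gamma>)"
      unfolding abs_mult using t nm by (intro mult_left_mono G_diff) auto
    also have "\<dots> \<le> \<bar>f 0\<bar> * (?\<eta> * T powr \<gamma>)"
      using t K \<gamma> by (intro mult_left_mono powr_mono2) auto
    finally have "\<bar>F n t - F m t\<bar> \<le> \<bar>f 0\<bar> * (?\<eta> * T powr \<gamma>)
        + sewing_const (\<alpha> + \<gamma>) * (q * ?\<eta>) * T powr (\<alpha> + \<gamma>)" using 1 by linarith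
    also have "\<dots> = (\<bar>f 0\<bar> + sewing_const (\<alpha> + \<gamma>) * q * T powr \<alpha>) * T powr \<gamma> * ?\<eta>"
      proof -
      have "a * (x * c) + d * (q * x) * (p * c) = (a + d * q * p) * c * x" for a x c d p :: real
        by (simp add: algebra_simps)
      then show ?thesis unfolding powr_add .
    qed
    finally show ?thesis .
  qed
  have e_lim: "(\<lambda>n. e n powr p) \<longlonglongrightarrow> 0" if "p > 0" for p
  proof -
    have "e \<longlonglongrightarrow> 0" using LIMSEQ_inverse_real_of_nat by (simp add: e_def[abs_def] inverse_eq_divide add.commute)
    then show ?thesis by (rule tendsto_zero_powrI) (use that e(1) in \<open>auto intro: less_imp_le always_eventually\<close>)
  qed
  have conv: "convergent (\<lambda>n. F n t)" if t: "t \<in> {0..T}" for t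
  proof (rule Cauchy_convergent, rule metric_CauchyI)
    fix \<epsilon> :: real assume "\<epsilon> > 0"
    define D where "D n = (\<bar>f 0\<bar> + sewing_const (\<alpha> + \<gamma>) * q * T powr \<alpha>) * T powr \<gamma> * (4 * K * e n powr (\<beta> - \<gamma>))" for n
    have "D \<longlonglongrightarrow> (\<bar>f 0\<bar> + sewing_const (\<alpha> + \<gamma>) * q * T powr \<alpha>) * T powr \<gamma> * (4 * K * 0)"
      unfolding D_def by (intro tendsto_mult tendsto_const e_lim) (use \<gamma> in simp)
    then have "\<forall>\<^sub>F n in sequentially. D n < \<epsilon> / 2"
      using \<open>\<epsilon> > 0\<close> by (intro order_tendstoD) auto
    then obtain N where N: "D N < \<epsilon> / 2"
      using eventually_happens' sequentially_bot by blast
    have "dist (F m t) (F n t) < \<epsilon>" if "m \<ge> N" "n \<ge> N" for m n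
      using F_diff[OF t that(1), folded D_def] F_diff[OF t that(2), folded D_def] N
      unfolding dist_real_def by linarith
    then show "\<exists>M. \<forall>m\<ge>M. \<forall>n\<ge>M. dist (F m t) (F n t) < \<epsilon>" by blast
  qed
  have G_lim: "(\<lambda>n. G n t) \<longlonglongrightarrow> g t" if "t \<in> {0..T}" for t
  proof (rule Lim_null[THEN iffD2], rule Lim_null_comparison)
    show "(\<lambda>n. K * e n powr \<beta>) \<longlonglongrightarrow> 0" using tendsto_mult_left[OF e_lim[OF \<beta>], of K] by simp
  qed (use G_approx[OF that] in auto)
  define L where "L t = lim (\<lambda>n. F n t)" for t
  have F_lim: "(\<lambda>n. F n t) \<longlonglongrightarrow> L t" if "t \<in> {0..T}" for t
    using conv[OF that] by (simp add: L_def convergent_LIMSEQ_iff)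
  have "negligible_on T (\<lambda>s t. L t - L s - f s * (g t - g s))"
  proof (rule negligible_onI[OF \<alpha>\<beta>])
    fix s t assume st: "0 \<le> s" "s \<le> t" "t \<le> T"
    have "(\<lambda>n. \<bar>F n t - F n s - f s * (G n t - G n s)\<bar>) \<longlonglongrightarrow> \<bar>L t - L s - f s * (g t - g s)\<bar>"
      using st by (intro tendsto_intros F_lim G_lim) auto
    then show "norm (L t - L s - f s * (g t - g s)) \<le> sewing_const (\<alpha> + \<beta>) * (q * K) * (t - s) powr (\<alpha> + \<beta>)"
      using F_bound[OF st] by (auto intro: LIMSEQ_le_const2)
  qed
  then show ?thesis by blast
qed

lemma holder_onE:
  assumes "holder_on \<alpha> S f"
  obtains K where "\<alpha> > 0" "K \<ge> 0" "\<And>s t. s \<in> S \<Longrightarrow> t \<in> S \<Longrightarrow> dist (f s) (f t) \<le> K * \<bar>s - t\<bar> powr \<alpha>"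
proof -
  obtain K where K: "\<alpha> > 0" "\<forall>s\<in>S. \<forall>t\<in>S. dist (f s) (f t) \<le> K * \<bar>s - t\<bar> powr \<alpha>"
    using assms unfolding holder_on_def by blast
  have "dist (f s) (f t) \<le> max K 0 * \<bar>s - t\<bar> powr \<alpha>" if "s \<in> S" "t \<in> S" for s t
  proof -
    have "dist (f s) (f t) \<le> K * \<bar>s - t\<bar> powr \<alpha>" using K that by blast
    also have "\<dots> \<le> max K 0 * \<bar>s - t\<bar> powr \<alpha>" by (intro mult_right_mono) auto
    finally show ?thesis .
  qed
  then show ?thesis using that[of "max K 0"] K(1) by simp
qed

text \<open>Composition with the projection \<open>clamp\<close> onto \<open>[0, T]\<close>, which
  does not increase distances, makes the Hoelder bounds global with the same constants; the
  averaging windows may then leave the interval.\<close>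

lemma young_primitive_exists:
  fixes f g :: "real \<Rightarrow> real"
  assumes f: "holder_on \<alpha> {0..T} f" and g: "holder_on \<beta> {0..T} g" and \<alpha>\<beta>: "\<alpha> + \<beta> > 1" and T: "T \<ge> 0"
  shows "\<exists>F. negligible_on T (\<lambda>s t. F t - F s - f s * (g t - g s))"
proof -
  define clamp where "clamp u = max 0 (min u T)" for u
  have clamp: "clamp u \<in> {0..T}" "\<bar>clamp u - clamp v\<bar> \<le> \<bar>u - v\<bar>" for u v
    using T by (auto simp: clamp_def)
  have ext: "\<exists>K\<ge>0. \<forall>s t. \<bar>h (clamp s) - h (clamp t)\<bar> \<le> K * \<bar>s - t\<bar> powr \<gamma>"
    if h: "holder_on \<gamma> {0..T} h" for h :: "real \<Rightarrow> real" and \<gamma>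
  proof -
    obtain K where K: "\<gamma> > 0" "K \<ge> 0"
        "\<And>s t. s \<in> {0..T} \<Longrightarrow> t \<in> {0..T} \<Longrightarrow> dist (h s) (h t) \<le> K * \<bar>s - t\<bar> powr \<gamma>"
      using holder_onE[OF h] by metis
    have "\<bar>h (clamp s) - h (clamp t)\<bar> \<le> K * \<bar>s - t\<bar> powr \<gamma>" for s t
    proof -
      have "\<bar>h (clamp s) - h (clamp t)\<bar> \<le> K * \<bar>clamp s - clamp t\<bar> powr \<gamma>"
        using K(3)[OF clamp(1) clamp(1)] by (simp add: dist_real_def)
      also have "\<dots> \<le> K * \<bar>s - t\<bar> powr \<gamma>"
        using K clamp by (intro mult_left_mono powr_mono2) auto
      finally show ?thesis .
    qed
    then show ?thesis using K(2) by blast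
  qed
  obtain q K where "q \<ge> 0" "K \<ge> 0"
    and "\<And>s t. \<bar>f (clamp s) - f (clamp t)\<bar> \<le> q * \<bar>s - t\<bar> powr \<alpha>"
    and "\<And>s t. \<bar>g (clamp s) - g (clamp t)\<bar> \<le> K * \<bar>s - t\<bar> powr \<beta>"
    using ext[OF f] ext[OF g] by blast
  moreover have "\<alpha> > 0" "\<beta> > 0" using f g by (auto simp: holder_on_def)
  ultimately obtain F where F: "negligible_on T (\<lambda>s t. F t - F s - f (clamp s) * (g (clamp t) - g (clamp s)))"
    using young_primitive_exists_global[of \<alpha> \<beta> q K T "\<lambda>s. f (clamp s)" "\<lambda>s. g (clamp s)"] \<alpha>\<beta> T by blast
  have "clamp u = u" if "u \<in> {0..T}" for u using that by (simp add: clamp_def)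
  then have "negligible_on T (\<lambda>s t. F t - F s - f s * (g t - g s))"
    using F by (subst (asm) negligible_on_cong) auto
  then show ?thesis by blast
qed

section \<open>Primitives and Riemann sums\<close>

lemma holder_on_subset: "holder_on \<alpha> S f \<Longrightarrow> S' \<subseteq> S \<Longrightarrow> holder_on \<alpha> S' f"
  unfolding holder_on_def by (meson subset_iff)

text \<open>Moving the tag from the left end of a cell to any other point changes the summand only
  by order \<alpha> + \<beta> > 1 in the cell length, so the difference between a Riemann sum and
  the telescoping sum of \<open>F\<close> is a sum of terms of order above one and vanishes with the
  mesh.\<close>

lemma has_young_integral_primitive:
  fixes f g F :: "real \<Rightarrow> real"
  assumes f: "holder_on \<alpha> {0..T} f" and g: "holder_on \<beta> {0..T} g" and \<alpha>\<beta>: "\<alpha> + \<beta> > 1"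
    and F: "negligible_on T (\<lambda>s t. F t - F s - f s * (g t - g s))" and \<tau>: "0 \<le> \<tau>" "\<tau> \<le> T"
  shows "has_young_integral f g 0 \<tau> (F \<tau> - F 0)"
  unfolding has_young_integral_def
proof (intro conjI allI impI)
  have sub: "{0..\<tau>} \<subseteq> {0..T}" using \<tau> by auto
  show "\<exists>\<alpha> \<beta>. 1 < \<alpha> + \<beta> \<and> holder_on \<alpha> {0..\<tau>} f \<and> holder_on \<beta> {0..\<tau>} g"
    using assms holder_on_subset[OF _ sub] by blast
  fix e :: real assume e: "e > 0"
  obtain q where q: "\<alpha> > 0" "q \<ge> 0"
    "\<And>s t. s \<in> {0..T} \<Longrightarrow> t \<in> {0..T} \<Longrightarrow> dist (f s) (f t) \<le> q * \<bar>s - t\<bar> powr \<alpha>"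
    using holder_onE[OF f] by metis
  obtain K where K: "\<beta> > 0" "K \<ge> 0"
    "\<And>s t. s \<in> {0..T} \<Longrightarrow> t \<in> {0..T} \<Longrightarrow> dist (g s) (g t) \<le> K * \<bar>s - t\<bar> powr \<beta>"
    using holder_onE[OF g] by metis
  \<comment> \<open>The second summand is the price of moving the tag. Bundling it with the
    expansion error yields a single exponent and constant for both.\<close>
  have "negligible_on T (\<lambda>s t. \<bar>F t - F s - f s * (g t - g s)\<bar> + q * K * (t - s) powr (\<alpha> + \<beta>))"
  proof (rule negligible_on_add)
    show "negligible_on T (\<lambda>s t. \<bar>F t - F s - f s * (g t - g s)\<bar>)"
      by (rule negligible_on_bounded_mult[OF F, where c = 1]) auto
    show "negligible_on T (\<lambda>s t. q * K * (t - s) powr (\<alpha> + \<beta>))"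
      by (rule negligible_onI[OF \<alpha>\<beta>]) (use q K in auto)
  qed
  then obtain \<theta> B where \<theta>: "\<theta> > 1" "B \<ge> 0" and *: "\<And>s t. \<lbrakk>0 \<le> s; s \<le> t; t \<le> T\<rbrakk> \<Longrightarrow>
      norm (\<bar>F t - F s - f s * (g t - g s)\<bar> + q * K * (t - s) powr (\<alpha> + \<beta>)) \<le> B * (t - s) powr \<theta>"
    unfolding negligible_on_def by blast
  have B: "\<bar>F t - F s - f s * (g t - g s)\<bar> + q * K * (t - s) powr (\<alpha> + \<beta>) \<le> B * (t - s) powr \<theta>"
    if "0 \<le> s" "s \<le> t" "t \<le> T" for s t
    using *[OF that] unfolding real_norm_def by linarith
  have tagged: "\<bar>F t - F s - f x * (g t - g s)\<bar> \<le> B * (t - s) powr \<theta>"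
    if st: "0 \<le> s" "s \<le> x" "x \<le> t" "t \<le> T" for s x t
  proof -
    have "\<bar>f x - f s\<bar> * \<bar>g t - g s\<bar> \<le> (q * (t - s) powr \<alpha>) * (K * (t - s) powr \<beta>)"
    proof (rule mult_mono)
      have "\<bar>f x - f s\<bar> \<le> q * \<bar>x - s\<bar> powr \<alpha>" using q(3)[of x s] st by (simp add: dist_real_def)
      also have "\<dots> \<le> q * (t - s) powr \<alpha>" using st q by (intro mult_left_mono powr_mono2) auto
      finally show "\<bar>f x - f s\<bar> \<le> q * (t - s) powr \<alpha>" .
      show "\<bar>g t - g s\<bar> \<le> K * (t - s) powr \<beta>" using K(3)[of t s] st by (simp add: dist_real_def)
    qed (use q in auto)
    then have "\<bar>(f x - f s) * (g t - g s)\<bar> \<le> q * K * (t - s) powr (\<alpha> + \<beta>)"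
      by (simp add: abs_mult powr_add mult_ac)
    moreover have "F t - F s - f x * (g t - g s) = (F t - F s - f s * (g t - g s)) - (f x - f s) * (g t - g s)"
      by (simp add: algebra_simps)
    ultimately show ?thesis using B[of s t] st by linarith
  qed
  \<comment> \<open>A cell inside a ball of radius \<delta> has length at most
    \<open>2 * \<delta>\<close>; its error is at most
    \<open>B * (2 * \<delta>) powr (\<theta> - 1)\<close> times its length, and the lengths add up
    to \<tau>.\<close>
  define D where "D \<delta> = B * (2 * \<delta>) powr (\<theta> - 1) * \<tau>" for \<delta>
  have "((\<lambda>\<delta>. D \<delta>) \<longlongrightarrow> B * (2 * 0) powr (\<theta> - 1) * \<tau>) (at_right 0)"
    unfolding D_def using \<theta> eventually_at_right_less[of "0::real"]
    by (intro tendsto_intros tendsto_powr') (auto elim: eventually_mono)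
  then have "\<forall>\<^sub>F \<delta> in at_right 0. D \<delta> < e" using e by (intro order_tendstoD) auto
  then have "\<forall>\<^sub>F \<delta> in at_right 0. D \<delta> < e \<and> \<delta> > 0"
    using eventually_at_right_less[of "0::real"] by (rule eventually_conj)
  then obtain \<delta> where \<delta>: "\<delta> > 0" "D \<delta> < e"
    using eventually_happens'[OF trivial_limit_at_right_real] by blast
  show "\<exists>\<delta>>0. \<forall>p. p tagged_division_of {0..\<tau>} \<and> (\<lambda>x. ball x \<delta>) fine p \<longrightarrow>
      norm ((\<Sum>(x, K)\<in>p. (g (Sup K) - g (Inf K)) *\<^sub>R f x) - (F \<tau> - F 0)) < e"
  proof (intro exI[where x = \<delta>] conjI allI impI \<delta>(1))
    fix p assume "p tagged_division_of {0..\<tau>} \<and> (\<lambda>x. ball x \<delta>) fine p"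
    then have p: "p tagged_division_of {0..\<tau>}" "(\<lambda>x. ball x \<delta>) fine p" by auto
    have term_bound: "\<bar>(g (Sup K) - g (Inf K)) * f x - (F (Sup K) - F (Inf K))\<bar>
        \<le> B * (2 * \<delta>) powr (\<theta> - 1) * measure lborel K" if xK: "(x, K) \<in> p" for x K
    proof -
      obtain u v where K: "K = {u..v}" using tagged_division_ofD(4)[OF p(1) xK] by (auto simp: box_real)
      have "x \<in> K" "K \<subseteq> {0..\<tau>}" using tagged_division_ofD(2,3)[OF p(1) xK] by auto
      then have uv: "u \<le> x" "x \<le> v" "0 \<le> u" "v \<le> \<tau>" by (auto simp: K)
      have "K \<subseteq> ball x \<delta>" using p(2) xK by (auto simp: fine_def)
      moreover have "u \<in> K" "v \<in> K" using uv by (auto simp: K)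
      ultimately have "u \<in> ball x \<delta>" "v \<in> ball x \<delta>" by blast+
      then have "v - u \<le> 2 * \<delta>" using uv by (simp add: dist_real_def)
      have "\<bar>F v - F u - f x * (g v - g u)\<bar> \<le> B * (v - u) powr \<theta>" using tagged uv \<tau> by simp
      also have "\<dots> \<le> B * ((2 * \<delta>) powr (\<theta> - 1) * (v - u) powr 1)"
        using \<theta> uv \<open>v - u \<le> 2 * \<delta>\<close> by (intro mult_left_mono powr_le_rescale) auto
      finally have "\<bar>F v - F u - f x * (g v - g u)\<bar> \<le> B * (2 * \<delta>) powr (\<theta> - 1) * (v - u)"
        using uv by simp
      then show ?thesis using uv by (simp add: K abs_minus_commute mult.commute)
    qed
    have "(\<Sum>(x, K)\<in>p. F (Sup K) - F (Inf K)) = F \<tau> - F 0"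
      using additive_tagged_division_1[OF \<tau>(1) p(1)] .
    then have "(\<Sum>(x, K)\<in>p. (g (Sup K) - g (Inf K)) *\<^sub>R f x) - (F \<tau> - F 0)
        = (\<Sum>(x, K)\<in>p. (g (Sup K) - g (Inf K)) * f x - (F (Sup K) - F (Inf K)))"
      by (simp add: sum_subtractf case_prod_unfold)
    also have "norm \<dots> \<le> (\<Sum>(x, K)\<in>p. B * (2 * \<delta>) powr (\<theta> - 1) * measure lborel K)"
      using term_bound by (intro sum_norm_le) auto
    also have "\<dots> = B * (2 * \<delta>) powr (\<theta> - 1) * (\<Sum>(x, K)\<in>p. measure lborel K)"
      by (simp add: sum_distrib_left case_prod_unfold)
    also have "(\<Sum>(x, K)\<in>p. measure lborel K) = \<tau>"
      using additive_content_tagged_division[of p 0 \<tau>] p(1) \<tau> by simp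
    finally show "norm ((\<Sum>(x, K)\<in>p. (g (Sup K) - g (Inf K)) *\<^sub>R f x) - (F \<tau> - F 0)) < e"
      using \<delta>(2) by (simp add: D_def)
  qed
qed

text \<open>Some tagged division is fine for both radii at once (Cousin's lemma), and its Riemann
  sum is close to both candidates.\<close>

lemma has_young_integral_unique:
  assumes I: "has_young_integral f g a b I" and J: "has_young_integral f g a b J"
  shows "I = J"
proof (rule ccontr)
  assume "I \<noteq> J"
  then have e: "norm (I - J) / 2 > 0" by simp
  let ?S = "\<lambda>p. \<Sum>(x, K)\<in>p. (g (Sup K) - g (Inf K)) *\<^sub>R f x"
  obtain d1 where d1: "d1 > 0"
    "\<And>p. p tagged_division_of {a..b} \<Longrightarrow> (\<lambda>x. ball x d1) fine p \<Longrightarrow> norm (?S p - I) < norm (I - J) / 2"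
    using I e unfolding has_young_integral_def by meson
  obtain d2 where d2: "d2 > 0"
    "\<And>p. p tagged_division_of {a..b} \<Longrightarrow> (\<lambda>x. ball x d2) fine p \<Longrightarrow> norm (?S p - J) < norm (I - J) / 2"
    using J e unfolding has_young_integral_def by meson
  have "gauge (\<lambda>x::real. ball x (min d1 d2))" using d1(1) d2(1) by (intro gauge_ball) simp
  then obtain p where p: "p tagged_division_of {a..b}" "(\<lambda>x. ball x (min d1 d2)) fine p"
    using fine_division_exists_real by blast
  have "(\<lambda>x. ball x d1) fine p"
    by (rule fineI) (use fineD[OF p(2)] subset_ball[of "min d1 d2" d1] in \<open>meson min.cobounded1 order_trans\<close>)
  moreover have "(\<lambda>x. ball x d2) fine p"
    by (rule fineI) (use fineD[OF p(2)] subset_ball[of "min d1 d2" d2] in \<open>meson min.cobounded2 order_trans\<close>)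
  ultimately have "norm (?S p - I) < norm (I - J) / 2" "norm (?S p - J) < norm (I - J) / 2"
    using d1(2) d2(2) p(1) by blast+
  then have "norm (?S p - I) + norm (?S p - J) < norm (I - J)" by linarith
  then show False by norm
qed

lemma young_integral_eqI: "has_young_integral f g a b I \<Longrightarrow> young_integral f g a b = I"
  unfolding young_integral_def by (blast intro: has_young_integral_unique)

text \<open>The form in which integrals are computed from here on: by
  \<open>negligible_increment_imp_const\<close> a local expansion determines a function up to its
  value at 0.\<close>

theorem young_integral_expansion:
  fixes f g :: "real \<Rightarrow> real"
  assumes "holder_on \<alpha> {0..T} f" "holder_on \<beta> {0..T} g" "\<alpha> + \<beta> > 1" "T \<ge> 0"
  shows "negligible_on T (\<lambda>s t. young_integral f g 0 t - young_integral f g 0 s - f s * (g t - g s))"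
proof -
  obtain F where F: "negligible_on T (\<lambda>s t. F t - F s - f s * (g t - g s))"
    using young_primitive_exists[OF assms] by blast
  have eq: "young_integral f g 0 t = F t - F 0" if "0 \<le> t" "t \<le> T" for t
    using has_young_integral_primitive[OF assms(1-3) F that] by (rule young_integral_eqI)
  have "negligible_on T (\<lambda>s t. young_integral f g 0 t - young_integral f g 0 s - f s * (g t - g s))
      \<longleftrightarrow> negligible_on T (\<lambda>s t. F t - F s - f s * (g t - g s))"
    by (rule negligible_on_cong) (simp add: eq)
  then show ?thesis using F by blast
qed

lemma young_integral_0:
  fixes f g :: "real \<Rightarrow> real"
  assumes "holder_on \<alpha> {0..0} f" "holder_on \<beta> {0..0} g" "\<alpha> + \<beta> > 1"
  shows "young_integral f g 0 0 = 0"
proof -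
  obtain F where F: "negligible_on 0 (\<lambda>s t. F t - F s - f s * (g t - g s))"
    using young_primitive_exists[OF assms] by blast
  show ?thesis
    using young_integral_eqI[OF has_young_integral_primitive[OF assms F, of 0]] by simp
qed

text \<open>Reduces the vector-valued integrals in the definition of a solution to the real-valued
  theory.\<close>

lemma has_young_integral_component:
  fixes f :: "real \<Rightarrow> real ^ 'n"
  assumes "has_young_integral f g a b I"
  shows "has_young_integral (\<lambda>s. f s $ j) g a b (I $ j)"
  unfolding has_young_integral_def
proof (intro conjI allI impI)
  have "holder_on \<alpha> S (\<lambda>s. f s $ j)" if "holder_on \<alpha> S f" for \<alpha> S
    using that dist_vec_nth_le unfolding holder_on_def by (meson order_trans)
  then show "\<exists>\<alpha> \<beta>. 1 < \<alpha> + \<beta> \<and> holder_on \<alpha> {a..b} (\<lambda>s. f s $ j) \<and> holder_on \<beta> {a..b} g"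
    using assms unfolding has_young_integral_def by blast
  fix e :: real assume "e > 0"
  then obtain \<delta> where \<delta>: "\<delta> > 0" "\<And>p. p tagged_division_of {a..b} \<Longrightarrow> (\<lambda>x. ball x \<delta>) fine p \<Longrightarrow>
        norm ((\<Sum>(x, K)\<in>p. (g (Sup K) - g (Inf K)) *\<^sub>R f x) - I) < e"
    using assms unfolding has_young_integral_def by meson
  have "norm ((\<Sum>(x, K)\<in>p. (g (Sup K) - g (Inf K)) *\<^sub>R f x $ j) - I $ j)
      \<le> norm ((\<Sum>(x, K)\<in>p. (g (Sup K) - g (Inf K)) *\<^sub>R f x) - I)" for p
    using component_le_norm_cart[of "(\<Sum>(x, K)\<in>p. (g (Sup K) - g (Inf K)) *\<^sub>R f x) - I" j]
    by (simp add: case_prod_unfold)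
  then show "\<exists>\<delta>>0. \<forall>p. p tagged_division_of {a..b} \<and> (\<lambda>x. ball x \<delta>) fine p \<longrightarrow>
      norm ((\<Sum>(x, K)\<in>p. (g (Sup K) - g (Inf K)) *\<^sub>R f x $ j) - I $ j) < e"
    using \<delta> by (meson order_le_less_trans)
qed

section \<open>Smooth functions and vanishing jets\<close>

definition dir_deriv :: "'a::real_normed_vector \<Rightarrow> ('a \<Rightarrow> 'b::real_normed_vector) \<Rightarrow> 'a \<Rightarrow> 'b" where
  "dir_deriv v f = (\<lambda>x. frechet_derivative f (at x) v)"

lemma C_k_Suc_iff: "C_k (Suc k) f \<longleftrightarrow> (\<forall>x. f differentiable (at x)) \<and> (\<forall>v. C_k k (dir_deriv v f))"
  by (simp add: dir_deriv_def)

declare C_k.simps(2) [simp del]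

lemma C_k_Suc_imp: "C_k (Suc k) f \<Longrightarrow> C_k k f"
proof (induction k arbitrary: f)
  case 0
  then show ?case
    by (auto simp: C_k_Suc_iff intro!: differentiable_imp_continuous_on differentiable_at_imp_differentiable_on)
next
  case (Suc k)
  then show ?case unfolding C_k_Suc_iff[of "Suc k"] by (auto simp: C_k_Suc_iff[of k])
qed

lemma C_infinity_differentiable: "C_infinity f \<Longrightarrow> f differentiable (at x)"
  unfolding C_infinity_def using C_k_Suc_iff by blast

lemma C_infinity_continuous: "C_infinity f \<Longrightarrow> continuous_on UNIV f"
  unfolding C_infinity_def using C_k.simps(1) by blast

lemma C_infinity_dir_deriv: "C_infinity f \<Longrightarrow> C_infinity (dir_deriv v f)"
  unfolding C_infinity_def using C_k_Suc_iff by blast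

lemma dir_deriv_eqI: "(\<And>x. (f has_derivative f' x) (at x)) \<Longrightarrow> dir_deriv v f = (\<lambda>x. f' x v)"
  unfolding dir_deriv_def by (metis frechet_derivative_at)

lemma has_derivative_dir_deriv:
  "f differentiable (at x) \<Longrightarrow> (f has_derivative (\<lambda>v. dir_deriv v f x)) (at x)"
  unfolding dir_deriv_def by (simp add: frechet_derivative_works[symmetric])

lemma C_k_const: "C_k k (\<lambda>_. c)"
  by (induction k arbitrary: c) (auto simp: C_k_Suc_iff dir_deriv_eqI[OF has_derivative_const])

lemma C_k_bounded_linear: assumes "bounded_linear f" shows "C_k k f"
proof (cases k)
  case 0
  then show ?thesis using assms by (simp add: linear_continuous_on)
next
  case (Suc n)
  have "(f has_derivative f) (at x)" for x using assms by (rule bounded_linear_imp_has_derivative)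
  then show ?thesis
    unfolding Suc C_k_Suc_iff by (auto simp: dir_deriv_eqI[of f "\<lambda>_. f"] C_k_const differentiable_def)
qed

lemma dir_deriv_add:
  assumes "\<And>x. f differentiable (at x)" "\<And>x. g differentiable (at x)"
  shows "dir_deriv v (\<lambda>x. f x + g x) = (\<lambda>x. dir_deriv v f x + dir_deriv v g x)"
  using assms by (intro dir_deriv_eqI has_derivative_add has_derivative_dir_deriv)

lemma dir_deriv_diff:
  assumes "\<And>x. f differentiable (at x)" "\<And>x. g differentiable (at x)"
  shows "dir_deriv v (\<lambda>x. f x - g x) = (\<lambda>x. dir_deriv v f x - dir_deriv v g x)"
  using assms by (intro dir_deriv_eqI has_derivative_diff has_derivative_dir_deriv)

lemma dir_deriv_mult:
  fixes f g :: "'a::real_normed_vector \<Rightarrow> real"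
  assumes "\<And>x. f differentiable (at x)" "\<And>x. g differentiable (at x)"
  shows "dir_deriv v (\<lambda>x. f x * g x) = (\<lambda>x. f x * dir_deriv v g x + dir_deriv v f x * g x)"
  using assms by (intro dir_deriv_eqI has_derivative_mult has_derivative_dir_deriv)

lemma dir_deriv_bounded_linear:
  assumes "\<And>x. f differentiable (at x)" "bounded_linear h"
  shows "dir_deriv v (\<lambda>x. h (f x)) = (\<lambda>x. h (dir_deriv v f x))"
  using assms(1) by (intro dir_deriv_eqI bounded_linear.has_derivative[OF assms(2)] has_derivative_dir_deriv)

lemma dir_deriv_translate:
  assumes "\<And>x. f differentiable (at x)"
  shows "dir_deriv v (\<lambda>x. f (x + w)) = (\<lambda>x. dir_deriv v f (x + w))"
proof (rule dir_deriv_eqI)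
  fix x
  have "((\<lambda>x. x + w) has_derivative (\<lambda>x. x)) (at x)" by (auto intro!: derivative_eq_intros)
  from has_derivative_compose[OF this, of f] has_derivative_dir_deriv[OF assms]
  show "((\<lambda>x. f (x + w)) has_derivative (\<lambda>v. dir_deriv v f (x + w))) (at x)" by blast
qed

lemma C_k_add: "C_k k f \<Longrightarrow> C_k k g \<Longrightarrow> C_k k (\<lambda>x. f x + g x)"
  by (induction k arbitrary: f g) (auto simp: C_k_Suc_iff dir_deriv_add continuous_on_add)

lemma C_k_component: "C_k k f \<Longrightarrow> bounded_linear h \<Longrightarrow> C_k k (\<lambda>x. h (f x))"
proof (induction k arbitrary: f)
  case 0
  then show ?case by (auto intro: bounded_linear.continuous_on)
next
  case (Suc k)
  then have "(\<lambda>x. h (f x)) differentiable (at x)" for x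
    unfolding C_k_Suc_iff differentiable_def by (blast intro: bounded_linear.has_derivative)
  then show ?case using Suc by (simp add: C_k_Suc_iff dir_deriv_bounded_linear)
qed

lemma C_k_mult:
  fixes f g :: "'a::euclidean_space \<Rightarrow> real"
  shows "C_k k f \<Longrightarrow> C_k k g \<Longrightarrow> C_k k (\<lambda>x. f x * g x)"
proof (induction k arbitrary: f g)
  case 0
  then show ?case by (simp add: continuous_on_mult)
next
  case (Suc k)
  then show ?case
    using C_k_Suc_imp[OF Suc.prems(1)] C_k_Suc_imp[OF Suc.prems(2)]
    by (auto simp: C_k_Suc_iff dir_deriv_mult intro!: C_k_add)
qed

lemma C_k_translate:
  assumes "C_k k f" shows "C_k k (\<lambda>x. f (x + w))"
  using assms
proof (induction k arbitrary: f)
  case 0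
  have "continuous_on UNIV (\<lambda>x. x + w)" by (intro continuous_intros)
  then show ?case using 0 continuous_on_compose2[of UNIV f UNIV "\<lambda>x. x + w"] by simp
next
  case (Suc k)
  have "(\<lambda>x. f (x + w)) differentiable (at x)" for x
    using differentiable_chain_at[of "\<lambda>x. x + w" x f] Suc.prems by (simp add: C_k_Suc_iff o_def)
  then show ?case using Suc by (simp add: C_k_Suc_iff dir_deriv_translate)
qed

lemma C_infinity_const: "C_infinity (\<lambda>_. c)" by (simp add: C_infinity_def C_k_const)
lemma C_infinity_bounded_linear: "bounded_linear f \<Longrightarrow> C_infinity f"
  by (simp add: C_infinity_def C_k_bounded_linear)
lemma C_infinity_add: "C_infinity f \<Longrightarrow> C_infinity g \<Longrightarrow> C_infinity (\<lambda>x. f x + g x)"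
  by (simp add: C_infinity_def C_k_add)
lemma C_infinity_mult:
  fixes f g :: "'a::euclidean_space \<Rightarrow> real"
  shows "C_infinity f \<Longrightarrow> C_infinity g \<Longrightarrow> C_infinity (\<lambda>x. f x * g x)"
  by (simp add: C_infinity_def C_k_mult)
lemma C_infinity_diff:
  fixes f g :: "'a::euclidean_space \<Rightarrow> real"
  shows "C_infinity f \<Longrightarrow> C_infinity g \<Longrightarrow> C_infinity (\<lambda>x. f x - g x)"
  using C_infinity_add[OF _ C_infinity_mult[OF C_infinity_const[of "-1"]], of f g] by simp
lemma C_infinity_translate: "C_infinity f \<Longrightarrow> C_infinity (\<lambda>x. f (x + w))"
  by (simp add: C_infinity_def C_k_translate)
lemma C_infinity_vec_nth: "C_infinity f \<Longrightarrow> C_infinity (\<lambda>x. f x $ j)"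
  unfolding C_infinity_def using C_k_component[OF _ bounded_linear_vec_nth] by blast
lemma C_infinity_sum: "(\<And>i. i \<in> I \<Longrightarrow> C_infinity (f i)) \<Longrightarrow> C_infinity (\<lambda>x. \<Sum>i\<in>I. f i x)"
  by (induction I rule: infinite_finite_induct) (auto intro: C_infinity_add C_infinity_const)
lemma C_infinity_power:
  fixes f :: "'a::euclidean_space \<Rightarrow> real"
  shows "C_infinity f \<Longrightarrow> C_infinity (\<lambda>x. f x ^ n)"
  by (induction n) (auto intro: C_infinity_mult C_infinity_const)
lemma C_infinity_prod:
  fixes f :: "'i \<Rightarrow> 'a::euclidean_space \<Rightarrow> real"
  shows "(\<And>i. i \<in> I \<Longrightarrow> C_infinity (f i)) \<Longrightarrow> C_infinity (\<lambda>x. \<Prod>i\<in>I. f i x)"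
  by (induction I rule: infinite_finite_induct) (auto intro: C_infinity_mult C_infinity_const)

lemma C_infinity_foldr_dir_deriv: "C_infinity f \<Longrightarrow> C_infinity (foldr dir_deriv vs f)"
  by (induction vs) (auto intro: C_infinity_dir_deriv)

section \<open>Finite differences\<close>

primrec finite_diff :: "real \<Rightarrow> 'a::real_vector list \<Rightarrow> ('a \<Rightarrow> real) \<Rightarrow> 'a \<Rightarrow> real" where
  "finite_diff h [] f x = f x"
| "finite_diff h (v # vs) f x = finite_diff h vs f (x + h *\<^sub>R v) - finite_diff h vs f x"

lemma finite_diff_diff:
  "finite_diff h vs (\<lambda>y. f (y + w) - f y) x = finite_diff h vs f (x + w) - finite_diff h vs f x"
  by (induction vs arbitrary: x) (auto simp: algebra_simps)

lemma foldr_dir_deriv_diff: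
  fixes f :: "'a::euclidean_space \<Rightarrow> real"
  assumes "C_infinity f"
  shows "foldr dir_deriv vs (\<lambda>y. f (y + w) - f y)
    = (\<lambda>y. foldr dir_deriv vs f (y + w) - foldr dir_deriv vs f y)"
proof (induction vs)
  case (Cons v vs)
  let ?N = "foldr dir_deriv vs f"
  have N: "C_infinity ?N" using assms by (rule C_infinity_foldr_dir_deriv)
  show ?case
    using Cons C_infinity_differentiable[OF N] C_infinity_differentiable[OF C_infinity_translate[OF N]]
    by (simp add: dir_deriv_diff dir_deriv_translate)
qed simp

text \<open>The difference in the first direction is moved inside, onto the function
  \<open>\<lambda>y. f (y + h *\<^sub>R v) - f y\<close>. The induction hypothesis turns it into a
  difference of mixed derivatives at two points of a segment, to which the one-dimensional mean
  value theorem applies; each direction moves the intermediate point by at most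
  \<open>h * norm v\<close>.\<close>

lemma finite_diff_mvt:
  fixes f :: "'a::euclidean_space \<Rightarrow> real"
  assumes "C_infinity f" and h: "h > 0"
  shows "\<exists>\<xi>. norm (\<xi> - x) \<le> h * (\<Sum>v\<leftarrow>vs. norm v) \<and>
    finite_diff h vs f x = h ^ length vs * foldr dir_deriv vs f \<xi>"
  using assms(1)
proof (induction vs arbitrary: f)
  case Nil
  then show ?case by (intro exI[where x = x]) auto
next
  case (Cons v vs)
  let ?N = "foldr dir_deriv vs f"
  have N: "C_infinity ?N" using Cons.prems by (rule C_infinity_foldr_dir_deriv)
  obtain \<xi> where \<xi>: "norm (\<xi> - x) \<le> h * (\<Sum>v\<leftarrow>vs. norm v)"
    "finite_diff h vs (\<lambda>y. f (y + h *\<^sub>R v) - f y) x = h ^ length vs * (?N (\<xi> + h *\<^sub>R v) - ?N \<xi>)"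
    using Cons.IH[OF C_infinity_diff[OF C_infinity_translate[OF Cons.prems, of "h *\<^sub>R v"] Cons.prems]]
    unfolding foldr_dir_deriv_diff[OF Cons.prems] by blast
  have "\<exists>z>0. z < h \<and> ?N (\<xi> + h *\<^sub>R v) - ?N (\<xi> + 0 *\<^sub>R v) = (h - 0) * dir_deriv v ?N (\<xi> + z *\<^sub>R v)"
  proof (rule MVT2[OF h])
    fix t :: real
    have "((\<lambda>t. ?N (\<xi> + t *\<^sub>R v)) has_derivative (\<lambda>s. dir_deriv (s *\<^sub>R v) ?N (\<xi> + t *\<^sub>R v))) (at t)"
      by (rule has_derivative_compose[of "\<lambda>t. \<xi> + t *\<^sub>R v" "\<lambda>s. s *\<^sub>R v" t UNIV ?N])
         (auto intro!: derivative_eq_intros has_derivative_dir_deriv C_infinity_differentiable N)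
    moreover have "dir_deriv (s *\<^sub>R v) ?N y = dir_deriv v ?N y * s" for s y
      using linear_scale[OF has_derivative_linear[OF has_derivative_dir_deriv[OF C_infinity_differentiable[OF N]]]]
      by (simp add: mult.commute)
    ultimately show "((\<lambda>t. ?N (\<xi> + t *\<^sub>R v)) has_real_derivative dir_deriv v ?N (\<xi> + t *\<^sub>R v)) (at t)"
      by (simp add: has_field_derivative_def)
  qed
  then obtain z where z: "0 < z" "z < h"
      "?N (\<xi> + h *\<^sub>R v) - ?N \<xi> = h * dir_deriv v ?N (\<xi> + z *\<^sub>R v)" by auto
  have "norm (\<xi> + z *\<^sub>R v - x) \<le> norm (\<xi> - x) + z * norm v"
    using norm_triangle_ineq[of "\<xi> - x" "z *\<^sub>R v"] z(1) by (simp add: algebra_simps)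
  also have "\<dots> \<le> h * (\<Sum>v\<leftarrow>vs. norm v) + h * norm v"
    using \<xi>(1) z(2) by (intro add_mono mult_right_mono) auto
  finally show ?case
    using \<xi>(2) z(3) by (intro exI[where x = "\<xi> + z *\<^sub>R v"]) (auto simp: algebra_simps finite_diff_diff)
qed

text \<open>A difference of order p is a signed sum of \<open>2 ^ p\<close> values of f, all taken
  within the stated distance of x.\<close>

lemma finite_diff_bound:
  fixes f :: "'a::real_normed_vector \<Rightarrow> real"
  assumes "\<And>y. norm (y - x) \<le> h * (\<Sum>v\<leftarrow>vs. norm v) \<Longrightarrow> \<bar>f y\<bar> \<le> M" "h > 0"
  shows "\<bar>finite_diff h vs f x\<bar> \<le> 2 ^ length vs * M"
  using assms(1)
proof (induction vs arbitrary: x)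
  case (Cons v vs)
  have "\<bar>finite_diff h vs f (x + h *\<^sub>R v)\<bar> \<le> 2 ^ length vs * M"
  proof (rule Cons.IH)
    fix y assume y: "norm (y - (x + h *\<^sub>R v)) \<le> h * (\<Sum>v\<leftarrow>vs. norm v)"
    have "norm (y - x) \<le> norm (y - (x + h *\<^sub>R v)) + norm (h *\<^sub>R v)"
      using norm_triangle_ineq[of "y - (x + h *\<^sub>R v)" "h *\<^sub>R v"] by (simp add: algebra_simps)
    then show "\<bar>f y\<bar> \<le> M" using y \<open>h > 0\<close> by (intro Cons.prems) (simp add: algebra_simps)
  qed
  moreover have "\<bar>finite_diff h vs f x\<bar> \<le> 2 ^ length vs * M"
  proof (rule Cons.IH)
    fix y assume "norm (y - x) \<le> h * (\<Sum>v\<leftarrow>vs. norm v)"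
    moreover have "0 \<le> h * norm v" using \<open>h > 0\<close> by simp
    ultimately show "\<bar>f y\<bar> \<le> M" by (intro Cons.prems) (simp add: algebra_simps)
  qed
  ultimately show ?case by simp
qed simp

section \<open>Vanishing jets\<close>

text \<open>Vanishing of all derivatives of order below m. Arbitrary directions are allowed, in
  accordance with the recursion of \<open>C_k\<close>.\<close>

definition flat_at :: "'a::real_normed_vector \<Rightarrow> nat \<Rightarrow> ('a \<Rightarrow> real) \<Rightarrow> bool" where
  "flat_at x0 m f \<longleftrightarrow> (\<forall>vs. length vs < m \<longrightarrow> foldr dir_deriv vs f x0 = 0)"

text \<open>
  A finite difference of order \<open>p < m\<close> with step \<open>h\<close> is \<open>h\<^sup>p\<close> times a mixed derivative at a nearby point, but
  it combines values of size \<open>O(h\<^sup>m)\<close>.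
\<close>

lemma flat_at_order_bound:
  fixes f :: "'a::euclidean_space \<Rightarrow> real"
  assumes f: "C_infinity f" and r: "r > 0" and B: "\<And>x. norm (x - x0) \<le> r \<Longrightarrow> \<bar>f x\<bar> \<le> B * norm (x - x0) ^ m"
  shows "flat_at x0 m f"
  unfolding flat_at_def
proof (intro allI impI)
  fix vs :: "'a list" assume p: "length vs < m"
  let ?p = "length vs"
  define S where "S = (\<Sum>v\<leftarrow>vs. norm v)"
  have S: "S \<ge> 0" unfolding S_def by (intro sum_list_nonneg) auto
  define h where "h n = inverse (real (Suc n))" for n
  have h: "h n > 0" for n by (simp add: h_def)
  have hlim: "h \<longlonglongrightarrow> 0" unfolding h_def by (rule LIMSEQ_inverse_real_of_nat)
  obtain \<xi> where \<xi>: "\<And>n. norm (\<xi> n - x0) \<le> h n * S"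
      "\<And>n. finite_diff (h n) vs f x0 = h n ^ ?p * foldr dir_deriv vs f (\<xi> n)"
    using finite_diff_mvt[of f _ x0 vs, OF f h] unfolding S_def by metis
  have hS: "(\<lambda>n. h n * S) \<longlonglongrightarrow> 0" using tendsto_mult[OF hlim tendsto_const, of S] by simp
  then have "(\<lambda>n. \<xi> n - x0) \<longlonglongrightarrow> 0" by (rule Lim_null_comparison[rotated]) (simp add: \<xi>(1))
  then have "\<xi> \<longlonglongrightarrow> x0" by (simp add: Lim_null[symmetric])
  moreover have "isCont (foldr dir_deriv vs f) x0"
    using C_infinity_continuous[OF C_infinity_foldr_dir_deriv[OF f]] by (simp add: continuous_on_eq_continuous_at)
  ultimately have lim1: "(\<lambda>n. foldr dir_deriv vs f (\<xi> n)) \<longlonglongrightarrow> foldr dir_deriv vs f x0"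
    by (simp add: isCont_tendsto_compose)
  have "\<forall>\<^sub>F n in sequentially. h n * S < r" using hS r by (rule order_tendstoD)
  then have "\<forall>\<^sub>F n in sequentially. norm (foldr dir_deriv vs f (\<xi> n)) \<le> 2 ^ ?p * (max B 0 * S ^ m) * h n ^ (m - ?p)"
  proof eventually_elim
    case (elim n)
    have "\<bar>finite_diff (h n) vs f x0\<bar> \<le> 2 ^ ?p * (max B 0 * (h n * S) ^ m)"
    proof (rule finite_diff_bound[OF _ h])
      fix y assume y: "norm (y - x0) \<le> h n * (\<Sum>v\<leftarrow>vs. norm v)"
      then have "\<bar>f y\<bar> \<le> B * norm (y - x0) ^ m" using elim by (intro B) (simp add: S_def)
      also have "\<dots> \<le> max B 0 * (h n * S) ^ m"
        using y by (intro mult_mono power_mono) (auto simp: S_def)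
      finally show "\<bar>f y\<bar> \<le> max B 0 * (h n * S) ^ m" .
    qed
    also have "(h n * S) ^ m = h n ^ ?p * (h n ^ (m - ?p) * S ^ m)"
      using p by (simp add: power_mult_distrib flip: power_add)
    finally have "h n ^ ?p * \<bar>foldr dir_deriv vs f (\<xi> n)\<bar>
        \<le> h n ^ ?p * (2 ^ ?p * (max B 0 * S ^ m) * h n ^ (m - ?p))"
      using h[of n] unfolding \<xi>(2) abs_mult by (simp add: mult_ac)
    then show ?case using h[of n] by (simp add: mult_le_cancel_left)
  qed
  moreover have "(\<lambda>n. 2 ^ ?p * (max B 0 * S ^ m) * h n ^ (m - ?p)) \<longlonglongrightarrow> 2 ^ ?p * (max B 0 * S ^ m) * 0 ^ (m - ?p)"
    by (intro tendsto_intros hlim)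
  then have "(\<lambda>n. 2 ^ ?p * (max B 0 * S ^ m) * h n ^ (m - ?p)) \<longlonglongrightarrow> 0"
    using p by (simp only: power_0_left) simp
  ultimately have "(\<lambda>n. foldr dir_deriv vs f (\<xi> n)) \<longlonglongrightarrow> 0"
    by (rule Lim_null_comparison)
  then show "foldr dir_deriv vs f x0 = 0" using lim1 LIMSEQ_unique by blast
qed

lemma flat_at_0: "flat_at x0 0 f"
  by (simp add: flat_at_def)

text \<open>\<open>foldr\<close> applies the last direction of the list first, so one derivative of
  \<open>f\<close> is split off at the end of the list.\<close>

lemma flat_at_Suc: "flat_at x0 (Suc m) f \<longleftrightarrow> f x0 = 0 \<and> (\<forall>v. flat_at x0 m (dir_deriv v f))"
proof
  assume L: "flat_at x0 (Suc m) f"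
  then have "f x0 = 0" unfolding flat_at_def by (metis foldr_Nil id_apply length_0_conv zero_less_Suc list.size(3))
  moreover have "flat_at x0 m (dir_deriv v f)" for v
    unfolding flat_at_def
  proof (intro allI impI)
    fix vs :: "'a list" assume "length vs < m"
    then show "foldr dir_deriv vs (dir_deriv v f) x0 = 0"
      using L unfolding flat_at_def by (elim allE[where x = "vs @ [v]"]) simp
  qed
  ultimately show "f x0 = 0 \<and> (\<forall>v. flat_at x0 m (dir_deriv v f))" by blast
next
  assume R: "f x0 = 0 \<and> (\<forall>v. flat_at x0 m (dir_deriv v f))"
  show "flat_at x0 (Suc m) f"
    unfolding flat_at_def
  proof (intro allI impI)
    fix vs :: "'a list" assume "length vs < Suc m"
    then show "foldr dir_deriv vs f x0 = 0"
      using R by (cases vs rule: rev_cases) (auto simp: flat_at_def)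
  qed
qed

lemma flat_at_Suc_imp: "flat_at x0 (Suc m) f \<Longrightarrow> flat_at x0 m f"
  by (simp add: flat_at_def)

lemma flat_at_add:
  assumes "C_infinity f" "C_infinity g" "flat_at x0 m f" "flat_at x0 m g"
  shows "flat_at x0 m (\<lambda>x. f x + g x)"
  using assms
proof (induction m arbitrary: f g)
  case (Suc m)
  then show ?case
    by (simp add: flat_at_Suc dir_deriv_add C_infinity_differentiable C_infinity_dir_deriv)
qed (simp add: flat_at_0)

lemma flat_at_mult:
  fixes f g :: "'a::euclidean_space \<Rightarrow> real"
  assumes "C_infinity f" "C_infinity g" "flat_at x0 m g"
  shows "flat_at x0 m (\<lambda>x. f x * g x)"
  using assms
proof (induction m arbitrary: f g)
  case (Suc m)
  have "flat_at x0 m (\<lambda>x. f x * dir_deriv v g x + dir_deriv v f x * g x)" for v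
    using Suc.prems flat_at_Suc_imp[OF Suc.prems(3)]
    by (intro flat_at_add Suc.IH C_infinity_mult C_infinity_dir_deriv) (auto simp: flat_at_Suc)
  then show ?case
    using Suc.prems by (simp add: flat_at_Suc dir_deriv_mult C_infinity_differentiable)
qed (simp add: flat_at_0)

lemma flat_at_zero: "flat_at x0 m (\<lambda>_. 0)"
proof -
  have "foldr dir_deriv vs (\<lambda>_. 0::real) = (\<lambda>_. 0)" for vs :: "'a list"
    by (induction vs) (auto simp: dir_deriv_eqI[OF has_derivative_const])
  then show ?thesis by (simp add: flat_at_def)
qed

lemma flat_at_sum:
  assumes "\<And>i. i \<in> I \<Longrightarrow> C_infinity (f i)" "\<And>i. i \<in> I \<Longrightarrow> flat_at x0 m (f i)"
  shows "flat_at x0 m (\<lambda>x. \<Sum>i\<in>I. f i x)"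
  using assms
proof (induction I rule: infinite_finite_induct)
  case (insert i I)
  then show ?case by (simp add: flat_at_add C_infinity_sum)
qed (simp_all add: flat_at_zero)

section \<open>Iterated action of vector fields\<close>

lemma vf_apply_dir_deriv: "vf_apply W f = (\<lambda>x. \<Sum>j\<in>UNIV. W x $ j * dir_deriv (axis j 1) f x)"
  by (simp add: vf_apply_def dir_deriv_def)

lemma vf_apply_mult:
  assumes "C_infinity f" "C_infinity g"
  shows "vf_apply W (\<lambda>x. f x * g x) = (\<lambda>x. f x * vf_apply W g x + vf_apply W f x * g x)"
  using assms
  by (simp add: vf_apply_dir_deriv dir_deriv_mult C_infinity_differentiable sum_distrib_left
      sum_distrib_right algebra_simps sum.distrib)

lemma vf_apply_add:
  assumes "C_infinity f" "C_infinity g"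
  shows "vf_apply W (\<lambda>x. f x + g x) = (\<lambda>x. vf_apply W f x + vf_apply W g x)"
  using assms
  by (simp add: vf_apply_dir_deriv dir_deriv_add C_infinity_differentiable algebra_simps sum.distrib)

lemma vf_apply_const: "vf_apply W (\<lambda>_. c) = (\<lambda>_. 0)"
  by (simp add: vf_apply_dir_deriv dir_deriv_eqI[OF has_derivative_const])

lemma vf_apply_coord: "vf_apply W (\<lambda>x. x $ j) = (\<lambda>x. W x $ j)"
proof -
  have "dir_deriv v (\<lambda>x. x $ j) = (\<lambda>x. v $ j)" for v :: "real ^ 'a"
    by (rule dir_deriv_eqI) (rule bounded_linear_imp_has_derivative[OF bounded_linear_vec_nth])
  then show ?thesis by (simp add: vf_apply_dir_deriv axis_def if_distrib sum.delta cong: if_cong)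
qed

lemma C_infinity_vf_apply:
  assumes "C_infinity W" "C_infinity f" shows "C_infinity (vf_apply W f)"
  unfolding vf_apply_dir_deriv using assms
  by (intro C_infinity_sum C_infinity_mult C_infinity_vec_nth C_infinity_dir_deriv)

text \<open>A vector field uses up one order of vanishing. Iterated along a word of length k, this
  shows that the terms of degree k depend on the k-jet alone.\<close>

lemma flat_at_vf_apply:
  assumes "C_infinity W" "C_infinity f" "flat_at x0 (Suc m) f"
  shows "flat_at x0 m (vf_apply W f)"
  unfolding vf_apply_dir_deriv using assms
  by (intro flat_at_sum flat_at_mult C_infinity_mult C_infinity_vec_nth C_infinity_dir_deriv)
     (auto simp: flat_at_Suc)

section \<open>Taylor terms of smooth functions\<close>

lemma holder_on_bounded:
  fixes f :: "real \<Rightarrow> 'a::real_normed_vector"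
  assumes "holder_on \<alpha> {0..T} f"
  obtains M where "M \<ge> 0" "\<And>t. 0 \<le> t \<Longrightarrow> t \<le> T \<Longrightarrow> norm (f t) \<le> M"
proof -
  obtain K where K: "\<alpha> > 0" "K \<ge> 0" "\<And>s t. s \<in> {0..T} \<Longrightarrow> t \<in> {0..T} \<Longrightarrow> dist (f s) (f t) \<le> K * \<bar>s - t\<bar> powr \<alpha>"
    using holder_onE[OF assms] by metis
  have "norm (f t) \<le> norm (f 0) + K * T powr \<alpha>" if t: "0 \<le> t" "t \<le> T" for t
  proof -
    have "norm (f t) \<le> norm (f 0) + dist (f t) (f 0)" unfolding dist_norm by (rule norm_triangle_sub)
    also have "dist (f t) (f 0) \<le> K * \<bar>t - 0\<bar> powr \<alpha>" using t by (intro K(3)) auto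
    also have "\<dots> \<le> K * T powr \<alpha>" using t K by (intro mult_left_mono powr_mono2) auto
    finally show ?thesis by simp
  qed
  moreover have "norm (f 0) + K * T powr \<alpha> \<ge> 0" using K by simp
  ultimately show ?thesis using that by blast
qed

lemma holder_onI_le:
  assumes "\<alpha> > 0" "\<And>s t. \<lbrakk>0 \<le> s; s \<le> t; t \<le> T\<rbrakk> \<Longrightarrow> dist (f s) (f t) \<le> c * (t - s) powr \<alpha>"
  shows "holder_on \<alpha> {0..T} f"
  unfolding holder_on_def
proof (intro conjI exI[where x = c] ballI assms(1))
  fix s t assume "s \<in> {0..T}" "t \<in> {0..T}"
  then show "dist (f s) (f t) \<le> c * \<bar>s - t\<bar> powr \<alpha>"
    using assms(2)[of s t] assms(2)[of t s] by (cases "s \<le> t") (simp_all add: dist_commute)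
qed

text \<open>On a bounded interval a remainder of order above one is absorbed by any exponent
  \<alpha> \<le> 1, so \<open>F\<close> inherits the regularity of its main term.\<close>

lemma holder_on_of_expansion:
  fixes F :: "real \<Rightarrow> 'a::real_normed_vector"
  assumes \<alpha>: "0 < \<alpha>" "\<alpha> \<le> 1"
    and R: "\<And>s t. \<lbrakk>0 \<le> s; s \<le> t; t \<le> T\<rbrakk> \<Longrightarrow> norm (R s t) \<le> c * (t - s) powr \<alpha>"
    and F: "negligible_on T (\<lambda>s t. F t - F s - R s t)"
  shows "holder_on \<alpha> {0..T} F"
proof -
  obtain \<theta> B where \<theta>: "\<theta> > 1" "B \<ge> 0"
    and B: "\<And>s t. \<lbrakk>0 \<le> s; s \<le> t; t \<le> T\<rbrakk> \<Longrightarrow> norm (F t - F s - R s t) \<le> B * (t - s) powr \<theta>"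
    using F unfolding negligible_on_def by blast
  show ?thesis
  proof (rule holder_onI_le[OF \<alpha>(1), where c = "c + B * T powr (\<theta> - \<alpha>)"])
    fix s t assume st: "0 \<le> s" "s \<le> t" "t \<le> T"
    have "norm (F t - F s - R s t) \<le> B * T powr (\<theta> - \<alpha>) * (t - s) powr \<alpha>"
      using \<theta> \<alpha> by (intro negligible_on_exponent[OF _ \<theta>(2) B st]) auto
    moreover have "dist (F s) (F t) \<le> norm (R s t) + norm (F t - F s - R s t)"
      using norm_triangle_ineq[of "R s t" "F t - F s - R s t"] by (simp add: dist_norm norm_minus_commute)
    ultimately show "dist (F s) (F t) \<le> (c + B * T powr (\<theta> - \<alpha>)) * (t - s) powr \<alpha>"
      using R[OF st] by (simp add: distrib_right)
  qed
qed

text \<open>Integration by parts in local form: the cross term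
  \<open>(F t - F s) * (G t - G s)\<close> has order 2 \<alpha> > 1 and drops out.\<close>

lemma negligible_on_product:
  fixes F G :: "real \<Rightarrow> real"
  assumes hF: "holder_on \<alpha> {0..T} F" and hG: "holder_on \<alpha> {0..T} G" and \<alpha>: "2 * \<alpha> > 1"
    and F: "negligible_on T (\<lambda>s t. F t - F s - A s t)" and G: "negligible_on T (\<lambda>s t. G t - G s - B s t)"
  shows "negligible_on T (\<lambda>s t. F t * G t - F s * G s - (F s * B s t + G s * A s t))"
proof -
  obtain MF where MF: "MF \<ge> 0" "\<And>t. 0 \<le> t \<Longrightarrow> t \<le> T \<Longrightarrow> norm (F t) \<le> MF"
    using holder_on_bounded[OF hF] by metis
  obtain MG where MG: "MG \<ge> 0" "\<And>t. 0 \<le> t \<Longrightarrow> t \<le> T \<Longrightarrow> norm (G t) \<le> MG"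
    using holder_on_bounded[OF hG] by metis
  obtain KF where KF: "\<alpha> > 0" "KF \<ge> 0" "\<And>s t. s \<in> {0..T} \<Longrightarrow> t \<in> {0..T} \<Longrightarrow> dist (F s) (F t) \<le> KF * \<bar>s - t\<bar> powr \<alpha>"
    using holder_onE[OF hF] by metis
  obtain KG where KG: "\<alpha> > 0" "KG \<ge> 0" "\<And>s t. s \<in> {0..T} \<Longrightarrow> t \<in> {0..T} \<Longrightarrow> dist (G s) (G t) \<le> KG * \<bar>s - t\<bar> powr \<alpha>"
    using holder_onE[OF hG] by metis
  have 1: "negligible_on T (\<lambda>s t. F s * (G t - G s - B s t))"
    using MF by (intro negligible_on_bounded_mult[OF G _ MF(1)]) (auto simp: abs_mult intro: mult_right_mono)
  have 2: "negligible_on T (\<lambda>s t. G s * (F t - F s - A s t))"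
    using MG by (intro negligible_on_bounded_mult[OF F _ MG(1)]) (auto simp: abs_mult intro: mult_right_mono)
  have 3: "negligible_on T (\<lambda>s t. (F t - F s) * (G t - G s))"
  proof (rule negligible_onI[OF \<alpha>])
    fix s t assume st: "0 \<le> s" "s \<le> t" "t \<le> T"
    have "\<bar>F t - F s\<bar> * \<bar>G t - G s\<bar> \<le> (KF * (t - s) powr \<alpha>) * (KG * (t - s) powr \<alpha>)"
      using KF(3)[of t s] KG(3)[of t s] st KF(2) by (intro mult_mono) (auto simp: dist_real_def)
    then show "norm ((F t - F s) * (G t - G s)) \<le> KF * KG * (t - s) powr (2 * \<alpha>)"
      unfolding mult_2 powr_add by (simp add: abs_mult mult_ac)
  qed
  show ?thesis
    using negligible_on_add[OF negligible_on_add[OF 1 2] 3] by (simp add: algebra_simps)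
qed

lemma holder_on_sum:
  fixes f :: "'i \<Rightarrow> real \<Rightarrow> real"
  assumes "\<And>i. i \<in> I \<Longrightarrow> holder_on \<alpha> S (f i)" "\<alpha> > 0"
  shows "holder_on \<alpha> S (\<lambda>t. \<Sum>i\<in>I. c i * f i t)"
proof -
  obtain C where C: "\<And>i. i \<in> I \<Longrightarrow> \<forall>s\<in>S. \<forall>t\<in>S. dist (f i s) (f i t) \<le> C i * \<bar>s - t\<bar> powr \<alpha>"
    using assms(1) unfolding holder_on_def by metis
  have "dist (\<Sum>i\<in>I. c i * f i s) (\<Sum>i\<in>I. c i * f i t) \<le> (\<Sum>i\<in>I. \<bar>c i\<bar> * C i) * \<bar>s - t\<bar> powr \<alpha>"
    if "s \<in> S" "t \<in> S" for s t
  proof -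
    have "dist (\<Sum>i\<in>I. c i * f i s) (\<Sum>i\<in>I. c i * f i t) = \<bar>\<Sum>i\<in>I. c i * (f i s - f i t)\<bar>"
      by (simp add: dist_real_def sum_subtractf right_diff_distrib)
    also have "\<dots> \<le> (\<Sum>i\<in>I. \<bar>c i\<bar> * (C i * \<bar>s - t\<bar> powr \<alpha>))"
      using C that by (intro sum_abs[THEN order_trans] sum_mono) (auto simp: abs_mult dist_real_def intro!: mult_left_mono)
    finally show ?thesis by (simp add: sum_distrib_right mult.assoc)
  qed
  then show ?thesis using assms(2) unfolding holder_on_def by blast
qed

section \<open>Expansion by degree along the driving path\<close>

text \<open>Normalised to the time interval \<open>[0, 1]\<close> and to \<beta> \<le> 1, the range
  in which remainders of order above one are absorbed into \<beta>-Hoelder bounds.\<close>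

locale taylor_data =
  fixes V :: "'m::finite \<Rightarrow> real ^ 'n \<Rightarrow> real ^ 'n"
    and y :: "real \<Rightarrow> real ^ 'm"
    and x0 :: "real ^ 'n"
    and \<beta> K :: real
  assumes smooth: "C_infinity (V i)"
    and \<beta>: "1 / 2 < \<beta>" "\<beta> \<le> 1"
    and K: "K \<ge> 0"
    and y_holder: "\<lbrakk>s \<in> {0..1}; t \<in> {0..1}\<rbrakk> \<Longrightarrow> \<bar>y s $ i - y t $ i\<bar> \<le> K * \<bar>s - t\<bar> powr \<beta>"
begin

lemma y_component_holder_on: "holder_on \<beta> {0..1} (\<lambda>s. y s $ i)"
  unfolding holder_on_def dist_real_def using \<beta> y_holder by (intro conjI exI[where x = K] ballI) auto

lemma iterated_integral_snoc:
  "iterated_integral y (I @ [i]) t = young_integral (iterated_integral y I) (\<lambda>s. y s $ i) 0 t"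
  by (simp add: iterated_integral_def)

text \<open>Regularity has to accompany the induction on the word: the next
  \<open>young_integral\<close> can be expanded because its integrand is again \<beta>-Hoelder and 2
  \<beta> > 1.\<close>

lemma iterated_integral_holder_on: "holder_on \<beta> {0..1} (iterated_integral y I)"
proof (induction I rule: rev_induct)
  case Nil
  show ?case unfolding iterated_integral_def holder_on_def using \<beta> by (auto intro: exI[where x = 0])
next
  case (snoc i I)
  let ?F = "iterated_integral y I"
  obtain M where M: "M \<ge> 0" "\<And>t. 0 \<le> t \<Longrightarrow> t \<le> 1 \<Longrightarrow> norm (?F t) \<le> M"
    using holder_on_bounded[OF snoc] by metis
  show ?case
  proof (rule holder_on_of_expansion[where R = "\<lambda>s t. ?F s * (y t $ i - y s $ i)" and c = "M * K"])
    fix s t :: real assume st: "0 \<le> s" "s \<le> t" "t \<le> 1"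
    have "\<bar>?F s\<bar> * \<bar>y t $ i - y s $ i\<bar> \<le> M * (K * (t - s) powr \<beta>)"
      using M y_holder[of t s i] st by (intro mult_mono) auto
    then show "norm (?F s * (y t $ i - y s $ i)) \<le> M * K * (t - s) powr \<beta>"
      by (simp add: abs_mult mult.assoc)
  next
    show "negligible_on 1 (\<lambda>s t. iterated_integral y (I @ [i]) t - iterated_integral y (I @ [i]) s
        - ?F s * (y t $ i - y s $ i))"
      unfolding iterated_integral_snoc
      by (rule young_integral_expansion[OF snoc y_component_holder_on]) (use \<beta> in auto)
  qed (use \<beta> in auto)
qed

lemma iterated_integral_expansion:
  "negligible_on 1 (\<lambda>s t. iterated_integral y (I @ [i]) t - iterated_integral y (I @ [i]) s
     - iterated_integral y I s * (y t $ i - y s $ i))"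
  unfolding iterated_integral_snoc
  by (rule young_integral_expansion[OF iterated_integral_holder_on y_component_holder_on]) (use \<beta> in auto)

lemma iterated_integral_0: "I \<noteq> [] \<Longrightarrow> iterated_integral y I 0 = 0"
proof (induction I rule: rev_induct)
  case (snoc i I)
  have "{0..0} \<subseteq> {0..1::real}" by auto
  then show ?case
    unfolding iterated_integral_snoc using \<beta>
    by (intro young_integral_0[where \<alpha> = \<beta> and \<beta> = \<beta>])
       (auto intro: holder_on_subset iterated_integral_holder_on y_component_holder_on)
qed simp

definition word_deriv :: "'m list \<Rightarrow> (real ^ 'n \<Rightarrow> real) \<Rightarrow> real ^ 'n \<Rightarrow> real" where
  "word_deriv I f = foldr (\<lambda>i. vf_apply (V i)) I f"

text \<open>The homogeneous part of degree \<open>k\<close> of the formal expansion of \<open>f (X t)\<close>.\<close>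

definition expansion_term :: "nat \<Rightarrow> (real ^ 'n \<Rightarrow> real) \<Rightarrow> real \<Rightarrow> real" where
  "expansion_term k f t = (\<Sum>I | length I = k. word_deriv I f x0 * iterated_integral y I t)"

lemma word_deriv_snoc: "word_deriv (I @ [i]) f = word_deriv I (vf_apply (V i) f)"
  by (simp add: word_deriv_def)

lemma word_deriv_linear:
  assumes "C_infinity f" "C_infinity g"
  shows "word_deriv I (\<lambda>x. a * f x + g x) = (\<lambda>x. a * word_deriv I f x + word_deriv I g x)"
  using assms
proof (induction I arbitrary: f g rule: rev_induct)
  case Nil
  then show ?case by (simp add: word_deriv_def)
next
  case (snoc i I)
  have "vf_apply (V i) (\<lambda>x. a * f x + g x) = (\<lambda>x. a * vf_apply (V i) f x + vf_apply (V i) g x)"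
    using snoc.prems by (simp add: vf_apply_add vf_apply_mult vf_apply_const C_infinity_mult C_infinity_const)
  then show ?case
    using snoc.IH[OF C_infinity_vf_apply[OF smooth snoc.prems(1)] C_infinity_vf_apply[OF smooth snoc.prems(2)]]
    by (simp add: word_deriv_snoc)
qed

lemma expansion_term_linear:
  assumes "C_infinity f" "C_infinity g"
  shows "expansion_term k (\<lambda>x. a * f x + g x) t = a * expansion_term k f t + expansion_term k g t"
  by (simp add: expansion_term_def word_deriv_linear[OF assms] distrib_right sum.distrib sum_distrib_left mult.assoc)

lemma expansion_term_add:
  assumes "C_infinity f" "C_infinity g"
  shows "expansion_term k (\<lambda>x. f x + g x) t = expansion_term k f t + expansion_term k g t"
  using expansion_term_linear[OF assms, of k 1 t] by simp

lemma word_deriv_flat: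
  "\<lbrakk>C_infinity f; flat_at x0 m f; length I < m\<rbrakk> \<Longrightarrow> word_deriv I f x0 = 0"
proof (induction I arbitrary: f m rule: rev_induct)
  case Nil
  then show ?case by (cases m) (auto simp: word_deriv_def flat_at_Suc)
next
  case (snoc i I)
  then obtain m' where m: "m = Suc m'" "length I < m'" by (cases m) auto
  have "word_deriv I (vf_apply (V i) f) x0 = 0"
    using snoc.prems m by (intro snoc.IH[where m = m'] C_infinity_vf_apply smooth flat_at_vf_apply) auto
  then show ?case by (simp add: word_deriv_snoc)
qed

lemma expansion_term_flat: "\<lbrakk>C_infinity f; flat_at x0 m f; k < m\<rbrakk> \<Longrightarrow> expansion_term k f t = 0"
  by (auto simp: expansion_term_def word_deriv_flat intro!: sum.neutral)

lemma expansion_term_zero: "expansion_term k (\<lambda>_. 0) t = 0"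
  using expansion_term_linear[of "\<lambda>_. 0" "\<lambda>_. 0" k 2 t] by (simp add: C_infinity_const)

lemma expansion_term_sum:
  assumes "finite J" "\<And>j. j \<in> J \<Longrightarrow> C_infinity (f j)"
  shows "expansion_term k (\<lambda>x. \<Sum>j\<in>J. c j * f j x) t = (\<Sum>j\<in>J. c j * expansion_term k (f j) t)"
  using assms
proof (induction J rule: finite_induct)
  case (insert j J)
  then show ?case
    by (simp add: expansion_term_linear C_infinity_sum C_infinity_mult C_infinity_const)
qed (simp add: expansion_term_zero)

lemma expansion_term_degree_0: "expansion_term 0 f t = f x0"
  by (simp add: expansion_term_def word_deriv_def iterated_integral_def)

lemma expansion_term_Suc_at_0: "expansion_term (Suc k) f 0 = 0"
proof -
  have "iterated_integral y I 0 = 0" if "length I = Suc k" for I :: "'m list"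
    using that by (intro iterated_integral_0) auto
  then show ?thesis by (simp add: expansion_term_def)
qed

text \<open>The last letter suits both factors of \<open>expansion_term\<close>: it is the outermost
  integration in \<open>iterated_integral\<close> and the first field applied to \<open>f\<close> in
  \<open>word_deriv\<close>.\<close>

lemma sum_words_snoc:
  "(\<Sum>I | length I = Suc k. F (I :: 'm list)) = (\<Sum>I | length I = k. \<Sum>i\<in>UNIV. F (I @ [i]))"
proof -
  have "finite {I :: 'm list. length I = k}" using finite_lists_length_eq[of "UNIV :: 'm set" k] by simp
  moreover have "bij_betw (\<lambda>(I, i). I @ [i]) ({I :: 'm list. length I = k} \<times> UNIV) {I. length I = Suc k}"
    by (rule bij_betw_byWitness[where f' = "\<lambda>J. (butlast J, last J)"]) (auto simp: append_butlast_last_id length_Suc_conv_rev)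
  ultimately show ?thesis
    by (subst sum.cartesian_product) (simp add: sum.reindex_bij_betw[symmetric] case_prod_unfold)
qed

text \<open>The chain rule degree by degree: the differential of the term of degree l + 1 of
  \<open>f\<close> is the sum over i of the term of degree l of \<open>V i\<close> applied to
  \<open>f\<close>, times the differential of the i-th component of \<open>y\<close>.\<close>

definition expansion_incr :: "nat \<Rightarrow> (real ^ 'n \<Rightarrow> real) \<Rightarrow> real \<Rightarrow> real \<Rightarrow> real" where
  "expansion_incr k f s t =
     (case k of 0 \<Rightarrow> 0 | Suc l \<Rightarrow> \<Sum>i\<in>UNIV. expansion_term l (vf_apply (V i) f) s * (y t $ i - y s $ i))"

lemma expansion_term_expansion:
  "negligible_on 1 (\<lambda>s t. expansion_term k f t - expansion_term k f s - expansion_incr k f s t)"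
proof (cases k)
  case 0
  then show ?thesis by (simp add: expansion_term_degree_0 expansion_incr_def negligible_on_0)
next
  case (Suc l)
  have "expansion_term k f t - expansion_term k f s - expansion_incr k f s t
      = (\<Sum>I | length I = l. \<Sum>i\<in>UNIV. word_deriv (I @ [i]) f x0 *\<^sub>R
          (iterated_integral y (I @ [i]) t - iterated_integral y (I @ [i]) s
           - iterated_integral y I s * (y t $ i - y s $ i)))" for s t
  proof -
    have "expansion_incr k f s t = (\<Sum>I | length I = l. \<Sum>i\<in>UNIV. word_deriv (I @ [i]) f x0 *
          (iterated_integral y I s * (y t $ i - y s $ i)))"
      by (subst sum.swap) (simp add: Suc expansion_incr_def expansion_term_def word_deriv_snoc
          sum_distrib_right mult.assoc)
    then show ?thesis
      by (simp add: Suc expansion_term_def sum_words_snoc right_diff_distrib sum_subtractf)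
  qed
  moreover have "negligible_on 1 (\<lambda>s t. \<Sum>I | length I = l. \<Sum>i\<in>UNIV. word_deriv (I @ [i]) f x0 *\<^sub>R
          (iterated_integral y (I @ [i]) t - iterated_integral y (I @ [i]) s
           - iterated_integral y I s * (y t $ i - y s $ i)))"
    by (intro negligible_on_sum negligible_on_scaleR iterated_integral_expansion)
  ultimately show ?thesis by simp
qed

lemma expansion_term_holder_on: "holder_on \<beta> {0..1} (expansion_term k f)"
  unfolding expansion_term_def[abs_def] using \<beta>
  by (intro holder_on_sum iterated_integral_holder_on) auto

text \<open>Both sides vanish at time 0 for positive degree, and by the Leibniz rule for the fields
  and the induction hypothesis they have the same local expansion, so they agree. This takes the
  role of the shuffle identity for iterated integrals.\<close>

lemma expansion_term_mult:
  assumes "C_infinity f" "C_infinity g" "0 \<le> t" "t \<le> 1"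
  shows "expansion_term k (\<lambda>x. f x * g x) t = (\<Sum>a\<le>k. expansion_term a f t * expansion_term (k - a) g t)"
  using assms
proof (induction k arbitrary: f g t)
  case 0
  then show ?case by (simp add: expansion_term_degree_0)
next
  case (Suc k)
  let ?E = expansion_term and ?D = expansion_incr
  have fg: "C_infinity (vf_apply (V i) f)" "C_infinity (vf_apply (V i) g)" for i
    using Suc.prems smooth by (auto intro: C_infinity_vf_apply)
  define P where "P t = (\<Sum>a\<le>Suc k. ?E a f t * ?E (Suc k - a) g t)" for t
  have P: "negligible_on 1 (\<lambda>s t. P t - P s
      - (\<Sum>a\<le>Suc k. ?E a f s * ?D (Suc k - a) g s t + ?E (Suc k - a) g s * ?D a f s t))"
    unfolding P_def sum_subtractf[symmetric] using \<beta>
    by (intro negligible_on_sum negligible_on_product[where \<alpha> = \<beta>] expansion_term_holder_on expansion_term_expansion) auto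
  have incr: "?D (Suc k) (\<lambda>x. f x * g x) s t
      = (\<Sum>a\<le>Suc k. ?E a f s * ?D (Suc k - a) g s t + ?E (Suc k - a) g s * ?D a f s t)"
    if s: "0 \<le> s" "s \<le> 1" for s t
  proof -
    have "?D (Suc k) (\<lambda>x. f x * g x) s t = (\<Sum>i\<in>UNIV. (\<Sum>a\<le>k. ?E a f s * ?E (k - a) (vf_apply (V i) g) s
        + ?E a (vf_apply (V i) f) s * ?E (k - a) g s) * (y t $ i - y s $ i))"
      using Suc.prems fg s
      by (simp add: expansion_incr_def vf_apply_mult expansion_term_add C_infinity_mult Suc.IH sum.distrib)
    also have "\<dots> = (\<Sum>a\<le>k. ?E a f s * (\<Sum>i\<in>UNIV. ?E (k - a) (vf_apply (V i) g) s * (y t $ i - y s $ i)))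
        + (\<Sum>a\<le>k. ?E (k - a) g s * (\<Sum>i\<in>UNIV. ?E a (vf_apply (V i) f) s * (y t $ i - y s $ i)))"
      unfolding sum_distrib_right sum_distrib_left
      by (subst sum.swap, simp add: sum.distrib[symmetric] algebra_simps)
    \<comment> \<open>The summand added at \<open>a = Suc k\<close> carries an increment of degree
      0, which is zero. The same happens at \<open>a = 0\<close> in the second sum, where the index
      is therefore shifted.\<close>
    also have "(\<Sum>a\<le>k. ?E a f s * (\<Sum>i\<in>UNIV. ?E (k - a) (vf_apply (V i) g) s * (y t $ i - y s $ i)))
        = (\<Sum>a\<le>Suc k. ?E a f s * ?D (Suc k - a) g s t)"
      by (simp add: expansion_incr_def Suc_diff_le)
    also have "(\<Sum>a\<le>k. ?E (k - a) g s * (\<Sum>i\<in>UNIV. ?E a (vf_apply (V i) f) s * (y t $ i - y s $ i)))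
        = (\<Sum>a\<le>Suc k. ?E (Suc k - a) g s * ?D a f s t)"
      by (subst sum.atMost_Suc_shift) (simp add: expansion_incr_def)
    finally show ?thesis by (simp add: sum.distrib)
  qed
  have "negligible_on 1 (\<lambda>s t. ?E (Suc k) (\<lambda>x. f x * g x) t - ?E (Suc k) (\<lambda>x. f x * g x) s
      - (\<Sum>a\<le>Suc k. ?E a f s * ?D (Suc k - a) g s t + ?E (Suc k - a) g s * ?D a f s t))"
    by (subst negligible_on_cong[OF arg_cong2[where f = minus, OF refl incr[symmetric]]])
       (auto intro: expansion_term_expansion)
  from negligible_on_diff[OF this P]
  have "negligible_on 1 (\<lambda>s t. (?E (Suc k) (\<lambda>x. f x * g x) t - P t) - (?E (Suc k) (\<lambda>x. f x * g x) s - P s))"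
    by (simp add: algebra_simps)
  then have "?E (Suc k) (\<lambda>x. f x * g x) t - P t = ?E (Suc k) (\<lambda>x. f x * g x) 0 - P 0"
    using Suc.prems by (intro negligible_increment_imp_const[where F = "\<lambda>t. ?E (Suc k) (\<lambda>x. f x * g x) t - P t"]) auto
  \<comment> \<open>In each product one of the two degrees is positive, and terms of positive degree
    vanish at time 0.\<close>
  moreover have "P 0 = 0"
  proof -
    have "?E a f 0 * ?E (Suc k - a) g 0 = 0" if "a \<le> Suc k" for a
      using that by (cases a) (auto simp: expansion_term_Suc_at_0)
    then show ?thesis unfolding P_def by (intro sum.neutral) auto
  qed
  ultimately show ?case by (simp add: P_def expansion_term_Suc_at_0)
qed

end

section \<open>Hoelder norms on a short interval\<close>

text \<open>
  On a short interval \<open>[0, T]\<close> the quantity \<open>\<bar>f 0\<bar> + [f]\<^sub>\<alpha>\<close>, where \<open>[f]\<^sub>\<alpha>\<close> is the Hoelder seminorm, is a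
  submultiplicative norm; \<open>hnorm_le f c\<close> says that it is at most \<open>c\<close>.
\<close>

locale short_interval =
  fixes T \<alpha> :: real
  assumes T: "0 < T" "T \<le> 1" and \<alpha>: "0 < \<alpha>" and short: "2 * T powr \<alpha> \<le> 1"
begin

definition hnorm_le :: "(real \<Rightarrow> real) \<Rightarrow> real \<Rightarrow> bool" where
  "hnorm_le f c \<longleftrightarrow> \<bar>f 0\<bar> \<le> c \<and>
     (\<forall>s t. 0 \<le> s \<longrightarrow> s \<le> t \<longrightarrow> t \<le> T \<longrightarrow> \<bar>f t - f s\<bar> \<le> (c - \<bar>f 0\<bar>) * (t - s) powr \<alpha>)"

lemma hnorm_le_nonneg: "hnorm_le f c \<Longrightarrow> c \<ge> 0"
  unfolding hnorm_le_def by linarith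

lemma hnorm_leD:
  "\<lbrakk>hnorm_le f c; 0 \<le> s; s \<le> t; t \<le> T\<rbrakk> \<Longrightarrow> \<bar>f t - f s\<bar> \<le> c * (t - s) powr \<alpha>"
proof -
  assume *: "hnorm_le f c" "0 \<le> s" "s \<le> t" "t \<le> T"
  then have "\<bar>f t - f s\<bar> \<le> (c - \<bar>f 0\<bar>) * (t - s) powr \<alpha>" unfolding hnorm_le_def by blast
  also have "\<dots> \<le> c * (t - s) powr \<alpha>" by (intro mult_right_mono) auto
  finally show ?thesis .
qed

lemma powr_short: "0 \<le> h \<Longrightarrow> h \<le> T \<Longrightarrow> h powr \<alpha> \<le> 1 / 2"
  using powr_mono2[of \<alpha> h T] \<alpha> short by simp

lemma hnorm_le_abs: "\<lbrakk>hnorm_le f c; 0 \<le> t; t \<le> T\<rbrakk> \<Longrightarrow> \<bar>f t\<bar> \<le> \<bar>f 0\<bar> + (c - \<bar>f 0\<bar>) * T powr \<alpha>"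
proof -
  assume *: "hnorm_le f c" "0 \<le> t" "t \<le> T"
  then have "\<bar>f t - f 0\<bar> \<le> (c - \<bar>f 0\<bar>) * (t - 0) powr \<alpha>" unfolding hnorm_le_def by blast
  also have "\<dots> \<le> (c - \<bar>f 0\<bar>) * T powr \<alpha>"
    using * \<alpha> by (intro mult_left_mono powr_mono2) (auto simp: hnorm_le_def)
  finally show ?thesis by linarith
qed

lemma hnorm_le_bound: assumes "hnorm_le f c" "0 \<le> t" "t \<le> T" shows "\<bar>f t\<bar> \<le> c"
proof -
  have "(c - \<bar>f 0\<bar>) * T powr \<alpha> \<le> (c - \<bar>f 0\<bar>) * 1"
    using assms(1) short by (intro mult_left_mono) (auto simp: hnorm_le_def)
  then have "\<bar>f 0\<bar> + (c - \<bar>f 0\<bar>) * T powr \<alpha> \<le> c" by simp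
  then show ?thesis using hnorm_le_abs[OF assms] by (rule order_trans[rotated])
qed

lemma hnorm_le_mono: assumes "hnorm_le f c" "c \<le> d" shows "hnorm_le f d"
  unfolding hnorm_le_def
proof (intro conjI allI impI)
  fix s t assume "0 \<le> s" "s \<le> t" "t \<le> T"
  then have "\<bar>f t - f s\<bar> \<le> (c - \<bar>f 0\<bar>) * (t - s) powr \<alpha>" using assms unfolding hnorm_le_def by blast
  also have "\<dots> \<le> (d - \<bar>f 0\<bar>) * (t - s) powr \<alpha>" using assms by (intro mult_right_mono) auto
  finally show "\<bar>f t - f s\<bar> \<le> (d - \<bar>f 0\<bar>) * (t - s) powr \<alpha>" .
qed (use assms in \<open>auto simp: hnorm_le_def\<close>)

lemma hnorm_le_cong:
  assumes "\<And>t. 0 \<le> t \<Longrightarrow> t \<le> T \<Longrightarrow> f t = g t" shows "hnorm_le f c \<longleftrightarrow> hnorm_le g c"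
  unfolding hnorm_le_def using assms T by auto

lemma hnorm_le_const: "hnorm_le (\<lambda>_. a) \<bar>a\<bar>"
  by (simp add: hnorm_le_def)

lemma hnorm_le_add:
  assumes f: "hnorm_le f c" and g: "hnorm_le g d" shows "hnorm_le (\<lambda>t. f t + g t) (c + d)"
  unfolding hnorm_le_def
proof (intro conjI allI impI)
  fix s t assume st: "0 \<le> s" "s \<le> t" "t \<le> T"
  have "\<bar>f t - f s\<bar> \<le> (c - \<bar>f 0\<bar>) * (t - s) powr \<alpha>" "\<bar>g t - g s\<bar> \<le> (d - \<bar>g 0\<bar>) * (t - s) powr \<alpha>"
    using st f g unfolding hnorm_le_def by blast+
  then have "\<bar>f t + g t - (f s + g s)\<bar> \<le> ((c - \<bar>f 0\<bar>) + (d - \<bar>g 0\<bar>)) * (t - s) powr \<alpha>"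
    unfolding distrib_right by linarith
  also have "\<dots> \<le> (c + d - \<bar>f 0 + g 0\<bar>) * (t - s) powr \<alpha>" by (intro mult_right_mono) auto
  finally show "\<bar>f t + g t - (f s + g s)\<bar> \<le> (c + d - \<bar>f 0 + g 0\<bar>) * (t - s) powr \<alpha>" .
qed (use f g in \<open>auto simp: hnorm_le_def\<close>)

text \<open>With c = a + p and d = b + q, where a and b are the absolute initial values, the Hoelder
  constant of the product is at most \<open>a * q + b * p + 2 * \<tau> * p * q\<close> for
  \<open>\<tau> = T powr \<alpha>\<close>. The assumption \<open>short\<close> lowers this to
  \<open>c * d - a * b\<close>; this is where it comes from.\<close>

lemma hnorm_le_mult:
  assumes f: "hnorm_le f c" and g: "hnorm_le g d" shows "hnorm_le (\<lambda>t. f t * g t) (c * d)"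
  unfolding hnorm_le_def
proof (intro conjI allI impI)
  have f0: "\<bar>f 0\<bar> \<le> c" and g0: "\<bar>g 0\<bar> \<le> d" using f g by (auto simp: hnorm_le_def)
  then show "\<bar>f 0 * g 0\<bar> \<le> c * d" unfolding abs_mult by (intro mult_mono) auto
  fix s t assume st: "0 \<le> s" "s \<le> t" "t \<le> T"
  define a b p q \<tau> h where "a = \<bar>f 0\<bar>" and "b = \<bar>g 0\<bar>" and "p = c - a" and "q = d - b"
    and "\<tau> = T powr \<alpha>" and "h = (t - s) powr \<alpha>"
  have nn: "a \<ge> 0" "b \<ge> 0" "p \<ge> 0" "q \<ge> 0" "h \<ge> 0" "\<tau> \<ge> 0" "2 * \<tau> \<le> 1"
    using f0 g0 short by (auto simp: a_def b_def p_def q_def h_def \<tau>_def)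
  have df: "\<bar>f t - f s\<bar> \<le> p * h" "\<bar>g t - g s\<bar> \<le> q * h"
    using st f g unfolding hnorm_le_def p_def q_def h_def a_def b_def by blast+
  have bf: "\<bar>f t\<bar> \<le> a + p * \<tau>" "\<bar>g s\<bar> \<le> b + q * \<tau>"
    using hnorm_le_abs[OF f, of t] hnorm_le_abs[OF g, of s] st by (auto simp: a_def b_def p_def q_def \<tau>_def)
  have "\<bar>f t * g t - f s * g s\<bar> = \<bar>f t * (g t - g s) + g s * (f t - f s)\<bar>" by (simp add: algebra_simps)
  also have "\<dots> \<le> \<bar>f t\<bar> * \<bar>g t - g s\<bar> + \<bar>g s\<bar> * \<bar>f t - f s\<bar>"
    unfolding abs_mult[symmetric] by (rule abs_triangle_ineq)
  also have "\<dots> \<le> (a + p * \<tau>) * (q * h) + (b + q * \<tau>) * (p * h)"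
    using df bf nn by (intro add_mono mult_mono) auto
  also have "\<dots> = (a * q + b * p + p * q * (2 * \<tau>)) * h" by (simp add: algebra_simps)
  also have "\<dots> \<le> (a * q + b * p + p * q * 1) * h"
    using nn by (intro mult_right_mono add_left_mono mult_left_mono) auto
  also have "\<dots> = (c * d - \<bar>f 0 * g 0\<bar>) * h"
    by (simp add: p_def q_def a_def b_def abs_mult algebra_simps)
  finally show "\<bar>f t * g t - f s * g s\<bar> \<le> (c * d - \<bar>f 0 * g 0\<bar>) * (t - s) powr \<alpha>" by (simp add: h_def)
qed

lemma hnorm_le_cmult: "hnorm_le f c \<Longrightarrow> hnorm_le (\<lambda>t. a * f t) (\<bar>a\<bar> * c)"
  using hnorm_le_mult[OF hnorm_le_const] .

lemma hnorm_le_sum: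
  assumes "\<And>i. i \<in> I \<Longrightarrow> hnorm_le (f i) (c i)" shows "hnorm_le (\<lambda>t. \<Sum>i\<in>I. f i t) (\<Sum>i\<in>I. c i)"
  using assms hnorm_le_const[of 0]
  by (induction I rule: infinite_finite_induct) (auto intro: hnorm_le_add)

text \<open>Pointwise convergence suffices, because each inequality in \<open>hnorm_le\<close>
  involves only finitely many values of the function.\<close>

lemma hnorm_le_limit:
  assumes "\<And>n::nat. hnorm_le (f n) c" "\<And>t. 0 \<le> t \<Longrightarrow> t \<le> T \<Longrightarrow> (\<lambda>n. f n t) \<longlonglongrightarrow> g t"
  shows "hnorm_le g c"
  unfolding hnorm_le_def
proof (intro conjI allI impI)
  have lim0: "(\<lambda>n. \<bar>f n 0\<bar>) \<longlonglongrightarrow> \<bar>g 0\<bar>" using assms(2)[of 0] T by (intro tendsto_intros) auto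
  then show "\<bar>g 0\<bar> \<le> c" by (rule LIMSEQ_le_const2) (use assms(1) in \<open>auto simp: hnorm_le_def\<close>)
  fix s t assume st: "0 \<le> s" "s \<le> t" "t \<le> T"
  show "\<bar>g t - g s\<bar> \<le> (c - \<bar>g 0\<bar>) * (t - s) powr \<alpha>"
  proof (rule LIMSEQ_le)
    show "(\<lambda>n. \<bar>f n t - f n s\<bar>) \<longlonglongrightarrow> \<bar>g t - g s\<bar>" using st by (intro tendsto_intros assms(2)) auto
    show "(\<lambda>n. (c - \<bar>f n 0\<bar>) * (t - s) powr \<alpha>) \<longlonglongrightarrow> (c - \<bar>g 0\<bar>) * (t - s) powr \<alpha>"
      by (intro tendsto_intros lim0)
    show "\<exists>N. \<forall>n\<ge>N. \<bar>f n t - f n s\<bar> \<le> (c - \<bar>f n 0\<bar>) * (t - s) powr \<alpha>"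
      using assms(1) st unfolding hnorm_le_def by blast
  qed
qed

section \<open>Total norms of graded families\<close>

text \<open>Encodes a bound on the sum of the norms of the degrees up to N through a choice of one
  bound per degree, so that the norm itself need not be formed as an infimum.\<close>

definition series_le :: "nat \<Rightarrow> (nat \<Rightarrow> real \<Rightarrow> real) \<Rightarrow> real \<Rightarrow> bool" where
  "series_le N F c \<longleftrightarrow> (\<exists>b. (\<forall>k\<le>N. hnorm_le (F k) (b k)) \<and> (\<Sum>k\<le>N. b k) \<le> c)"

lemma series_leI: "(\<And>k. k \<le> N \<Longrightarrow> hnorm_le (F k) (b k)) \<Longrightarrow> (\<Sum>k\<le>N. b k) \<le> c \<Longrightarrow> series_le N F c"
  unfolding series_le_def by blast

lemma series_leE:
  assumes "series_le N F c"
  obtains b where "\<And>k. k \<le> N \<Longrightarrow> hnorm_le (F k) (b k)" "\<And>k. b k \<ge> 0" "(\<Sum>k\<le>N. b k) \<le> c"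
proof -
  obtain b where b: "\<And>k. k \<le> N \<Longrightarrow> hnorm_le (F k) (b k)" "(\<Sum>k\<le>N. b k) \<le> c"
    using assms unfolding series_le_def by blast
  show ?thesis
    by (rule that[of "\<lambda>k. if k \<le> N then b k else 0"]) (use b hnorm_le_nonneg in auto)
qed

lemma series_le_cong:
  assumes "\<And>k t. k \<le> N \<Longrightarrow> 0 \<le> t \<Longrightarrow> t \<le> T \<Longrightarrow> F k t = G k t"
  shows "series_le N F c \<longleftrightarrow> series_le N G c"
proof -
  have "hnorm_le (F k) d \<longleftrightarrow> hnorm_le (G k) d" if "k \<le> N" for k d
    by (rule hnorm_le_cong) (rule assms[OF that])
  then show ?thesis unfolding series_le_def by auto
qed

text \<open>Pairs of degrees with sum at most N lie in the square of degrees up to N, so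
  submultiplicativity survives the truncation.\<close>

lemma series_le_mult:
  assumes F: "series_le N F c" and G: "series_le N G d"
  shows "series_le N (\<lambda>k t. \<Sum>a\<le>k. F a t * G (k - a) t) (c * d)"
proof -
  obtain b where b: "\<And>k. k \<le> N \<Longrightarrow> hnorm_le (F k) (b k)" "\<And>k. b k \<ge> 0" "(\<Sum>k\<le>N. b k) \<le> c"
    using series_leE[OF F] by metis
  obtain b' where b': "\<And>k. k \<le> N \<Longrightarrow> hnorm_le (G k) (b' k)" "\<And>k. b' k \<ge> 0" "(\<Sum>k\<le>N. b' k) \<le> d"
    using series_leE[OF G] by metis
  show ?thesis
  proof (rule series_leI[where b = "\<lambda>k. \<Sum>a\<le>k. b a * b' (k - a)"])
    show "hnorm_le (\<lambda>t. \<Sum>a\<le>k. F a t * G (k - a) t) (\<Sum>a\<le>k. b a * b' (k - a))" if "k \<le> N" for k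
      using that by (intro hnorm_le_sum hnorm_le_mult b b') auto
    have "(\<Sum>k\<le>N. \<Sum>a\<le>k. b a * b' (k - a)) = (\<Sum>(i, j)\<in>{(i, j). i + j \<le> N}. b i * b' j)"
      by (rule sum.triangle_reindex_eq[symmetric])
    also have "\<dots> \<le> (\<Sum>(i, j)\<in>{..N} \<times> {..N}. b i * b' j)"
      using b b' by (intro sum_mono2) auto
    also have "\<dots> = (\<Sum>k\<le>N. b k) * (\<Sum>k\<le>N. b' k)"
      by (simp add: sum_product sum.cartesian_product)
    also have "\<dots> \<le> c * d"
      using b b' by (intro mult_mono sum_nonneg) (auto intro: order_trans[OF sum_nonneg b(3)])
    finally show "(\<Sum>k\<le>N. \<Sum>a\<le>k. b a * b' (k - a)) \<le> c * d" .
  qed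
qed

lemma series_le_linear_combination:
  assumes "finite S" "\<And>i. i \<in> S \<Longrightarrow> series_le N (F i) (d i)"
  shows "series_le N (\<lambda>k t. \<Sum>i\<in>S. c i * F i k t) (\<Sum>i\<in>S. \<bar>c i\<bar> * d i)"
proof -
  obtain b where b: "\<And>i k. i \<in> S \<Longrightarrow> k \<le> N \<Longrightarrow> hnorm_le (F i k) (b i k)" "\<And>i. i \<in> S \<Longrightarrow> (\<Sum>k\<le>N. b i k) \<le> d i"
    using assms(2) unfolding series_le_def by metis
  show ?thesis
  proof (rule series_leI[where b = "\<lambda>k. \<Sum>i\<in>S. \<bar>c i\<bar> * b i k"])
    show "hnorm_le (\<lambda>t. \<Sum>i\<in>S. c i * F i k t) (\<Sum>i\<in>S. \<bar>c i\<bar> * b i k)" if "k \<le> N" for k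
      using that by (intro hnorm_le_sum hnorm_le_cmult b) auto
    have "(\<Sum>k\<le>N. \<Sum>i\<in>S. \<bar>c i\<bar> * b i k) = (\<Sum>i\<in>S. \<bar>c i\<bar> * (\<Sum>k\<le>N. b i k))"
      by (subst sum.swap) (simp add: sum_distrib_left)
    also have "\<dots> \<le> (\<Sum>i\<in>S. \<bar>c i\<bar> * d i)" using b by (intro sum_mono mult_left_mono) auto
    finally show "(\<Sum>k\<le>N. \<Sum>i\<in>S. \<bar>c i\<bar> * b i k) \<le> (\<Sum>i\<in>S. \<bar>c i\<bar> * d i)" .
  qed
qed

lemma series_le_mono: "series_le N F c \<Longrightarrow> c \<le> d \<Longrightarrow> series_le N F d"
  unfolding series_le_def by (meson order_trans)

lemma series_le_partial_sum:
  assumes "series_le N F c" shows "hnorm_le (\<lambda>t. \<Sum>k\<le>N. F k t) c"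
proof -
  obtain b where b: "\<And>k. k \<le> N \<Longrightarrow> hnorm_le (F k) (b k)" "(\<Sum>k\<le>N. b k) \<le> c"
    using series_leE[OF assms] by metis
  then have "hnorm_le (\<lambda>t. \<Sum>k\<le>N. F k t) (\<Sum>k\<le>N. b k)" by (intro hnorm_le_sum) auto
  then show ?thesis using b(2) by (rule hnorm_le_mono)
qed

lemma series_le_sum_abs:
  assumes "series_le N F c" "0 \<le> t" "t \<le> T" shows "(\<Sum>k\<le>N. \<bar>F k t\<bar>) \<le> c"
proof -
  obtain b where b: "\<And>k. k \<le> N \<Longrightarrow> hnorm_le (F k) (b k)" "(\<Sum>k\<le>N. b k) \<le> c"
    using series_leE[OF assms(1)] by metis
  then have "(\<Sum>k\<le>N. \<bar>F k t\<bar>) \<le> (\<Sum>k\<le>N. b k)" using assms by (intro sum_mono hnorm_le_bound) auto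
  then show ?thesis using b(2) by linarith
qed

lemma series_le_summable:
  assumes "\<And>N. series_le N F c" "0 \<le> t" "t \<le> T" shows "summable (\<lambda>k. \<bar>F k t\<bar>)" "(\<Sum>k. \<bar>F k t\<bar>) \<le> c"
proof -
  have bound: "(\<Sum>k<N. \<bar>F k t\<bar>) \<le> c" for N
    using sum_mono2[of "{..N}" "{..<N}" "\<lambda>k. \<bar>F k t\<bar>"] series_le_sum_abs[OF assms(1)[of N] assms(2,3)] by force
  show "summable (\<lambda>k. \<bar>F k t\<bar>)" by (rule bounded_imp_summable[where B = c])
    (use series_le_sum_abs[OF assms(1) assms(2,3)] in auto)
  then show "(\<Sum>k. \<bar>F k t\<bar>) \<le> c" by (rule suminf_le_const) (rule bound)
qed

end

section \<open>Power series\<close>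

context taylor_data
begin

definition coord :: "'n \<Rightarrow> real ^ 'n \<Rightarrow> real" where
  "coord i x = x $ i - x0 $ i"

definition monomial :: "('n \<Rightarrow> nat) \<Rightarrow> real ^ 'n \<Rightarrow> real" where
  "monomial \<nu> x = (\<Prod>i\<in>UNIV. coord i x ^ \<nu> i)"

abbreviation deg :: "('n \<Rightarrow> nat) \<Rightarrow> nat" where
  "deg \<nu> \<equiv> sum \<nu> UNIV"

lemma C_infinity_coord: "C_infinity (coord i)"
  unfolding coord_def[abs_def]
  by (intro C_infinity_diff C_infinity_const C_infinity_bounded_linear bounded_linear_vec_nth)

lemma C_infinity_monomial: "C_infinity (monomial \<nu>)"
  unfolding monomial_def[abs_def] by (intro C_infinity_prod C_infinity_power C_infinity_coord)

lemma vf_apply_coord_centered: "vf_apply W (coord j) = (\<lambda>x. W x $ j)"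
proof -
  have "C_infinity (\<lambda>x::real ^ 'n. x $ j)" by (intro C_infinity_bounded_linear bounded_linear_vec_nth)
  from vf_apply_add[OF this C_infinity_const[of "- (x0 $ j)"], of W] show ?thesis
    by (simp add: coord_def[abs_def] vf_apply_coord vf_apply_const)
qed

lemma word_deriv_const: "I \<noteq> [] \<Longrightarrow> word_deriv I (\<lambda>_. a) = (\<lambda>_. 0)"
proof (induction I arbitrary: a rule: rev_induct)
  case (snoc i I)
  then show ?case by (cases "I = []") (auto simp: word_deriv_snoc vf_apply_const word_deriv_def)
qed simp

lemma expansion_term_const: "expansion_term (Suc k) (\<lambda>_. a) t = 0"
proof -
  have "word_deriv I (\<lambda>_. a) x0 = 0" if "length I = Suc k" for I :: "'m list"
    using that by (subst word_deriv_const) auto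
  then show ?thesis by (simp add: expansion_term_def)
qed

lemma expansion_term_coord: "expansion_term (Suc k) (coord j) t = expansion_term (Suc k) (\<lambda>x. x $ j) t"
proof -
  have "C_infinity (\<lambda>x::real ^ 'n. x $ j)" by (intro C_infinity_bounded_linear bounded_linear_vec_nth)
  from expansion_term_add[OF this C_infinity_const[of "- (x0 $ j)"], of "Suc k" t] show ?thesis
    by (simp add: coord_def[abs_def] expansion_term_const)
qed

lemma abs_monomial_le: "\<bar>monomial \<nu> x\<bar> \<le> norm (x - x0) ^ deg \<nu>"
proof -
  have "\<bar>monomial \<nu> x\<bar> = (\<Prod>i\<in>UNIV. \<bar>coord i x\<bar> ^ \<nu> i)"
    by (simp add: monomial_def abs_prod power_abs)
  also have "\<dots> \<le> (\<Prod>i\<in>UNIV. norm (x - x0) ^ \<nu> i)"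
    using component_le_norm_cart[of "x - x0"] by (intro prod_mono conjI power_mono) (auto simp: coord_def)
  also have "\<dots> = norm (x - x0) ^ deg \<nu>" by (simp add: power_sum)
  finally show ?thesis .
qed

lemma finite_deg_le: "finite {\<nu> :: 'n \<Rightarrow> nat. deg \<nu> \<le> k}"
proof (rule finite_subset)
  show "{\<nu> :: 'n \<Rightarrow> nat. deg \<nu> \<le> k} \<subseteq> PiE UNIV (\<lambda>_. {..k})"
  proof
    fix \<nu> :: "'n \<Rightarrow> nat" assume "\<nu> \<in> {\<nu>. deg \<nu> \<le> k}"
    then have "\<nu> i \<le> k" for i using member_le_sum[of i UNIV \<nu>] by simp
    then show "\<nu> \<in> PiE UNIV (\<lambda>_. {..k})" by auto
  qed
qed (intro finite_PiE, auto)

lemma expansion_term_monomial_high: "k < deg \<nu> \<Longrightarrow> expansion_term k (monomial \<nu>) t = 0"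
proof (rule expansion_term_flat[OF C_infinity_monomial])
  show "flat_at x0 (deg \<nu>) (monomial \<nu>)"
    by (rule flat_at_order_bound[OF C_infinity_monomial zero_less_one, where B = 1])
       (simp add: abs_monomial_le)
qed

text \<open>At the point all of whose centred coordinates equal \<rho> the monomials become
  \<open>\<rho> ^ deg \<nu>\<close>, and unordered summability of reals is absolute. The factor
  \<open>CARD('n)\<close> keeps this point inside the ball, its norm being estimated by the sum of
  its coordinates.\<close>

lemma power_series_abs_summable:
  fixes h :: "real ^ 'n \<Rightarrow> real"
  assumes hs: "\<And>x. x \<in> ball x0 r \<Longrightarrow> ((\<lambda>\<nu>. monomial \<nu> x * c \<nu>) has_sum h x) UNIV"
    and \<rho>: "0 < \<rho>" "real CARD('n) * \<rho> < r"
  shows "(\<lambda>\<nu>. \<bar>c \<nu>\<bar> * \<rho> ^ deg \<nu>) summable_on UNIV"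
proof -
  define x where "x = x0 + (\<chi> i. \<rho>)"
  have "norm (x - x0) \<le> (\<Sum>i\<in>(UNIV::'n set). \<rho>)"
    using norm_le_l1_cart[of "x - x0"] \<rho> by (simp add: x_def)
  then have "x \<in> ball x0 r" using \<rho> by (simp add: dist_norm norm_minus_commute)
  from hs[OF this] have "(\<lambda>\<nu>. monomial \<nu> x * c \<nu>) summable_on UNIV" by (rule has_sum_imp_summable)
  then have "(\<lambda>\<nu>. norm (monomial \<nu> x * c \<nu>)) summable_on UNIV"
    by (rule iffD1[OF summable_on_iff_abs_summable_on_real])
  moreover have "monomial \<nu> x = \<rho> ^ deg \<nu>" for \<nu>
    by (simp add: monomial_def coord_def x_def power_sum)
  ultimately show ?thesis using \<rho> by (simp add: abs_mult mult.commute)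
qed

text \<open>The error of the Taylor polynomial \<open>P\<close> is bounded by a multiple of
  \<open>norm (x - x0) ^ Suc N\<close>; by \<open>flat_at_order_bound\<close> it is flat and hence
  invisible in degrees up to N. The jet is read off from this size estimate in place of termwise
  differentiation.\<close>

lemma expansion_term_power_series:
  fixes h :: "real ^ 'n \<Rightarrow> real"
  assumes h: "C_infinity h"
    and hs: "\<And>x. x \<in> ball x0 r \<Longrightarrow> ((\<lambda>\<nu>. monomial \<nu> x * c \<nu>) has_sum h x) UNIV"
    and \<rho>: "0 < \<rho>" "real CARD('n) * \<rho> < r" and k: "k \<le> N"
  shows "expansion_term k h t = (\<Sum>\<nu> | deg \<nu> \<le> N. c \<nu> * expansion_term k (monomial \<nu>) t)"
proof -
  define P where "P x = (\<Sum>\<nu> | deg \<nu> \<le> N. c \<nu> * monomial \<nu> x)" for x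
  define A where "A = (\<Sum>\<^sub>\<infinity>\<nu>. \<bar>c \<nu>\<bar> * \<rho> ^ deg \<nu>)"
  have A: "((\<lambda>\<nu>. \<bar>c \<nu>\<bar> * \<rho> ^ deg \<nu>) has_sum A) UNIV"
    unfolding A_def using power_series_abs_summable[OF hs \<rho>] by (rule has_sum_infsum)
  have C_P: "C_infinity P"
    unfolding P_def by (intro C_infinity_sum C_infinity_mult C_infinity_const C_infinity_monomial)
  have \<rho>r: "\<rho> < r"
  proof -
    have "1 * \<rho> \<le> real CARD('n) * \<rho>" using \<rho>(1) by (intro mult_right_mono) (auto simp: Suc_le_eq)
    then show ?thesis using \<rho>(2) by linarith
  qed
  have "flat_at x0 (Suc N) (\<lambda>x. h x - P x)"
  proof (rule flat_at_order_bound[OF C_infinity_diff[OF h C_P] \<rho>(1)])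
    fix x assume x: "norm (x - x0) \<le> \<rho>"
    then have "x \<in> ball x0 r" using \<rho>r by (simp add: dist_norm norm_minus_commute)
    from hs[OF this] have "((\<lambda>\<nu>. monomial \<nu> x * c \<nu>) has_sum h x) UNIV" .
    moreover have "((\<lambda>\<nu>. monomial \<nu> x * c \<nu>) has_sum P x) {\<nu>. deg \<nu> \<le> N}"
      unfolding P_def using has_sum_finite[OF finite_deg_le] by (simp add: mult.commute)
    ultimately have "((\<lambda>\<nu>. monomial \<nu> x * c \<nu>) has_sum (h x - P x)) (UNIV - {\<nu>. deg \<nu> \<le> N})"
      by (rule has_sum_Diff) auto
    then have tail: "((\<lambda>\<nu>. monomial \<nu> x * c \<nu>) has_sum (h x - P x)) {\<nu>. N < deg \<nu>}"
      by (simp add: Compl_eq_Diff_UNIV[symmetric] Collect_neg_eq[symmetric] not_le)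
    define z where "z = norm (x - x0)"
    have z: "0 \<le> z" "z \<le> \<rho>" using x by (auto simp: z_def)
    \<comment> \<open>In degrees above N the ratio z / \<rho> \<le> 1 occurs at least N + 1 times;
      extracting these powers gives the order of vanishing and leaves a summable majorant.\<close>
    have term_le: "\<bar>monomial \<nu> x * c \<nu>\<bar> \<le> (z / \<rho>) ^ Suc N * (\<bar>c \<nu>\<bar> * \<rho> ^ deg \<nu>)" if "N < deg \<nu>" for \<nu>
    proof -
      have "\<bar>monomial \<nu> x\<bar> \<le> z ^ deg \<nu>" unfolding z_def by (rule abs_monomial_le)
      also have "\<dots> = (z / \<rho>) ^ deg \<nu> * \<rho> ^ deg \<nu>" using \<rho> by (simp add: power_divide)
      also have "\<dots> \<le> (z / \<rho>) ^ Suc N * \<rho> ^ deg \<nu>"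
        using z \<rho> that by (intro mult_right_mono power_decreasing) auto
      finally have "\<bar>monomial \<nu> x\<bar> * \<bar>c \<nu>\<bar> \<le> (z / \<rho>) ^ Suc N * \<rho> ^ deg \<nu> * \<bar>c \<nu>\<bar>"
        by (rule mult_right_mono) simp
      then show ?thesis by (simp add: abs_mult mult_ac)
    qed
    have abs_sum: "(\<lambda>\<nu>. norm (monomial \<nu> x * c \<nu>)) summable_on {\<nu>. N < deg \<nu>}"
      using has_sum_imp_summable[OF tail] by (rule iffD1[OF summable_on_iff_abs_summable_on_real])
    have "norm (h x - P x) \<le> (\<Sum>\<^sub>\<infinity>\<nu>\<in>{\<nu>. N < deg \<nu>}. norm (monomial \<nu> x * c \<nu>))"
      by (rule norm_has_sum_bound[OF has_sum_infsum[OF abs_sum] tail])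
    also have "\<dots> \<le> (z / \<rho>) ^ Suc N * A"
    proof (rule has_sum_mono_neutral[OF has_sum_infsum[OF abs_sum] has_sum_cmult_right[OF A]])
      show "norm (monomial \<nu> x * c \<nu>) \<le> (z / \<rho>) ^ Suc N * (\<bar>c \<nu>\<bar> * \<rho> ^ deg \<nu>)"
        if "\<nu> \<in> {\<nu>. N < deg \<nu>} \<inter> UNIV" for \<nu>
        using term_le[of \<nu>] that by simp
      show "0 \<le> (z / \<rho>) ^ Suc N * (\<bar>c \<nu>\<bar> * \<rho> ^ deg \<nu>)" for \<nu>
        using z \<rho> by simp
    qed simp
    finally show "\<bar>h x - P x\<bar> \<le> (A / \<rho> ^ Suc N) * norm (x - x0) ^ Suc N"
      by (simp add: z_def power_divide mult.commute)
  qed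
  then have "expansion_term k (\<lambda>x. h x - P x) t = 0"
    using k by (intro expansion_term_flat[OF C_infinity_diff[OF h C_P]]) auto
  then have "expansion_term k h t = expansion_term k P t"
    using expansion_term_add[OF C_infinity_diff[OF h C_P] C_P, of k t] by simp
  also have "\<dots> = (\<Sum>\<nu> | deg \<nu> \<le> N. c \<nu> * expansion_term k (monomial \<nu>) t)"
    unfolding P_def by (rule expansion_term_sum[OF finite_deg_le C_infinity_monomial])
  finally show ?thesis .
qed

end

section \<open>Integration on a short interval\<close>

locale taylor_interval = taylor_data V y x0 \<beta> K + short_interval T \<alpha>
  for V :: "'m::finite \<Rightarrow> real ^ 'n \<Rightarrow> real ^ 'n" and y x0 \<beta> K T \<alpha> +
  assumes \<alpha>\<beta>: "\<alpha> < \<beta>" "1 < \<alpha> + \<beta>"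
begin

text \<open>As in \<open>young_remainder_bound\<close>, the constant depends on the integrands only
  through their norm bounds, so the estimate persists in the limit of the partial sums in
  \<open>taylor_sum_expansion\<close>.\<close>

lemma integral_remainder_bound:
  assumes f: "\<And>i. hnorm_le (f i) (b i)"
    and F: "negligible_on T (\<lambda>s t. F t - F s - (\<Sum>i\<in>UNIV. f i s * (y t $ i - y s $ i)))"
    and st: "0 \<le> s" "s \<le> t" "t \<le> T"
  shows "\<bar>F t - F s - (\<Sum>i\<in>UNIV. f i s * (y t $ i - y s $ i))\<bar>
    \<le> sewing_const (\<alpha> + \<beta>) * (K * (\<Sum>i\<in>UNIV. b i)) * (t - s) powr (\<alpha> + \<beta>)"
proof -
  define R where "R s t = F t - F s - (\<Sum>i\<in>UNIV. f i s * (y t $ i - y s $ i))" for s t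
  obtain \<theta>' B where *: "\<theta>' > 1" "\<And>s t. \<lbrakk>0 \<le> s; s \<le> t; t \<le> T\<rbrakk> \<Longrightarrow> norm (R s t) \<le> B * (t - s) powr \<theta>'"
    using F unfolding negligible_on_def R_def by blast
  have b: "b i \<ge> 0" for i using hnorm_le_nonneg[OF f] .
  have "norm (R s t) \<le> sewing_const (\<alpha> + \<beta>) * (K * (\<Sum>i\<in>UNIV. b i)) * (t - s) powr (\<alpha> + \<beta>)"
  proof (rule sewing_bound[OF \<alpha>\<beta>(2) *(1) _ *(2) _ st])
    show "0 \<le> K * (\<Sum>i\<in>UNIV. b i)" using K b by (intro mult_nonneg_nonneg sum_nonneg)
    fix s m t assume smt: "0 \<le> s" "s \<le> m" "m \<le> t" "t \<le> T"
    have "R s t - R s m - R m t = (\<Sum>i\<in>UNIV. (f i m - f i s) * (y t $ i - y m $ i))"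
      by (simp add: R_def algebra_simps sum_subtractf sum.distrib)
    also have "norm \<dots> \<le> (\<Sum>i\<in>UNIV. b i * (t - s) powr \<alpha> * (K * (t - s) powr \<beta>))"
    proof (rule sum_norm_le)
      fix i
      have "\<bar>f i m - f i s\<bar> \<le> b i * (m - s) powr \<alpha>" using smt by (intro hnorm_leD[OF f]) auto
      also have "\<dots> \<le> b i * (t - s) powr \<alpha>" using smt b \<alpha> by (intro mult_left_mono powr_mono2) auto
      finally have 1: "\<bar>f i m - f i s\<bar> \<le> b i * (t - s) powr \<alpha>" .
      have "\<bar>y t $ i - y m $ i\<bar> \<le> K * \<bar>t - m\<bar> powr \<beta>" using smt T by (intro y_holder) auto
      also have "\<dots> \<le> K * (t - s) powr \<beta>" using smt K \<beta> by (intro mult_left_mono powr_mono2) auto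
      finally have 2: "\<bar>y t $ i - y m $ i\<bar> \<le> K * (t - s) powr \<beta>" .
      show "norm ((f i m - f i s) * (y t $ i - y m $ i)) \<le> b i * (t - s) powr \<alpha> * (K * (t - s) powr \<beta>)"
        unfolding real_norm_def abs_mult using b by (intro mult_mono 1 2) auto
    qed
    also have "\<dots> = K * (\<Sum>i\<in>UNIV. b i) * (t - s) powr (\<alpha> + \<beta>)"
      by (simp add: powr_add sum_distrib_left sum_distrib_right mult_ac)
    finally show "norm (R s t - R s m - R m t) \<le> K * (\<Sum>i\<in>UNIV. b i) * (t - s) powr (\<alpha> + \<beta>)" .
  qed
  then show ?thesis by (simp add: R_def)
qed

text \<open>Bounds the norm of integration against \<open>y\<close>: the summand 1 accounts for the
  main term, \<open>sewing_const\<close> for the remainder, and the power of T for the return from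
  exponent \<beta> to \<alpha>.\<close>

definition integral_gain :: real where
  "integral_gain = K * (1 + sewing_const (\<alpha> + \<beta>)) * T powr (\<beta> - \<alpha>)"

lemma integral_gain_nonneg: "integral_gain \<ge> 0"
  unfolding integral_gain_def using K sewing_const_pos[OF \<alpha>\<beta>(2)] by simp

lemma integral_hnorm_le:
  assumes f: "\<And>i. hnorm_le (f i) (b i)"
    and F: "negligible_on T (\<lambda>s t. F t - F s - (\<Sum>i\<in>UNIV. f i s * (y t $ i - y s $ i)))"
    and F0: "F 0 = 0"
  shows "hnorm_le F (integral_gain * (\<Sum>i\<in>UNIV. b i))"
  unfolding hnorm_le_def
proof (intro conjI allI impI)
  have b: "b i \<ge> 0" for i using hnorm_le_nonneg[OF f] .
  then have b_sum: "(\<Sum>i\<in>UNIV. b i) \<ge> 0" by (intro sum_nonneg)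
  then show "\<bar>F 0\<bar> \<le> integral_gain * (\<Sum>i\<in>UNIV. b i)" using integral_gain_nonneg by (simp add: F0)
  fix s t assume st: "0 \<le> s" "s \<le> t" "t \<le> T"
  define C where "C = sewing_const (\<alpha> + \<beta>)"
  have C: "C \<ge> 0" using sewing_const_pos[OF \<alpha>\<beta>(2)] by (simp add: C_def)
  have "\<bar>\<Sum>i\<in>UNIV. f i s * (y t $ i - y s $ i)\<bar> \<le> (\<Sum>i\<in>UNIV. b i * (K * (t - s) powr \<beta>))"
  proof (rule order_trans[OF sum_abs sum_mono])
    fix i
    have "\<bar>f i s\<bar> \<le> b i" using st by (intro hnorm_le_bound[OF f]) auto
    moreover have "\<bar>y t $ i - y s $ i\<bar> \<le> K * (t - s) powr \<beta>" using y_holder[of t s i] st T by auto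
    ultimately show "\<bar>f i s * (y t $ i - y s $ i)\<bar> \<le> b i * (K * (t - s) powr \<beta>)"
      unfolding abs_mult using b by (intro mult_mono) auto
  qed
  moreover have "\<bar>F t - F s - (\<Sum>i\<in>UNIV. f i s * (y t $ i - y s $ i))\<bar>
      \<le> C * (K * (\<Sum>i\<in>UNIV. b i)) * (t - s) powr \<beta>"
  proof -
    have "(t - s) powr (\<alpha> + \<beta>) \<le> 1 * (t - s) powr \<beta>"
      unfolding powr_add using powr_short[of "t - s"] st by (intro mult_right_mono) auto
    then have "C * (K * (\<Sum>i\<in>UNIV. b i)) * (t - s) powr (\<alpha> + \<beta>) \<le> C * (K * (\<Sum>i\<in>UNIV. b i)) * (t - s) powr \<beta>"
      using C K b_sum by (intro mult_left_mono) auto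
    then show ?thesis using integral_remainder_bound[OF f F st] by (simp add: C_def)
  qed
  ultimately have "\<bar>F t - F s\<bar> \<le> (\<Sum>i\<in>UNIV. b i * (K * (t - s) powr \<beta>)) + C * (K * (\<Sum>i\<in>UNIV. b i)) * (t - s) powr \<beta>"
    by linarith
  also have "\<dots> = (K * (1 + C) * (\<Sum>i\<in>UNIV. b i)) * (t - s) powr \<beta>"
    unfolding sum_distrib_right[symmetric] by (simp add: algebra_simps)
  also have "\<dots> \<le> (K * (1 + C) * (\<Sum>i\<in>UNIV. b i)) * (T powr (\<beta> - \<alpha>) * (t - s) powr \<alpha>)"
    using st \<alpha>\<beta> K C b_sum by (intro mult_left_mono powr_le_rescale) auto
  finally show "\<bar>F t - F s\<bar> \<le> (integral_gain * (\<Sum>i\<in>UNIV. b i) - \<bar>F 0\<bar>) * (t - s) powr \<alpha>"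
    by (simp add: F0 integral_gain_def C_def mult_ac)
qed

lemma expansion_term_coord_expansion:
  "negligible_on T (\<lambda>s t. expansion_term (Suc k) (coord j) t - expansion_term (Suc k) (coord j) s
     - (\<Sum>i\<in>UNIV. expansion_term k (\<lambda>x. V i x $ j) s * (y t $ i - y s $ i)))"
  using negligible_on_mono[OF expansion_term_expansion[of "Suc k" "coord j"] T(2)]
  by (simp add: expansion_incr_def vf_apply_coord_centered)

text \<open>Degree k + 1 of a coordinate is an integral of degree k of the fields, so control of the
  fields up to N reaches the coordinates up to N + 1. The vanishing degree 0 term adds nothing, and
  the whole bound carries the factor \<open>integral_gain\<close>.\<close>

lemma series_le_coord_Suc:
  assumes "\<And>i. series_le N (\<lambda>k. expansion_term k (\<lambda>x. V i x $ j)) M"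
  shows "series_le (Suc N) (\<lambda>k. expansion_term k (coord j)) (integral_gain * (real CARD('m) * M))"
proof -
  have "\<forall>i. \<exists>b. (\<forall>k\<le>N. hnorm_le (expansion_term k (\<lambda>x. V i x $ j)) (b k)) \<and> (\<Sum>k\<le>N. b k) \<le> M"
    using assms unfolding series_le_def by blast
  then obtain b where b: "\<And>i k. k \<le> N \<Longrightarrow> hnorm_le (expansion_term k (\<lambda>x. V i x $ j)) (b i k)"
      "\<And>i. (\<Sum>k\<le>N. b i k) \<le> M" by metis
  define b' where "b' k = (case k of 0 \<Rightarrow> 0 | Suc k \<Rightarrow> integral_gain * (\<Sum>i\<in>UNIV. b i k))" for k
  show ?thesis
  proof (rule series_leI[where b = b'])
    fix k assume k: "k \<le> Suc N"
    show "hnorm_le (expansion_term k (coord j)) (b' k)"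
    proof (cases k)
      case 0
      then show ?thesis
        using hnorm_le_const[of 0] by (simp add: b'_def expansion_term_degree_0[abs_def] coord_def)
    next
      case (Suc l)
      then show ?thesis
        unfolding b'_def using k
        by (auto intro!: integral_hnorm_le b expansion_term_coord_expansion expansion_term_Suc_at_0)
    qed
  next
    have "(\<Sum>k\<le>Suc N. b' k) = integral_gain * (\<Sum>i\<in>UNIV. \<Sum>k\<le>N. b i k)"
      by (subst sum.atMost_Suc_shift, subst sum.swap) (simp add: b'_def sum_distrib_left)
    also have "\<dots> \<le> integral_gain * (\<Sum>i\<in>(UNIV::'m set). M)"
      using b(2) integral_gain_nonneg by (intro mult_left_mono sum_mono)
    finally show "(\<Sum>k\<le>Suc N. b' k) \<le> integral_gain * (real CARD('m) * M)" by simp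
  qed
qed

lemma series_le_one: "series_le N (\<lambda>k. expansion_term k (\<lambda>_. 1)) 1"
proof (rule series_leI[where b = "\<lambda>k. if k = 0 then 1 else 0"])
  show "hnorm_le (expansion_term k (\<lambda>_. 1)) (if k = 0 then 1 else 0)" for k
    using hnorm_le_const[of 1] hnorm_le_const[of 0]
    by (cases k) (simp_all add: expansion_term_degree_0[abs_def] expansion_term_const[abs_def])
qed simp

lemma series_le_expansion_mult:
  assumes "C_infinity f" "C_infinity g"
    and "series_le N (\<lambda>k. expansion_term k f) c" "series_le N (\<lambda>k. expansion_term k g) d"
  shows "series_le N (\<lambda>k. expansion_term k (\<lambda>x. f x * g x)) (c * d)"
proof -
  have "expansion_term k (\<lambda>x. f x * g x) t = (\<Sum>a\<le>k. expansion_term a f t * expansion_term (k - a) g t)"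
    if "0 \<le> t" "t \<le> T" for k t
    using expansion_term_mult[OF assms(1,2), of t k] that T by simp
  then show ?thesis using series_le_mult[OF assms(3,4)] by (subst series_le_cong)
qed

lemma series_le_expansion_power:
  assumes "C_infinity f" "series_le N (\<lambda>k. expansion_term k f) c"
  shows "series_le N (\<lambda>k. expansion_term k (\<lambda>x. f x ^ n)) (c ^ n)"
  by (induction n) (auto intro!: series_le_one series_le_expansion_mult C_infinity_power assms)

lemma series_le_monomial:
  assumes "\<And>j. series_le N (\<lambda>k. expansion_term k (coord j)) \<rho>"
  shows "series_le N (\<lambda>k. expansion_term k (monomial \<nu>)) (\<rho> ^ deg \<nu>)"
proof -
  have "series_le N (\<lambda>k. expansion_term k (\<lambda>x. \<Prod>i\<in>J. coord i x ^ \<nu> i)) (\<Prod>i\<in>J. \<rho> ^ \<nu> i)" if "finite J" for J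
    using that
  proof (induction J rule: finite_induct)
    case empty
    then show ?case by (simp add: series_le_one)
  next
    case (insert i J)
    then show ?case
      by (auto intro!: series_le_expansion_mult series_le_expansion_power assms C_infinity_power
          C_infinity_prod C_infinity_coord)
  qed
  from this[of UNIV] show ?thesis by (simp add: monomial_def[abs_def] power_sum)
qed

end

section \<open>The sum of the Taylor series\<close>

locale analytic_taylor = taylor_data V y x0 \<beta> K
  for V :: "'m::finite \<Rightarrow> real ^ 'n \<Rightarrow> real ^ 'n" and y x0 \<beta> K +
  fixes c :: "'m \<Rightarrow> ('n \<Rightarrow> nat) \<Rightarrow> real ^ 'n" and r \<rho> :: real
  assumes power_series: "x \<in> ball x0 r \<Longrightarrow> ((\<lambda>\<nu>. monomial \<nu> x *\<^sub>R c i \<nu>) has_sum V i x) UNIV"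
    and \<rho>: "0 < \<rho>" "real CARD('n) * \<rho> < r"
begin

lemma power_series_component:
  "x \<in> ball x0 r \<Longrightarrow> ((\<lambda>\<nu>. monomial \<nu> x * c i \<nu> $ j) has_sum V i x $ j) UNIV"
  using has_sum_bounded_linear[OF bounded_linear_vec_nth[of j] power_series[of x i]] by simp

text \<open>Summation over i and j yields one number that dominates the majorant series of every
  component of every field.\<close>

definition majorant :: real where
  "majorant = (\<Sum>i\<in>UNIV. \<Sum>j\<in>UNIV. \<Sum>\<^sub>\<infinity>\<nu>. \<bar>c i \<nu> $ j\<bar> * \<rho> ^ deg \<nu>)"

lemma majorant_ge: "(\<Sum>\<^sub>\<infinity>\<nu>. \<bar>c i \<nu> $ j\<bar> * \<rho> ^ deg \<nu>) \<le> majorant"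
proof -
  have nn: "0 \<le> (\<Sum>\<^sub>\<infinity>\<nu>. \<bar>c i \<nu> $ j\<bar> * \<rho> ^ deg \<nu>)" for i j using \<rho> by (intro infsum_nonneg) auto
  have "(\<Sum>\<^sub>\<infinity>\<nu>. \<bar>c i \<nu> $ j\<bar> * \<rho> ^ deg \<nu>) \<le> (\<Sum>j\<in>UNIV. \<Sum>\<^sub>\<infinity>\<nu>. \<bar>c i \<nu> $ j\<bar> * \<rho> ^ deg \<nu>)"
    by (rule member_le_sum) (use nn in auto)
  also have "\<dots> \<le> majorant" unfolding majorant_def
    by (rule member_le_sum[of i UNIV "\<lambda>i. \<Sum>j\<in>UNIV. \<Sum>\<^sub>\<infinity>\<nu>. \<bar>c i \<nu> $ j\<bar> * \<rho> ^ deg \<nu>"])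
       (use nn in \<open>auto intro: sum_nonneg\<close>)
  finally show ?thesis .
qed

end

locale analytic_taylor_interval =
  analytic_taylor V y x0 \<beta> K c r \<rho> + taylor_interval V y x0 \<beta> K T \<alpha>
  for V :: "'m::finite \<Rightarrow> real ^ 'n \<Rightarrow> real ^ 'n" and y x0 \<beta> K c r \<rho> T \<alpha> +
  assumes small: "integral_gain * (real CARD('m) * majorant) \<le> \<rho>"
begin

text \<open>By multiplicativity each coordinate may be replaced by its bound \<rho> in the power
  series. For degrees up to N only finitely many monomials contribute, and their sum stays below
  \<open>majorant\<close> independently of N.\<close>

lemma series_le_vector_field:
  assumes "\<And>j. series_le N (\<lambda>k. expansion_term k (coord j)) \<rho>"
  shows "series_le N (\<lambda>k. expansion_term k (\<lambda>x. V i x $ j)) majorant"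
proof -
  let ?S = "{\<nu> :: 'n \<Rightarrow> nat. deg \<nu> \<le> N}"
  have V: "C_infinity (\<lambda>x. V i x $ j)" using smooth by (rule C_infinity_vec_nth)
  have "series_le N (\<lambda>k t. \<Sum>\<nu>\<in>?S. c i \<nu> $ j * expansion_term k (monomial \<nu>) t) (\<Sum>\<nu>\<in>?S. \<bar>c i \<nu> $ j\<bar> * \<rho> ^ deg \<nu>)"
    by (rule series_le_linear_combination[OF finite_deg_le series_le_monomial[OF assms]])
  moreover have "(\<Sum>\<nu>\<in>?S. \<bar>c i \<nu> $ j\<bar> * \<rho> ^ deg \<nu>) \<le> (\<Sum>\<^sub>\<infinity>\<nu>. \<bar>c i \<nu> $ j\<bar> * \<rho> ^ deg \<nu>)"
    using \<rho> by (intro finite_sum_le_infsum finite_deg_le power_series_abs_summable[OF power_series_component]) auto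
  ultimately have "series_le N (\<lambda>k t. \<Sum>\<nu>\<in>?S. c i \<nu> $ j * expansion_term k (monomial \<nu>) t) majorant"
    using majorant_ge[of i j] by (auto intro: series_le_mono)
  moreover have "expansion_term k (\<lambda>x. V i x $ j) t = (\<Sum>\<nu>\<in>?S. c i \<nu> $ j * expansion_term k (monomial \<nu>) t)"
    if "k \<le> N" for k t
    by (rule expansion_term_power_series[OF V power_series_component \<rho> that])
  ultimately show ?thesis by (subst series_le_cong)
qed

lemma series_le_coord: "series_le N (\<lambda>k. expansion_term k (coord j)) \<rho>"
proof (induction N arbitrary: j)
  case 0
  show ?case
    using hnorm_le_const[of 0] \<rho>
    by (intro series_leI[where b = "\<lambda>_. 0"]) (simp_all add: expansion_term_degree_0[abs_def] coord_def)
next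
  case (Suc N)
  from series_le_coord_Suc[OF series_le_vector_field[OF Suc]] small show ?case by (rule series_le_mono)
qed

definition taylor_sum :: "real \<Rightarrow> real ^ 'n" where
  "taylor_sum t = (\<chi> j. x0 $ j + (\<Sum>k. expansion_term k (coord j) t))"

text \<open>Bundled so that the property is multiplicative and passes from the coordinates to all
  monomials; the uniform norm bound supplies the absolute convergence behind Cauchy
  products.\<close>

definition converges :: "(real ^ 'n \<Rightarrow> real) \<Rightarrow> real \<Rightarrow> bool" where
  "converges f b \<longleftrightarrow> C_infinity f \<and> (\<forall>N. series_le N (\<lambda>k. expansion_term k f) b) \<and>
     (\<forall>t. 0 \<le> t \<longrightarrow> t \<le> T \<longrightarrow> (\<lambda>k. expansion_term k f t) sums f (taylor_sum t))"

lemma converges_coord: "converges (coord j) \<rho>"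
  unfolding converges_def
proof (intro conjI allI impI)
  fix t assume t: "0 \<le> t" "t \<le> T"
  have "summable (\<lambda>k. expansion_term k (coord j) t)"
    by (rule summable_rabs_cancel) (rule series_le_summable[OF series_le_coord t])
  then show "(\<lambda>k. expansion_term k (coord j) t) sums coord j (taylor_sum t)"
    by (simp add: coord_def taylor_sum_def summable_sums)
qed (auto intro: C_infinity_coord series_le_coord)

lemma converges_one: "converges (\<lambda>_. 1) 1"
  unfolding converges_def
proof (intro conjI allI impI)
  fix t
  have "expansion_term k (\<lambda>_. 1) t = (if k = 0 then 1 else 0)" for k
    by (cases k) (simp_all add: expansion_term_degree_0 expansion_term_const)
  then show "(\<lambda>k. expansion_term k (\<lambda>_. 1) t) sums 1" using sums_single[of 0 "\<lambda>_. 1::real"] by simp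
qed (auto intro: C_infinity_const series_le_one)

lemma converges_mult:
  assumes "converges f b" "converges g d" shows "converges (\<lambda>x. f x * g x) (b * d)"
  unfolding converges_def
proof (intro conjI allI impI)
  have f: "C_infinity f" "\<And>N. series_le N (\<lambda>k. expansion_term k f) b"
    and g: "C_infinity g" "\<And>N. series_le N (\<lambda>k. expansion_term k g) d"
    using assms by (auto simp: converges_def)
  show "C_infinity (\<lambda>x. f x * g x)" using f g by (intro C_infinity_mult)
  show "series_le N (\<lambda>k. expansion_term k (\<lambda>x. f x * g x)) (b * d)" for N
    using f g by (intro series_le_expansion_mult)
  fix t assume t: "0 \<le> t" "t \<le> T"
  have "(\<Sum>k. expansion_term k f t) = f (taylor_sum t)" "(\<Sum>k. expansion_term k g t) = g (taylor_sum t)"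
    using assms t by (auto simp: converges_def sums_iff)
  then have "(\<lambda>k. \<Sum>a\<le>k. expansion_term a f t * expansion_term (k - a) g t) sums (f (taylor_sum t) * g (taylor_sum t))"
    using Cauchy_product_sums[of "\<lambda>k. expansion_term k f t" "\<lambda>k. expansion_term k g t"]
      series_le_summable(1)[OF f(2) t] series_le_summable(1)[OF g(2) t] by simp
  then show "(\<lambda>k. expansion_term k (\<lambda>x. f x * g x) t) sums (f (taylor_sum t) * g (taylor_sum t))"
    using expansion_term_mult[OF f(1) g(1), of t] t T by simp
qed

lemma converges_power: "converges f b \<Longrightarrow> converges (\<lambda>x. f x ^ n) (b ^ n)"
  by (induction n) (auto intro: converges_one converges_mult)

lemma converges_monomial: "converges (monomial \<nu>) (\<rho> ^ deg \<nu>)"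
proof -
  have "converges (\<lambda>x. \<Prod>i\<in>J. coord i x ^ \<nu> i) (\<Prod>i\<in>J. \<rho> ^ \<nu> i)" if "finite J" for J
    using that
  proof (induction J rule: finite_induct)
    case (insert i J)
    then show ?case using converges_mult[OF converges_power[OF converges_coord] insert.IH] by simp
  qed (simp add: converges_one)
  from this[of UNIV] show ?thesis by (simp add: monomial_def[abs_def] power_sum)
qed

lemma taylor_sum_in_ball:
  assumes t: "0 \<le> t" "t \<le> T" shows "taylor_sum t \<in> ball x0 r"
proof -
  have "\<bar>coord j (taylor_sum t)\<bar> \<le> \<rho>" for j
  proof -
    have sums: "(\<lambda>k. expansion_term k (coord j) t) sums coord j (taylor_sum t)"
      using converges_coord t by (simp add: converges_def)
    have "\<bar>\<Sum>k. expansion_term k (coord j) t\<bar> \<le> (\<Sum>k. \<bar>expansion_term k (coord j) t\<bar>)"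
      by (rule summable_rabs[OF series_le_summable(1)[OF series_le_coord t]])
    also have "\<dots> \<le> \<rho>" by (rule series_le_summable(2)[OF series_le_coord t])
    finally show ?thesis using sums by (simp add: sums_iff)
  qed
  then have "norm (taylor_sum t - x0) \<le> (\<Sum>j\<in>(UNIV::'n set). \<rho>)"
    by (intro norm_le_l1_cart[THEN order_trans] sum_mono) (simp add: coord_def)
  then show ?thesis using \<rho>(2) by (simp add: dist_norm norm_minus_commute)
qed

text \<open>The double series over multi-indices \<nu> and degrees k converges absolutely, since for
  fixed \<nu> the degrees contribute at most
  \<open>\<bar>c i \<nu> $ j\<bar> * \<rho> ^ deg \<nu>\<close>. Summed over k first it is the power
  series of the field at \<open>taylor_sum t\<close>; summed over \<nu> first it gives the term of
  degree k, a finite sum because monomials of degree above k drop out.\<close>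

lemma converges_vector_field: "converges (\<lambda>x. V i x $ j) majorant"
  unfolding converges_def
proof (intro conjI allI impI)
  show V: "C_infinity (\<lambda>x. V i x $ j)" using smooth by (rule C_infinity_vec_nth)
  show V_series: "series_le N (\<lambda>k. expansion_term k (\<lambda>x. V i x $ j)) majorant" for N
    by (rule series_le_vector_field[OF series_le_coord])
  fix t assume t: "0 \<le> t" "t \<le> T"
  define g where "g \<nu> k = c i \<nu> $ j * expansion_term k (monomial \<nu>) t" for \<nu> k
  have mono: "\<And>N. series_le N (\<lambda>k. expansion_term k (monomial \<nu>)) (\<rho> ^ deg \<nu>)"
      "(\<lambda>k. expansion_term k (monomial \<nu>) t) sums monomial \<nu> (taylor_sum t)" for \<nu>
    using converges_monomial[of \<nu>] t by (auto simp: converges_def)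
  have g_summable: "summable (\<lambda>k. norm (g \<nu> k))" for \<nu>
    unfolding g_def real_norm_def abs_mult
    by (intro summable_mult series_le_summable(1)[OF mono(1) t])
  have g_has_sum: "(g \<nu> has_sum (c i \<nu> $ j * monomial \<nu> (taylor_sum t))) UNIV" for \<nu>
    using g_summable by (rule norm_summable_imp_has_sum) (unfold g_def, intro sums_mult mono(2))
  have norm_g_summable: "(\<lambda>k. norm (g \<nu> k)) summable_on UNIV" for \<nu>
    using g_summable[of \<nu>] by (intro norm_summable_imp_summable_on) simp
  have g_total: "(\<Sum>\<^sub>\<infinity>k. norm (g \<nu> k)) \<le> \<bar>c i \<nu> $ j\<bar> * \<rho> ^ deg \<nu>" for \<nu>
  proof -
    have "(\<lambda>k. norm (g \<nu> k)) sums (\<bar>c i \<nu> $ j\<bar> * (\<Sum>k. \<bar>expansion_term k (monomial \<nu>) t\<bar>))"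
      unfolding g_def real_norm_def abs_mult
      by (intro sums_mult summable_sums series_le_summable(1)[OF mono(1) t])
    then have "(\<Sum>\<^sub>\<infinity>k. norm (g \<nu> k)) = \<bar>c i \<nu> $ j\<bar> * (\<Sum>k. \<bar>expansion_term k (monomial \<nu>) t\<bar>)"
      by (intro infsumI sums_nonneg_imp_has_sum) auto
    also have "\<dots> \<le> \<bar>c i \<nu> $ j\<bar> * \<rho> ^ deg \<nu>"
      by (intro mult_left_mono series_le_summable(2)[OF mono(1) t]) auto
    finally show ?thesis .
  qed
  have "(\<lambda>\<nu>. \<Sum>\<^sub>\<infinity>k. norm (g \<nu> k)) summable_on UNIV"
    by (rule summable_on_comparison_test[OF power_series_abs_summable[OF power_series_component \<rho>]])
       (use g_total in \<open>auto intro: infsum_nonneg\<close>)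
  then have outer: "(\<lambda>\<nu>. norm (\<Sum>\<^sub>\<infinity>k. norm (g \<nu> k))) summable_on UNIV"
    by (rule iffD1[OF summable_on_iff_abs_summable_on_real])
  have "(\<lambda>p. norm (case p of (\<nu>, k) \<Rightarrow> g \<nu> k)) summable_on (UNIV \<times> UNIV)"
    unfolding Infinite_Sum.abs_summable_on_Sigma_iff prod.case using norm_g_summable outer by blast
  then have "(\<Sum>\<^sub>\<infinity>\<nu>. \<Sum>\<^sub>\<infinity>k. g \<nu> k) = (\<Sum>\<^sub>\<infinity>k. \<Sum>\<^sub>\<infinity>\<nu>. g \<nu> k)"
    by (rule infsum_swap_banach[OF Infinite_Sum.abs_summable_summable])
  moreover have "(\<Sum>\<^sub>\<infinity>\<nu>. \<Sum>\<^sub>\<infinity>k. g \<nu> k) = V i (taylor_sum t) $ j"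
  proof -
    have "(\<Sum>\<^sub>\<infinity>\<nu>. \<Sum>\<^sub>\<infinity>k. g \<nu> k) = (\<Sum>\<^sub>\<infinity>\<nu>. monomial \<nu> (taylor_sum t) * c i \<nu> $ j)"
      by (intro infsum_cong infsumI) (use g_has_sum in \<open>simp add: mult.commute\<close>)
    then show ?thesis using infsumI[OF power_series_component[OF taylor_sum_in_ball[OF t]]] by simp
  qed
  moreover have "(\<Sum>\<^sub>\<infinity>\<nu>. g \<nu> k) = expansion_term k (\<lambda>x. V i x $ j) t" for k
  proof -
    have "(\<Sum>\<^sub>\<infinity>\<nu>. g \<nu> k) = (\<Sum>\<^sub>\<infinity>\<nu>\<in>{\<nu>. deg \<nu> \<le> k}. g \<nu> k)"
      by (intro infsum_cong_neutral) (auto simp: g_def expansion_term_monomial_high)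
    then show ?thesis
      using expansion_term_power_series[OF V power_series_component \<rho> order_refl, of k t]
      by (simp add: infsum_finite finite_deg_le g_def)
  qed
  moreover have "summable (\<lambda>k. norm (expansion_term k (\<lambda>x. V i x $ j) t))"
    using series_le_summable(1)[OF V_series t] by simp
  then have "(\<lambda>k. expansion_term k (\<lambda>x. V i x $ j) t) sums (\<Sum>\<^sub>\<infinity>k. expansion_term k (\<lambda>x. V i x $ j) t)"
    by (intro has_sum_imp_sums has_sum_infsum norm_summable_imp_summable_on)
  ultimately show "(\<lambda>k. expansion_term k (\<lambda>x. V i x $ j) t) sums (V i (taylor_sum t) $ j)" by simp
qed

text \<open>The coordinate terms of degrees 1 to N + 1 are the integrals of the field terms of
  degrees 0 to N, and the remainder bound is uniform in N because the norms of the integrands stay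
  below \<open>majorant\<close>. Letting N tend to infinity gives the equation for the sum.\<close>

lemma taylor_sum_expansion:
  "negligible_on T (\<lambda>s t. taylor_sum t $ j - taylor_sum s $ j
     - (\<Sum>i\<in>UNIV. V i (taylor_sum s) $ j * (y t $ i - y s $ i)))"
proof (rule negligible_onI[OF \<alpha>\<beta>(2)])
  fix s t assume st: "0 \<le> s" "s \<le> t" "t \<le> T"
  define F where "F N t = (\<Sum>k\<le>N. expansion_term (Suc k) (coord j) t)" for N t
  define f where "f N i t = (\<Sum>k\<le>N. expansion_term k (\<lambda>x. V i x $ j) t)" for N i t
  have f: "hnorm_le (f N i) majorant" for N i
    unfolding f_def by (rule series_le_partial_sum) (use converges_vector_field in \<open>auto simp: converges_def\<close>)
  have "F N t - F N s - (\<Sum>i\<in>UNIV. f N i s * (y t $ i - y s $ i))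
      = (\<Sum>k\<le>N. expansion_term (Suc k) (coord j) t - expansion_term (Suc k) (coord j) s
          - (\<Sum>i\<in>UNIV. expansion_term k (\<lambda>x. V i x $ j) s * (y t $ i - y s $ i)))" for N s t
    unfolding F_def f_def sum_subtractf sum_distrib_right by (subst sum.swap) simp
  then have F: "negligible_on T (\<lambda>s t. F N t - F N s - (\<Sum>i\<in>UNIV. f N i s * (y t $ i - y s $ i)))" for N
    by (simp add: negligible_on_sum expansion_term_coord_expansion)
  have F_lim: "(\<lambda>N. F N t) \<longlonglongrightarrow> taylor_sum t $ j - x0 $ j" if "0 \<le> t" "t \<le> T" for t
  proof -
    have "(\<lambda>k. expansion_term k (coord j) t) sums coord j (taylor_sum t)"
      using converges_coord that by (simp add: converges_def)
    moreover have "expansion_term 0 (coord j) t = 0" by (simp add: expansion_term_degree_0 coord_def)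
    ultimately show ?thesis
      using sums_Suc_iff[of "\<lambda>k. expansion_term k (coord j) t" "coord j (taylor_sum t)"]
      by (simp add: F_def sums_def_le[symmetric] coord_def)
  qed
  have f_lim: "(\<lambda>N. f N i t) \<longlonglongrightarrow> V i (taylor_sum t) $ j" if "0 \<le> t" "t \<le> T" for t i
    using converges_vector_field that by (simp add: f_def converges_def sums_def_le)
  have "(\<lambda>N. \<bar>F N t - F N s - (\<Sum>i\<in>UNIV. f N i s * (y t $ i - y s $ i))\<bar>)
      \<longlonglongrightarrow> \<bar>(taylor_sum t $ j - x0 $ j) - (taylor_sum s $ j - x0 $ j)
        - (\<Sum>i\<in>UNIV. V i (taylor_sum s) $ j * (y t $ i - y s $ i))\<bar>"
    using st by (intro tendsto_intros F_lim f_lim) auto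
  then show "norm (taylor_sum t $ j - taylor_sum s $ j - (\<Sum>i\<in>UNIV. V i (taylor_sum s) $ j * (y t $ i - y s $ i)))
      \<le> sewing_const (\<alpha> + \<beta>) * (K * (\<Sum>i\<in>(UNIV::'m set). majorant)) * (t - s) powr (\<alpha> + \<beta>)"
    using integral_remainder_bound[OF f F st] by (auto intro: LIMSEQ_le_const2)
qed

lemma taylor_sum_hnorm_le: "hnorm_le (\<lambda>t. taylor_sum t $ j - x0 $ j) \<rho>"
proof (rule hnorm_le_limit)
  show "hnorm_le (\<lambda>t. \<Sum>k\<le>N. expansion_term k (coord j) t) \<rho>" for N
    by (rule series_le_partial_sum[OF series_le_coord])
  show "(\<lambda>N. \<Sum>k\<le>N. expansion_term k (coord j) t) \<longlonglongrightarrow> taylor_sum t $ j - x0 $ j" if "0 \<le> t" "t \<le> T" for t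
    using converges_coord[of j] that by (simp add: converges_def sums_def_le coord_def)
qed

end

section \<open>Uniqueness\<close>

lemma dir_deriv_basis:
  fixes f :: "real ^ 'n \<Rightarrow> 'b::real_normed_vector"
  assumes "f differentiable (at x)"
  shows "dir_deriv v f x = (\<Sum>k\<in>UNIV. v $ k *\<^sub>R dir_deriv (axis k 1) f x)"
proof -
  interpret linear "\<lambda>v. dir_deriv v f x"
    using has_derivative_dir_deriv[OF assms] by (rule has_derivative_linear)
  have "dir_deriv (\<Sum>k\<in>UNIV. v $ k *\<^sub>R axis k 1) f x = (\<Sum>k\<in>UNIV. v $ k *\<^sub>R dir_deriv (axis k 1) f x)"
    by (simp add: sum scale)
  then show ?thesis by (simp add: basis_expansion flip: scalar_mult_eq_scaleR)
qed

text \<open>Mean value inequality for \<open>\<lambda>z. W (z + e) - W z\<close>. Its derivative in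
  direction v is expanded in coordinate directions, where the Lipschitz bound is available; hence
  the factor \<open>CARD('n)\<close>.\<close>

lemma second_difference_bound:
  fixes W :: "real ^ 'n \<Rightarrow> 'b::real_normed_vector"
  assumes W: "\<And>x. W differentiable (at x)"
    and lip: "\<And>k. L'-lipschitz_on UNIV (dir_deriv (axis k 1) W)"
  shows "norm ((W (z + e) - W z) - (W (z' + e) - W z')) \<le> (real CARD('n) * L' * norm e) * norm (z - z')"
proof (rule differentiable_bound[OF convex_UNIV])
  let ?\<psi>' = "\<lambda>x v. dir_deriv v W (x + e) - dir_deriv v W x"
  fix x
  show "((\<lambda>z. W (z + e) - W z) has_derivative ?\<psi>' x) (at x within UNIV)"
  proof (rule has_derivative_diff)
    have "((\<lambda>x. x + e) has_derivative (\<lambda>x. x)) (at x)" by (auto intro!: derivative_eq_intros)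
    from has_derivative_compose[OF this has_derivative_dir_deriv[OF W]]
    show "((\<lambda>z. W (z + e)) has_derivative (\<lambda>v. dir_deriv v W (x + e))) (at x within UNIV)" by simp
  qed (use has_derivative_dir_deriv[OF W] in simp)
  show "onorm (?\<psi>' x) \<le> real CARD('n) * L' * norm e"
  proof (rule onorm_le)
    fix v :: "real ^ 'n"
    have "?\<psi>' x v = (\<Sum>k\<in>UNIV. v $ k *\<^sub>R (dir_deriv (axis k 1) W (x + e) - dir_deriv (axis k 1) W x))"
      by (simp add: dir_deriv_basis[OF W, of v] sum_subtractf scaleR_diff_right)
    also have "norm \<dots> \<le> (\<Sum>k\<in>(UNIV::'n set). norm v * (L' * norm e))"
    proof (rule sum_norm_le)
      fix k
      have "norm (dir_deriv (axis k 1) W (x + e) - dir_deriv (axis k 1) W x) \<le> L' * norm e"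
        using lipschitz_onD[OF lip, of "x + e" x k] by (simp add: dist_norm)
      then show "norm (v $ k *\<^sub>R (dir_deriv (axis k 1) W (x + e) - dir_deriv (axis k 1) W x)) \<le> norm v * (L' * norm e)"
        unfolding norm_scaleR using component_le_norm_cart[of v k] by (intro mult_mono) auto
    qed
    finally show "norm (?\<psi>' x v) \<le> real CARD('n) * L' * norm e * norm v" by (simp add: mult_ac)
  qed
qed auto

text \<open>Insert \<open>W (z + (x' - z'))\<close>: the Lipschitz bound of \<open>W\<close>
  compares it with \<open>W x\<close>, and what is left is a second difference with the common shift
  \<open>x' - z'\<close>.\<close>

lemma difference_of_differences_bound:
  fixes W :: "real ^ 'n \<Rightarrow> 'b::real_normed_vector"
  assumes W: "\<And>x. W differentiable (at x)" and L: "L-lipschitz_on UNIV W"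
    and lip: "\<And>k. L'-lipschitz_on UNIV (dir_deriv (axis k 1) W)"
  shows "norm ((W x - W z) - (W x' - W z'))
    \<le> L * norm ((x - z) - (x' - z')) + (real CARD('n) * L' * norm (x' - z')) * norm (z - z')"
proof -
  have "norm (W x - W (z + (x' - z'))) \<le> L * norm ((x - z) - (x' - z'))"
    using lipschitz_onD[OF L, of x "z + (x' - z')"] by (simp add: dist_norm algebra_simps)
  moreover have "norm ((W (z + (x' - z')) - W z) - (W x' - W z')) \<le> (real CARD('n) * L' * norm (x' - z')) * norm (z - z')"
    using second_difference_bound[OF W lip, of z "x' - z'" z'] by simp
  ultimately show ?thesis
    using norm_triangle_ineq[of "W x - W (z + (x' - z'))" "(W (z + (x' - z')) - W z) - (W x' - W z')"]
    by (simp add: algebra_simps)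
qed

context taylor_interval
begin

lemma hnorm_le_vec_increment:
  fixes D :: "real \<Rightarrow> real ^ 'k"
  assumes "\<And>j. hnorm_le (\<lambda>t. D t $ j) q" and st: "0 \<le> s" "s \<le> t" "t \<le> T"
  shows "norm (D t - D s) \<le> real CARD('k) * q * (t - s) powr \<alpha>"
proof -
  have "norm (D t - D s) \<le> (\<Sum>j\<in>UNIV. \<bar>(D t - D s) $ j\<bar>)" by (rule norm_le_l1_cart)
  also have "\<dots> \<le> (\<Sum>j\<in>(UNIV :: 'k set). q * (t - s) powr \<alpha>)"
    using hnorm_leD[OF assms(1) st] by (intro sum_mono) simp
  finally show ?thesis by simp
qed

text \<open>Any bound q on the norm of the components of \<open>X - Z\<close> improves to q / 2,
  because \<open>X - Z\<close> is the integral of the differences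
  \<open>V i (X s) - V i (Z s)\<close>. Iteration from the finite bound \<open>q0\<close> leaves
  only 0.\<close>

lemma young_ode_unique:
  fixes X Z :: "real \<Rightarrow> real ^ 'n"
  assumes lip: "\<And>i. L-lipschitz_on UNIV (V i)"
    and lip': "\<And>i k. L'-lipschitz_on UNIV (dir_deriv (axis k 1) (V i))"
    and X: "\<And>j. negligible_on T (\<lambda>s t. X t $ j - X s $ j - (\<Sum>i\<in>UNIV. V i (X s) $ j * (y t $ i - y s $ i)))"
    and Z: "\<And>j. negligible_on T (\<lambda>s t. Z t $ j - Z s $ j - (\<Sum>i\<in>UNIV. V i (Z s) $ j * (y t $ i - y s $ i)))"
    and init: "X 0 = Z 0"
    and regular: "\<And>j. hnorm_le (\<lambda>t. (X t - Z t) $ j) q0" and Z_bound: "\<And>j. hnorm_le (\<lambda>t. (Z t - x0) $ j) \<rho>"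
    and gain: "integral_gain * (real CARD('m) * (real CARD('n) * L + real CARD('n) ^ 3 * L' * \<rho>)) \<le> 1 / 2"
    and t: "0 \<le> t" "t \<le> T"
  shows "X t = Z t"
proof -
  \<comment> \<open>The first summand comes from the Lipschitz constant of the fields. In the
    second, one factor \<open>CARD('n)\<close> stems from the second difference and one each from
    passing from components to norms for \<open>X s - Z s\<close> and for
    \<open>Z t - Z s\<close>.\<close>
  define A where "A = real CARD('n) * L + real CARD('n) ^ 3 * L' * \<rho>"
  have L': "L' \<ge> 0" and L: "L \<ge> 0" using lip lip' lipschitz_on_nonneg by blast+
  have \<rho>: "\<rho> \<ge> 0" using hnorm_le_nonneg[OF Z_bound] .
  have contract: "hnorm_le (\<lambda>t. (X t - Z t) $ j) (q / 2)" if q: "\<And>j. hnorm_le (\<lambda>t. (X t - Z t) $ j) q" for q j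
  proof -
    have q0: "q \<ge> 0" using hnorm_le_nonneg[OF q] .
    have W: "hnorm_le (\<lambda>t. V i (X t) $ j - V i (Z t) $ j) (A * q)" for i
      unfolding hnorm_le_def
    proof (intro conjI allI impI)
      show "\<bar>V i (X 0) $ j - V i (Z 0) $ j\<bar> \<le> A * q"
        using init q0 L L' \<rho> by (simp add: A_def)
      fix s t assume st: "0 \<le> s" "s \<le> t" "t \<le> T"
      let ?h = "(t - s) powr \<alpha>" and ?n = "real CARD('n)"
      have D: "norm ((X t - Z t) - (X s - Z s)) \<le> ?n * q * ?h"
        by (rule hnorm_le_vec_increment[OF q st])
      have "norm ((X s - Z s) - (X 0 - Z 0)) \<le> ?n * q * (s - 0) powr \<alpha>"
        using st by (intro hnorm_le_vec_increment[OF q]) auto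
      also have "\<dots> \<le> ?n * q * 1"
        using powr_short[of s] st q0 by (intro mult_left_mono) auto
      finally have Ds: "norm (X s - Z s) \<le> ?n * q" using init by simp
      have "norm ((Z t - x0) - (Z s - x0)) \<le> ?n * \<rho> * ?h"
        by (rule hnorm_le_vec_increment[OF Z_bound st])
      then have Zts: "norm (Z t - Z s) \<le> ?n * \<rho> * ?h" by simp
      have "\<bar>(V i (X t) $ j - V i (Z t) $ j) - (V i (X s) $ j - V i (Z s) $ j)\<bar>
          \<le> norm ((V i (X t) - V i (Z t)) - (V i (X s) - V i (Z s)))"
        using component_le_norm_cart[of "(V i (X t) - V i (Z t)) - (V i (X s) - V i (Z s))" j] by simp
      also have "\<dots> \<le> L * norm ((X t - Z t) - (X s - Z s)) + (?n * L' * norm (X s - Z s)) * norm (Z t - Z s)"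
        by (rule difference_of_differences_bound[OF C_infinity_differentiable[OF smooth] lip lip'])
      also have "\<dots> \<le> L * (?n * q * ?h) + (?n * L' * (?n * q)) * (?n * \<rho> * ?h)"
        using D Ds Zts L L' q0 by (intro add_mono mult_left_mono mult_mono) auto
      also have "\<dots> = A * q * ?h" by (simp add: A_def algebra_simps power3_eq_cube)
      finally show "\<bar>(V i (X t) $ j - V i (Z t) $ j) - (V i (X s) $ j - V i (Z s) $ j)\<bar>
          \<le> (A * q - \<bar>V i (X 0) $ j - V i (Z 0) $ j\<bar>) * ?h"
        using init by simp
    qed
    have "negligible_on T (\<lambda>s t. (X t - Z t) $ j - (X s - Z s) $ j
        - (\<Sum>i\<in>UNIV. (V i (X s) $ j - V i (Z s) $ j) * (y t $ i - y s $ i)))"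
      using negligible_on_diff[OF X[of j] Z[of j]] by (simp add: left_diff_distrib sum_subtractf sum.distrib algebra_simps)
    then have "hnorm_le (\<lambda>t. (X t - Z t) $ j) (integral_gain * (\<Sum>i\<in>(UNIV::'m set). A * q))"
      using init by (intro integral_hnorm_le[OF W]) auto
    moreover have "integral_gain * (\<Sum>i\<in>(UNIV::'m set). A * q) \<le> q / 2"
      using mult_right_mono[OF gain[folded A_def] q0] by (simp add: mult_ac)
    ultimately show ?thesis by (rule hnorm_le_mono)
  qed
  have iter: "hnorm_le (\<lambda>t. (X t - Z t) $ j) (q0 * (1 / 2) ^ n)" for n j
  proof (induction n arbitrary: j)
    case (Suc n)
    from contract[OF Suc] show ?case by (simp add: mult.commute)
  qed (simp add: regular[simplified])
  have "(X t - Z t) $ j = 0" for j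
  proof -
    have "(\<lambda>n. q0 * (1 / 2) ^ n) \<longlonglongrightarrow> q0 * 0" by (intro tendsto_mult tendsto_const LIMSEQ_power_zero) simp
    moreover have "\<bar>(X t - Z t) $ j\<bar> \<le> q0 * (1 / 2) ^ n" for n using hnorm_le_bound[OF iter t] .
    ultimately have "\<bar>(X t - Z t) $ j\<bar> \<le> q0 * 0" by (intro LIMSEQ_le_const) auto
    then show ?thesis by simp
  qed
  then show ?thesis by (simp add: vec_eq_iff)
qed

end

section \<open>Solutions and Taylor terms\<close>

context taylor_data
begin

text \<open>The notion of solution provides only some unknown Hoelder exponents for the integrands.
  They suffice for the local expansion and for boundedness on \<open>[0, 1]\<close>, and from these
  \<open>X\<close> regains the exponent \<beta> of the driver.\<close>

lemma young_ode_solution_expansion: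
  assumes sol: "young_ode_solution V y x0 X"
  shows "negligible_on 1 (\<lambda>s t. X t $ j - X s $ j - (\<Sum>i\<in>UNIV. V i (X s) $ j * (y t $ i - y s $ i)))"
    and "holder_on \<beta> {0..1} (\<lambda>t. X t $ j)" and "X 0 = x0"
proof -
  define J where "J i j t = young_integral (\<lambda>s. V i (X s) $ j) (\<lambda>s. y s $ i) 0 t" for i j t
  have X: "X t $ j = x0 $ j + (\<Sum>i\<in>UNIV. J i j t)" if "t \<ge> 0" for t j
  proof -
    have "young_integral (\<lambda>s. V i (X s)) (\<lambda>s. y s $ i) 0 t $ j = J i j t" for i
    proof -
      have "young_integrable (\<lambda>s. V i (X s)) (\<lambda>s. y s $ i) 0 t"
        using sol that unfolding young_ode_solution_def by blast
      then obtain I where I: "has_young_integral (\<lambda>s. V i (X s)) (\<lambda>s. y s $ i) 0 t I"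
        unfolding young_integrable_def by blast
      show ?thesis
        unfolding J_def young_integral_eqI[OF I] young_integral_eqI[OF has_young_integral_component[OF I]] ..
    qed
    moreover have "X t = x0 + (\<Sum>i\<in>UNIV. young_integral (\<lambda>s. V i (X s)) (\<lambda>s. y s $ i) 0 t)"
      using sol that unfolding young_ode_solution_def by blast
    ultimately show ?thesis by simp
  qed
  have exponents: "\<exists>a b. a + b > 1 \<and> holder_on a {0..1} (\<lambda>s. V i (X s) $ j) \<and> holder_on b {0..1} (\<lambda>s. y s $ i)" for i j
  proof -
    have "young_integrable (\<lambda>s. V i (X s)) (\<lambda>s. y s $ i) 0 1"
      using sol zero_le_one unfolding young_ode_solution_def by blast
    then obtain I where "has_young_integral (\<lambda>s. V i (X s)) (\<lambda>s. y s $ i) 0 1 I"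
      unfolding young_integrable_def by blast
    from has_young_integral_component[OF this, of j] show ?thesis unfolding has_young_integral_def by blast
  qed
  have J: "negligible_on 1 (\<lambda>s t. J i j t - J i j s - V i (X s) $ j * (y t $ i - y s $ i))" for i j
    using exponents[of i j] young_integral_expansion unfolding J_def by fastforce
  have J0: "J i j 0 = 0" for i j
  proof -
    have "{0..0} \<subseteq> {0..1::real}" by auto
    then show ?thesis
      using exponents[of i j] unfolding J_def by (blast intro: young_integral_0 holder_on_subset)
  qed
  show "X 0 = x0" using X[of 0] by (simp add: J0 vec_eq_iff)
  have "negligible_on 1 (\<lambda>s t. \<Sum>i\<in>UNIV. J i j t - J i j s - V i (X s) $ j * (y t $ i - y s $ i))"
    by (intro negligible_on_sum J)
  then show neg: "negligible_on 1 (\<lambda>s t. X t $ j - X s $ j - (\<Sum>i\<in>UNIV. V i (X s) $ j * (y t $ i - y s $ i)))"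
    by (rule iffD1[OF negligible_on_cong, rotated]) (simp add: X sum_subtractf)
  have "\<forall>i. \<exists>M\<ge>0. \<forall>s. 0 \<le> s \<longrightarrow> s \<le> 1 \<longrightarrow> norm (V i (X s) $ j) \<le> M"
    using exponents holder_on_bounded by (metis (no_types, lifting))
  then obtain M where M: "\<And>i. M i \<ge> 0" "\<And>i s. 0 \<le> s \<Longrightarrow> s \<le> 1 \<Longrightarrow> \<bar>V i (X s) $ j\<bar> \<le> M i"
    by (metis real_norm_def)
  show "holder_on \<beta> {0..1} (\<lambda>t. X t $ j)"
  proof (rule holder_on_of_expansion[OF _ \<beta>(2) _ neg, where c = "\<Sum>i\<in>UNIV. M i * K"])
    fix s t :: real assume st: "0 \<le> s" "s \<le> t" "t \<le> 1"
    have "norm (\<Sum>i\<in>UNIV. V i (X s) $ j * (y t $ i - y s $ i)) \<le> (\<Sum>i\<in>UNIV. M i * (K * (t - s) powr \<beta>))"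
    proof (rule sum_norm_le)
      fix i
      have "\<bar>y t $ i - y s $ i\<bar> \<le> K * (t - s) powr \<beta>" using y_holder[of t s i] st by auto
      then show "norm (V i (X s) $ j * (y t $ i - y s $ i)) \<le> M i * (K * (t - s) powr \<beta>)"
        unfolding real_norm_def abs_mult using M st by (intro mult_mono) auto
    qed
    then show "norm (\<Sum>i\<in>UNIV. V i (X s) $ j * (y t $ i - y s $ i)) \<le> (\<Sum>i\<in>UNIV. M i * K) * (t - s) powr \<beta>"
      by (simp add: sum_distrib_right mult.assoc)
  qed (use \<beta> in auto)
qed

text \<open>Restricted to positive degree, where coordinates and centred coordinates have the same
  terms.\<close>

lemma taylor_term_component:
  "taylor_term V y x0 (Suc k) t $ j = expansion_term (Suc k) (coord j) t"
  unfolding expansion_term_coord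
  by (simp add: taylor_term_def expansion_term_def taylor_coeff_def word_deriv_def)

end

context analytic_taylor_interval
begin

lemma taylor_sum_0: "taylor_sum 0 = x0"
proof -
  have "expansion_term k (coord j) 0 = 0" for k j
    by (cases k) (simp_all add: expansion_term_Suc_at_0 expansion_term_degree_0 coord_def)
  then show ?thesis by (simp add: taylor_sum_def vec_eq_iff)
qed

lemma taylor_series_sums:
  assumes t: "0 \<le> t" "t \<le> T"
  shows "summable (\<lambda>k. norm (taylor_term V y x0 (Suc k) t))"
    and "taylor_sum t = x0 + (\<Sum>k. taylor_term V y x0 (Suc k) t)"
proof -
  have abs: "summable (\<lambda>k. \<bar>expansion_term (Suc k) (coord j) t\<bar>)" for j
    using series_le_summable(1)[OF series_le_coord t] by (subst summable_Suc_iff)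
  show summable: "summable (\<lambda>k. norm (taylor_term V y x0 (Suc k) t))"
  proof (rule summable_comparison_test'[where N = 0])
    show "summable (\<lambda>k. \<Sum>j\<in>UNIV. \<bar>expansion_term (Suc k) (coord j) t\<bar>)"
      by (intro summable_sum abs)
    show "norm (norm (taylor_term V y x0 (Suc k) t)) \<le> (\<Sum>j\<in>UNIV. \<bar>expansion_term (Suc k) (coord j) t\<bar>)" for k
      using norm_le_l1_cart[of "taylor_term V y x0 (Suc k) t"] by (simp add: taylor_term_component)
  qed
  have "(\<Sum>k. taylor_term V y x0 (Suc k) t) $ j = taylor_sum t $ j - x0 $ j" for j
  proof -
    have "(\<Sum>k. taylor_term V y x0 (Suc k) t) $ j = (\<Sum>k. taylor_term V y x0 (Suc k) t $ j)"
      by (rule bounded_linear.suminf[OF bounded_linear_vec_nth summable_norm_cancel[OF summable]])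
    also have "\<dots> = (\<Sum>k. expansion_term k (coord j) t) - expansion_term 0 (coord j) t"
      unfolding taylor_term_component
      by (rule suminf_split_head[OF summable_rabs_cancel[OF series_le_summable(1)[OF series_le_coord t]]])
    finally show ?thesis by (simp add: taylor_sum_def expansion_term_degree_0 coord_def)
  qed
  then show "taylor_sum t = x0 + (\<Sum>k. taylor_term V y x0 (Suc k) t)" by (simp add: vec_eq_iff)
qed

end

section \<open>Choice of the time interval and conclusion\<close>

theorem theorem2p4:
  fixes V :: "'m::finite \<Rightarrow> real ^ 'n \<Rightarrow> real ^ 'n"
    and y :: "real \<Rightarrow> real ^ 'm"
    and X :: "real \<Rightarrow> real ^ 'n"
    and x0 :: "real ^ 'n"
    and \<beta> C :: real
  assumes smooth: "\<And>i. C_infinity (V i)"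
    and lipschitz: "\<And>i. \<exists>L. L-lipschitz_on UNIV (V i)"
    and lipschitz_deriv: "\<And>i v. \<exists>L. L-lipschitz_on UNIV (\<lambda>x. frechet_derivative (V i) (at x) v)"
    and C: "C > 0"
    and analytic: "\<And>i. real_analytic_on (V i) {x. norm (x - x0) \<le> C}"
    and \<beta>: "\<beta> > 1 / 2"
    and holder: "\<And>T. holder_on \<beta> {0..T} y"
    and solution: "young_ode_solution V y x0 X"
  shows "\<exists>T>0. \<forall>t. 0 \<le> t \<and> t < T \<longrightarrow>
           summable (\<lambda>k. norm (taylor_term V y x0 (Suc k) t)) \<and>
           X t = x0 + (\<Sum>k. taylor_term V y x0 (Suc k) t)"
proof -
  \<comment> \<open>Capped at 1 as \<open>taylor_data\<close> demands; on \<open>[0, 1]\<close>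
    lowering the exponent costs only a factor 1.\<close>
  define \<gamma> where "\<gamma> = min \<beta> 1"
  have \<gamma>: "1 / 2 < \<gamma>" "\<gamma> \<le> 1" "\<gamma> \<le> \<beta>" using \<beta> by (auto simp: \<gamma>_def)
  obtain K where K: "K \<ge> 0" "\<And>s t. s \<in> {0..1} \<Longrightarrow> t \<in> {0..1} \<Longrightarrow> dist (y s) (y t) \<le> K * \<bar>s - t\<bar> powr \<beta>"
    using holder_onE[OF holder[of 1]] by metis
  interpret taylor_data V y x0 \<gamma> K
  proof
    fix s t :: real and i assume st: "s \<in> {0..1}" "t \<in> {0..1}"
    have "\<bar>y s $ i - y t $ i\<bar> \<le> dist (y s) (y t)"
      using dist_vec_nth_le[of "y s" i "y t"] by (simp add: dist_real_def)
    also have "\<dots> \<le> K * \<bar>s - t\<bar> powr \<beta>" by (rule K(2)[OF st])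
    also have "\<dots> \<le> K * (1 powr (\<beta> - \<gamma>) * \<bar>s - t\<bar> powr \<gamma>)"
      using st K(1) \<gamma> by (intro mult_left_mono powr_le_rescale) auto
    finally show "\<bar>y s $ i - y t $ i\<bar> \<le> K * \<bar>s - t\<bar> powr \<gamma>" by simp
  qed (use smooth \<gamma> K in auto)

  have "\<forall>i. \<exists>r>0. \<exists>c. \<forall>x\<in>ball x0 r. ((\<lambda>\<nu>. monomial \<nu> x *\<^sub>R c \<nu>) has_sum V i x) UNIV"
  proof
    fix i
    have "x0 \<in> {x. norm (x - x0) \<le> C}" using C by simp
    then show "\<exists>r>0. \<exists>c. \<forall>x\<in>ball x0 r. ((\<lambda>\<nu>. monomial \<nu> x *\<^sub>R c \<nu>) has_sum V i x) UNIV"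
      using analytic[of i] unfolding real_analytic_on_def monomial_def coord_def by (rule bspec[rotated])
  qed
  then obtain r' c where r': "\<And>i. r' i > 0"
    and c: "\<And>i x. x \<in> ball x0 (r' i) \<Longrightarrow> ((\<lambda>\<nu>. monomial \<nu> x *\<^sub>R c i \<nu>) has_sum V i x) UNIV"
    by metis
  define r where "r = Min (range r')"
  have r: "r > 0" "r \<le> r' i" for i using r' by (auto simp: r_def)
  \<comment> \<open>Then \<open>CARD('n) * \<rho>\<close> equals r / 2, strictly inside the
    radius.\<close>
  define \<rho> where "\<rho> = r / (2 * real CARD('n))"
  have \<rho>: "0 < \<rho>" "real CARD('n) * \<rho> < r" using r(1) by (auto simp: \<rho>_def)
  interpret analytic_taylor V y x0 \<gamma> K c r \<rho>
  proof unfold_locales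
    fix x i assume "x \<in> ball x0 r"
    then have "x \<in> ball x0 (r' i)" using r(2)[of i] by simp
    then show "((\<lambda>\<nu>. monomial \<nu> x *\<^sub>R c i \<nu>) has_sum V i x) UNIV" by (rule c)
  qed (use \<rho> in auto)

  obtain l where l: "\<And>i. (l i)-lipschitz_on UNIV (V i)" using lipschitz by metis
  \<comment> \<open>Indexing by pairs (i, k) allows a single maximum over a finite type.\<close>
  have "\<forall>p. \<exists>l. l-lipschitz_on UNIV (dir_deriv (axis (snd p) 1) (V (fst p)))"
    using lipschitz_deriv unfolding dir_deriv_def by blast
  from choice[OF this] obtain l'
    where l': "\<And>p. (l' p)-lipschitz_on UNIV (dir_deriv (axis (snd p) 1) (V (fst p)))" by blast
  define L where "L = Max (range l)"
  define L' where "L' = Max (range l')"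
  have L: "L-lipschitz_on UNIV (V i)" for i
    by (rule lipschitz_on_le[OF l]) (simp add: L_def)
  have L': "L'-lipschitz_on UNIV (dir_deriv (axis k 1) (V i))" for i k
    using lipschitz_on_le[OF l'[of "(i, k)"], of L'] by (simp add: L'_def)

  \<comment> \<open>This is \<open>integral_gain\<close> for \<alpha> = 1/2 as a function of T. It
    tends to 0 with T because \<gamma> > 1/2, so the requirements of convergence (\<open>A\<close>),
    of contraction (\<open>B\<close>) and of a short interval hold together for some small
    T.\<close>
  define gain where "gain T = K * (1 + sewing_const (1 / 2 + \<gamma>)) * T powr (\<gamma> - 1 / 2)" for T
  define A where "A = real CARD('m) * majorant"
  define B where "B = real CARD('m) * (real CARD('n) * L + real CARD('n) ^ 3 * L' * \<rho>)"
  have nonneg: "\<forall>\<^sub>F T in at_right (0::real). 0 \<le> T"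
    using eventually_at_right_less[of "0::real"] by (auto elim: eventually_mono)
  have powr_lim: "((\<lambda>T. T powr p) \<longlongrightarrow> 0) (at_right 0)" if "p > 0" for p :: real
  proof -
    have "((\<lambda>T. T powr p) \<longlongrightarrow> 0 powr p) (at_right 0)"
      by (intro tendsto_powr' tendsto_ident_at tendsto_const) (use that nonneg in simp)
    then show ?thesis by simp
  qed
  have "((\<lambda>T. gain T * A) \<longlongrightarrow> K * (1 + sewing_const (1 / 2 + \<gamma>)) * 0 * A) (at_right 0)"
    unfolding gain_def by (intro tendsto_mult tendsto_const powr_lim) (use \<gamma> in simp)
  then have 1: "\<forall>\<^sub>F T in at_right 0. gain T * A < \<rho>" using \<rho>(1) by (intro order_tendstoD) auto
  have "((\<lambda>T. gain T * B) \<longlongrightarrow> K * (1 + sewing_const (1 / 2 + \<gamma>)) * 0 * B) (at_right 0)"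
    unfolding gain_def by (intro tendsto_mult tendsto_const powr_lim) (use \<gamma> in simp)
  then have 2: "\<forall>\<^sub>F T in at_right 0. gain T * B < 1 / 2" by (intro order_tendstoD) auto
  have 3: "\<forall>\<^sub>F T in at_right (0::real). T powr (1 / 2) < 1 / 2"
    using powr_lim[of "1 / 2"] by (intro order_tendstoD) auto
  have 4: "\<forall>\<^sub>F T in at_right (0::real). 0 < T \<and> T < 1"
    unfolding eventually_at_right_field by (intro exI[where x = 1]) auto
  have "\<forall>\<^sub>F T in at_right 0. gain T * A < \<rho> \<and> gain T * B < 1 / 2 \<and> T powr (1 / 2) < 1 / 2 \<and> 0 < T \<and> T < 1"
    using 1 2 3 4 by eventually_elim blast
  then obtain T where T_small: "gain T * A < \<rho>" "gain T * B < 1 / 2" "T powr (1 / 2) < 1 / 2" "0 < T" "T < 1"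
    using eventually_happens'[OF trivial_limit_at_right_real] by blast

  interpret taylor_interval V y x0 \<gamma> K T "1 / 2"
    by unfold_locales (use T_small \<gamma> in auto)
  have gain: "integral_gain = gain T" by (simp add: integral_gain_def gain_def)
  interpret analytic_taylor_interval V y x0 \<gamma> K c r \<rho> T "1 / 2"
    by unfold_locales (use T_small(1) in \<open>simp add: gain A_def\<close>)

  have "\<exists>q. hnorm_le (\<lambda>t. X t $ j - x0 $ j) q" for j
  proof -
    have X0: "X 0 = x0" by (rule young_ode_solution_expansion(3)[OF solution])
    obtain q where q: "q \<ge> 0" "\<And>s t. s \<in> {0..1} \<Longrightarrow> t \<in> {0..1} \<Longrightarrow> dist (X s $ j) (X t $ j) \<le> q * \<bar>s - t\<bar> powr \<gamma>"
      using holder_onE[OF young_ode_solution_expansion(2)[OF solution]] by metis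
    have "\<bar>X t $ j - X s $ j\<bar> \<le> q * (t - s) powr (1 / 2)" if "0 \<le> s" "s \<le> t" "t \<le> T" for s t
    proof -
      have "\<bar>X t $ j - X s $ j\<bar> \<le> q * \<bar>t - s\<bar> powr \<gamma>"
        using q(2)[of t s] that T_small by (simp add: dist_real_def)
      also have "\<dots> \<le> q * (1 powr (\<gamma> - 1 / 2) * \<bar>t - s\<bar> powr (1 / 2))"
        using that T_small q(1) \<gamma> by (intro mult_left_mono powr_le_rescale) auto
      finally show ?thesis using that by simp
    qed
    then show ?thesis using q(1) X0 unfolding hnorm_le_def by (intro exI[where x = q]) auto
  qed
  then obtain q where q: "\<And>j. hnorm_le (\<lambda>t. X t $ j - x0 $ j) (q j)" by metis
  \<comment> \<open>Only finiteness counts: this bound starts the contraction and is halved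
    away.\<close>
  have regular: "hnorm_le (\<lambda>t. (X t - taylor_sum t) $ j) (Max (range q) + \<rho>)" for j
  proof -
    have "hnorm_le (\<lambda>t. (-1) * (taylor_sum t $ j - x0 $ j)) (\<bar>-1\<bar> * \<rho>)"
      by (rule hnorm_le_cmult[OF taylor_sum_hnorm_le])
    from hnorm_le_add[OF q this, of j] have "hnorm_le (\<lambda>t. (X t - taylor_sum t) $ j) (q j + \<rho>)"
      by simp
    then show ?thesis by (rule hnorm_le_mono) simp
  qed
  have "X t = taylor_sum t" if "0 \<le> t" "t \<le> T" for t
  proof (rule young_ode_unique[OF L L' _ taylor_sum_expansion _ regular _ _ that])
    show "negligible_on T (\<lambda>s t. X t $ j - X s $ j - (\<Sum>i\<in>UNIV. V i (X s) $ j * (y t $ i - y s $ i)))" for j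
      using T_small(5) by (intro negligible_on_mono[OF young_ode_solution_expansion(1)[OF solution]]) simp
    show "X 0 = taylor_sum 0"
      using young_ode_solution_expansion(3)[OF solution] taylor_sum_0 by simp
    show "hnorm_le (\<lambda>t. (taylor_sum t - x0) $ j) \<rho>" for j using taylor_sum_hnorm_le by simp
    show "integral_gain * (real CARD('m) * (real CARD('n) * L + real CARD('n) ^ 3 * L' * \<rho>)) \<le> 1 / 2"
      using T_small(2) by (simp add: gain B_def)
  qed
  then show ?thesis
    using T_small(4) taylor_series_sums by (intro exI[where x = T]) (auto simp: less_imp_le)
qed

end
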